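(* Let $\mathbf{k}$ be a field or $\mathbb{Z}$, let $G$ be a finite group, let $K$ be a simplicial $G$-complex on $m$ vertices, and let $(X,A)$ be a pair of connected based CW-complexes. Then for each $i$ there exists a $\mathbf{k}G$-module isomorphism $$\widetilde{H}_i((X,A)^K;\mathbf{k})\cong\bigoplus_{J\subseteq[m]}\widetilde{H}_i((X,A)^{\wedge K_J};\mathbf{k})\cong\bigoplus_{J\in[m]/G}\mathrm{Ind}_{G_J}^G\widetilde{H}_i((X,A)^{\wedge K_J};\mathbf{k}),$$ where $G$ acts on the middle term by permuting the summands such that $g\cdot\widetilde{H}_i((X,A)^{\wedge K_J};\mathbf{k})=\widetilde{H}_i((X,A)^{\wedge K_{g\cdot J}};\mathbf{k})$, $[m]/G$ is a set of representatives of the orbits of $2^{[m]}\setminus\{\emptyset\}$ under $G$, and $G_J$ is the stabiliser of $J$.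
   Context: $[m]=\{1,\dots,m\}$. A simplicial $G$-complex is a simplicial complex $K$ on vertex set $[m]$ with a $G$-action on $[m]$ such that the induced action on subsets of $[m]$ preserves $K$. For $J\subseteq[m]$, $K_J=\{\sigma\cap J\mid\sigma\in K\}$ is the full subcomplex on $J$, and $G_J=\{g\in G\mid g\cdot J=J\}$. Polyhedral product: $(X,A)^K=\bigcup_{I\in K}\{(x_1,\dots,x_m)\in X^m\mid x_j\in A\text{ for }j\notin I\}$. Polyhedral smash product: for non-empty $J\subseteq[m]$, $(X,A)^{\wedge K_J}=\bigcup_{\sigma\in K_J}(X,A)^{\wedge\sigma}$, where $(X,A)^{\wedge\sigma}$ is the subspace of $X^{\wedge J}$ (smash product of copies of $X$ indexed by $J$) of points whose $j$-th coordinate lies in $A$ for $j\in J\setminus\sigma$. The sum in the middle term runs over non-empty $J$. $G$ acts on $(X,A)^K$ by $(g\cdot x)_i=x_{g^{-1}\cdot i}$, and $g$ maps $(X,A)^{\wedge K_J}$ to $(X,A)^{\wedge K_{g\cdot J}}$ by sending the coordinate indexed by $i\in J$ to the coordinate indexed by $g\cdot i$; the actions on homology are the induced ones. *)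

theory Defs
  imports "HOL-Homology.Homology" "HOL-Algebra.Algebra" "HOL-Algebra.Algebraic_Closure_Type"
begin

text \<open>The polynomial variable of HOL-Algebra would otherwise claim the name \<open>X\<close>, used here for spaces.\<close>

no_notation var (\<open>X\<index>\<close>)

section \<open>Formal linear combinations and quotients\<close>

text \<open>
  The coefficient ring is a type \<open>'k\<close> of class \<^class>\<open>comm_ring_1\<close>; its record form in HOL-Algebra is
  \<^const>\<open>ring_of_type_algebra\<close>. The free module on a set \<open>S\<close> consists of the finitely supported
  functions with \<open>Poly_Mapping.keys c \<subseteq> S\<close>.
\<close>

definition lin_scale :: "'k::comm_ring_1 \<Rightarrow> ('x \<Rightarrow>\<^sub>0 'k) \<Rightarrow> 'x \<Rightarrow>\<^sub>0 'k"
  where "lin_scale r c = Poly_Mapping.map ((*) r) c"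

definition lin_extend :: "('x \<Rightarrow> 'y \<Rightarrow>\<^sub>0 'k) \<Rightarrow> ('x \<Rightarrow>\<^sub>0 'k) \<Rightarrow> 'y \<Rightarrow>\<^sub>0 'k::comm_ring_1"
  where "lin_extend F c = (\<Sum>x\<in>Poly_Mapping.keys c. lin_scale (Poly_Mapping.lookup c x) (F x))"

inductive_set lin_span :: "('x \<Rightarrow>\<^sub>0 'k::comm_ring_1) set \<Rightarrow> ('x \<Rightarrow>\<^sub>0 'k) set"
  for S :: "('x \<Rightarrow>\<^sub>0 'k) set"
  where
    zero: "0 \<in> lin_span S"
  | base: "s \<in> S \<Longrightarrow> s \<in> lin_span S"
  | add: "\<lbrakk>a \<in> lin_span S; b \<in> lin_span S\<rbrakk> \<Longrightarrow> a + b \<in> lin_span S"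
  | scale: "a \<in> lin_span S \<Longrightarrow> lin_scale r a \<in> lin_span S"

text \<open>
  The quotient \<open>Z/B\<close> of submodules \<open>B \<subseteq> Z\<close>, with cosets as elements. The record type of modules
  extends that of rings; the ring multiplication and its unit play no role for modules and
  are left undefined, here and below.
\<close>

definition quotient_module ::
    "('x \<Rightarrow>\<^sub>0 'k) set \<Rightarrow> ('x \<Rightarrow>\<^sub>0 'k) set \<Rightarrow> ('k::comm_ring_1, ('x \<Rightarrow>\<^sub>0 'k) set) module"
  where "quotient_module Z B =
    \<lparr>carrier = {{c + b | b. b \<in> B} | c. c \<in> Z},
     monoid.mult = undefined, monoid.one = undefined,
     ring.zero = B,
     ring.add = (\<lambda>\<alpha> \<beta>. {a + b | a b. a \<in> \<alpha> \<and> b \<in> \<beta>}),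
     module.smult = (\<lambda>r \<alpha>. {lin_scale r a + b | a b. a \<in> \<alpha> \<and> b \<in> B})\<rparr>"

text \<open>The map into \<open>Z/B\<close> induced by \<open>F\<close>: the coset of \<open>c\<close> goes to \<open>F c + B\<close>.\<close>

definition quotient_map_induced ::
    "('y \<Rightarrow>\<^sub>0 'k) set \<Rightarrow> (('x \<Rightarrow>\<^sub>0 'k) \<Rightarrow> 'y \<Rightarrow>\<^sub>0 'k) \<Rightarrow> ('x \<Rightarrow>\<^sub>0 'k) set \<Rightarrow> ('y \<Rightarrow>\<^sub>0 'k::comm_ring_1) set"
  where "quotient_map_induced B F \<alpha> = {F c + b | c b. c \<in> \<alpha> \<and> b \<in> B}"


section \<open>Reduced singular homology with coefficients\<close>

text \<open>
  This repeats \<^const>\<open>singular_chain\<close>, \<^const>\<open>chain_boundary\<close> and \<^const>\<open>chain_map\<close>, which are integral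
  only, over \<open>'k\<close>, and augments the complex in degree 0 by the sum of the coefficients.
\<close>

type_synonym ('a, 'k) lin_chain = "((nat \<Rightarrow> real) \<Rightarrow> 'a) \<Rightarrow>\<^sub>0 'k"

definition lin_boundary :: "nat \<Rightarrow> ('a, 'k) lin_chain \<Rightarrow> ('a, 'k::comm_ring_1) lin_chain"
  where "lin_boundary p =
    lin_extend (\<lambda>\<sigma>. \<Sum>k\<le>p. Poly_Mapping.single (singular_face p k \<sigma>) ((-1) ^ k))"

definition lin_chain_map :: "nat \<Rightarrow> ('a \<Rightarrow> 'b) \<Rightarrow> ('a, 'k) lin_chain \<Rightarrow> ('b, 'k::comm_ring_1) lin_chain"
  where "lin_chain_map p f = lin_extend (\<lambda>\<sigma>. Poly_Mapping.single (simplex_map p f \<sigma>) 1)"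

definition reduced_cycles :: "nat \<Rightarrow> 'a topology \<Rightarrow> ('a, 'k::comm_ring_1) lin_chain set"
  where "reduced_cycles p X =
    {c. Poly_Mapping.keys c \<subseteq> singular_simplex_set p X \<and>
        (if p = 0 then (\<Sum>\<sigma>\<in>Poly_Mapping.keys c. Poly_Mapping.lookup c \<sigma>) = 0
         else lin_boundary p c = 0)}"

definition boundaries :: "nat \<Rightarrow> 'a topology \<Rightarrow> ('a, 'k::comm_ring_1) lin_chain set"
  where "boundaries p X =
    lin_boundary (Suc p) ` {c. Poly_Mapping.keys c \<subseteq> singular_simplex_set (Suc p) X}"

definition reduced_homology ::
    "nat \<Rightarrow> 'a topology \<Rightarrow> ('k::comm_ring_1, ('a, 'k) lin_chain set) module"
  where "reduced_homology p X = quotient_module (reduced_cycles p X) (boundaries p X)"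

text \<open>The map induced by a continuous map \<open>f\<close> with codomain \<open>Y\<close>.\<close>

definition reduced_homology_map ::
    "nat \<Rightarrow> 'b topology \<Rightarrow> ('a \<Rightarrow> 'b) \<Rightarrow> ('a, 'k) lin_chain set \<Rightarrow> ('b, 'k::comm_ring_1) lin_chain set"
  where "reduced_homology_map p Y f = quotient_map_induced (boundaries p Y) (lin_chain_map p f)"


section \<open>Modules over a group ring\<close>

text \<open>
  A module over the group ring of \<open>G\<close> over \<open>R\<close>, given as an \<open>R\<close>-module with an \<open>R\<close>-linear action
  of \<open>G\<close>.
\<close>

locale group_ring_module = module R M + G: group G
  for R :: "'k ring" (structure) and G :: "('g, 'z) monoid_scheme" and M :: "('k, 'm) module" (structure) +
  fixes \<rho> :: "'g \<Rightarrow> 'm \<Rightarrow> 'm"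
  assumes act_closed: "\<lbrakk>g \<in> carrier G; x \<in> carrier M\<rbrakk> \<Longrightarrow> \<rho> g x \<in> carrier M"
    and act_add: "\<lbrakk>g \<in> carrier G; x \<in> carrier M; y \<in> carrier M\<rbrakk>
      \<Longrightarrow> \<rho> g (x \<oplus>\<^bsub>M\<^esub> y) = \<rho> g x \<oplus>\<^bsub>M\<^esub> \<rho> g y"
    and act_smult: "\<lbrakk>g \<in> carrier G; r \<in> carrier R; x \<in> carrier M\<rbrakk>
      \<Longrightarrow> \<rho> g (r \<odot>\<^bsub>M\<^esub> x) = r \<odot>\<^bsub>M\<^esub> \<rho> g x"
    and act_one: "x \<in> carrier M \<Longrightarrow> \<rho> \<one>\<^bsub>G\<^esub> x = x"
    and act_mult: "\<lbrakk>g \<in> carrier G; h \<in> carrier G; x \<in> carrier M\<rbrakk>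
      \<Longrightarrow> \<rho> (g \<otimes>\<^bsub>G\<^esub> h) x = \<rho> g (\<rho> h x)"

definition group_ring_isomorphic ::
    "'k ring \<Rightarrow> ('g, 'z) monoid_scheme \<Rightarrow> ('k, 'm) module \<Rightarrow> ('g \<Rightarrow> 'm \<Rightarrow> 'm)
      \<Rightarrow> ('k, 'n) module \<Rightarrow> ('g \<Rightarrow> 'n \<Rightarrow> 'n) \<Rightarrow> bool"
  where "group_ring_isomorphic R G M \<rho> N \<tau> \<longleftrightarrow>
    group_ring_module R G M \<rho> \<and> group_ring_module R G N \<tau> \<and>
    (\<exists>f. bij_betw f (carrier M) (carrier N) \<and>
      (\<forall>x\<in>carrier M. \<forall>y\<in>carrier M. f (x \<oplus>\<^bsub>M\<^esub> y) = f x \<oplus>\<^bsub>N\<^esub> f y) \<and>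
      (\<forall>r\<in>carrier R. \<forall>x\<in>carrier M. f (r \<odot>\<^bsub>M\<^esub> x) = r \<odot>\<^bsub>N\<^esub> f x) \<and>
      (\<forall>g\<in>carrier G. \<forall>x\<in>carrier M. f (\<rho> g x) = \<tau> g (f x)))"

definition direct_sum_module :: "'i set \<Rightarrow> ('i \<Rightarrow> ('k, 'm) module) \<Rightarrow> ('k, 'i \<Rightarrow> 'm) module"
  where "direct_sum_module I M =
    \<lparr>carrier = {f \<in> \<Pi>\<^sub>E i\<in>I. carrier (M i). finite {i \<in> I. f i \<noteq> \<zero>\<^bsub>M i\<^esub>}},
     monoid.mult = undefined, monoid.one = undefined,
     ring.zero = (\<lambda>i\<in>I. \<zero>\<^bsub>M i\<^esub>),
     ring.add = (\<lambda>f f'. \<lambda>i\<in>I. f i \<oplus>\<^bsub>M i\<^esub> f' i),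
     module.smult = (\<lambda>r f. \<lambda>i\<in>I. r \<odot>\<^bsub>M i\<^esub> f i)\<rparr>"

definition direct_sum_action :: "'i set \<Rightarrow> ('i \<Rightarrow> 'g \<Rightarrow> 'm \<Rightarrow> 'm) \<Rightarrow> 'g \<Rightarrow> ('i \<Rightarrow> 'm) \<Rightarrow> 'i \<Rightarrow> 'm"
  where "direct_sum_action I \<rho> g f = (\<lambda>i\<in>I. \<rho> i g (f i))"

text \<open>
  The induced module \<open>kG \<otimes> M\<close>, the tensor product being over \<open>kH\<close>: formal combinations of pairs
  \<open>(g, x)\<close>, standing for \<open>g \<otimes> x\<close>, modulo \<open>k\<close>-linearity in \<open>x\<close> and \<open>gh \<otimes> x = g \<otimes> hx\<close> for \<open>h \<in> H\<close>.
  Linearity in the factor \<open>kG\<close> is built in, because \<open>kG\<close> is free over \<open>k\<close> on the elements of \<open>G\<close>.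
\<close>

definition induced_relations ::
    "('g, 'z) monoid_scheme \<Rightarrow> 'g set \<Rightarrow> ('k, 'm) module \<Rightarrow> ('g \<Rightarrow> 'm \<Rightarrow> 'm)
      \<Rightarrow> ('g \<times> 'm \<Rightarrow>\<^sub>0 'k::comm_ring_1) set"
  where "induced_relations G H M \<rho> = lin_span
    ({Poly_Mapping.single (g, x \<oplus>\<^bsub>M\<^esub> y) 1 - Poly_Mapping.single (g, x) 1 - Poly_Mapping.single (g, y) 1
        | g x y. g \<in> carrier G \<and> x \<in> carrier M \<and> y \<in> carrier M} \<union>
     {Poly_Mapping.single (g, r \<odot>\<^bsub>M\<^esub> x) 1 - Poly_Mapping.single (g, x) r
        | g r x. g \<in> carrier G \<and> x \<in> carrier M} \<union>
     {Poly_Mapping.single (g \<otimes>\<^bsub>G\<^esub> h, x) 1 - Poly_Mapping.single (g, \<rho> h x) 1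
        | g h x. g \<in> carrier G \<and> h \<in> H \<and> x \<in> carrier M})"

definition induced_module ::
    "('g, 'z) monoid_scheme \<Rightarrow> 'g set \<Rightarrow> ('k, 'm) module \<Rightarrow> ('g \<Rightarrow> 'm \<Rightarrow> 'm)
      \<Rightarrow> ('k::comm_ring_1, ('g \<times> 'm \<Rightarrow>\<^sub>0 'k) set) module"
  where "induced_module G H M \<rho> =
    quotient_module {c. Poly_Mapping.keys c \<subseteq> carrier G \<times> carrier M} (induced_relations G H M \<rho>)"

definition induced_action ::
    "('g, 'z) monoid_scheme \<Rightarrow> 'g set \<Rightarrow> ('k, 'm) module \<Rightarrow> ('g \<Rightarrow> 'm \<Rightarrow> 'm)
      \<Rightarrow> 'g \<Rightarrow> ('g \<times> 'm \<Rightarrow>\<^sub>0 'k) set \<Rightarrow> ('g \<times> 'm \<Rightarrow>\<^sub>0 'k::comm_ring_1) set"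
  where "induced_action G H M \<rho> g =
    quotient_map_induced (induced_relations G H M \<rho>)
      (lin_extend (\<lambda>(g', x). Poly_Mapping.single (g \<otimes>\<^bsub>G\<^esub> g', x) 1))"


section \<open>CW-complexes\<close>

text \<open>
  A cell is given by its dimension \<open>n\<close> and its characteristic map, defined on the closed unit
  disk of \<^term>\<open>Euclidean_space n\<close>. For \<open>n = 0\<close> the closed and the open disk are both a
  point and the bounding sphere is empty.
\<close>

definition closed_disk :: "nat \<Rightarrow> (nat \<Rightarrow> real) set"
  where "closed_disk n = {x \<in> topspace (Euclidean_space n). (\<Sum>i<n. (x i)\<^sup>2) \<le> 1}"

definition open_disk :: "nat \<Rightarrow> (nat \<Rightarrow> real) set"
  where "open_disk n = {x \<in> topspace (Euclidean_space n). (\<Sum>i<n. (x i)\<^sup>2) < 1}"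

type_synonym 'a cell = "nat \<times> ((nat \<Rightarrow> real) \<Rightarrow> 'a)"

definition closed_cell :: "'a cell \<Rightarrow> 'a set"
  where "closed_cell e = snd e ` closed_disk (fst e)"

definition open_cell :: "'a cell \<Rightarrow> 'a set"
  where "open_cell e = snd e ` open_disk (fst e)"

definition cell_frontier :: "'a cell \<Rightarrow> 'a set"
  where "cell_frontier e = snd e ` (closed_disk (fst e) - open_disk (fst e))"

text \<open>
  Whitehead's definition: the last two conditions are closure finiteness and the weak topology.
\<close>

definition cw_structure :: "'a topology \<Rightarrow> 'a cell set \<Rightarrow> bool"
  where "cw_structure X C \<longleftrightarrow>
    Hausdorff_space X \<and>
    (\<forall>(n, \<Phi>)\<in>C. continuous_map (subtopology (Euclidean_space n) (closed_disk n)) X \<Phi> \<and>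
                embedding_map (subtopology (Euclidean_space n) (open_disk n)) X \<Phi>) \<and>
    topspace X = (\<Union>e\<in>C. open_cell e) \<and>
    pairwise (\<lambda>e e'. disjnt (open_cell e) (open_cell e')) C \<and>
    (\<forall>e\<in>C. \<exists>F\<subseteq>C. finite F \<and> (\<forall>e'\<in>F. fst e' < fst e) \<and> cell_frontier e \<subseteq> (\<Union>e'\<in>F. open_cell e')) \<and>
    (\<forall>S\<subseteq>topspace X. (\<forall>e\<in>C. closedin X (S \<inter> closed_cell e)) \<longrightarrow> closedin X S)"

definition cw_subcomplex :: "'a cell set \<Rightarrow> 'a set \<Rightarrow> bool"
  where "cw_subcomplex C A \<longleftrightarrow>
    (\<exists>D\<subseteq>C. A = (\<Union>e\<in>D. open_cell e) \<and> (\<forall>e\<in>D. closed_cell e \<subseteq> A))"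

text \<open>The base point is a 0-cell of the subcomplex \<open>A\<close>.\<close>

definition based_cw_pair :: "'a topology \<Rightarrow> 'a set \<Rightarrow> 'a \<Rightarrow> bool"
  where "based_cw_pair X A pt \<longleftrightarrow>
    (\<exists>C. cw_structure X C \<and> cw_subcomplex C A \<and>
         pt \<in> A \<and> (\<exists>e\<in>C. fst e = 0 \<and> open_cell e = {pt}))"


section \<open>Simplicial complexes with a group action\<close>

text \<open>The empty simplex is always present. Elements of \<open>V\<close> need not be simplices.\<close>

definition simplicial_complex_on :: "'v set \<Rightarrow> 'v set set \<Rightarrow> bool"
  where "simplicial_complex_on V K \<longleftrightarrow>
    {} \<in> K \<and> (\<forall>\<sigma>\<in>K. finite \<sigma> \<and> \<sigma> \<subseteq> V) \<and> (\<forall>\<sigma>\<in>K. \<forall>\<tau>\<subseteq>\<sigma>. \<tau> \<in> K)"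

definition simplicial_group_complex ::
    "('g, 'z) monoid_scheme \<Rightarrow> ('g \<Rightarrow> 'v \<Rightarrow> 'v) \<Rightarrow> 'v set \<Rightarrow> 'v set set \<Rightarrow> bool"
  where "simplicial_group_complex G \<phi> V K \<longleftrightarrow>
    simplicial_complex_on V K \<and> group_action G V \<phi> \<and>
    (\<forall>g\<in>carrier G. \<forall>\<sigma>\<in>K. \<phi> g ` \<sigma> \<in> K)"

definition full_subcomplex :: "'v set set \<Rightarrow> 'v set \<Rightarrow> 'v set set"
  where "full_subcomplex K J = {\<sigma> \<inter> J | \<sigma>. \<sigma> \<in> K}"


section \<open>Polyhedral products and polyhedral smash products\<close>

definition polyhedral_product ::
    "'a topology \<Rightarrow> 'a set \<Rightarrow> 'v set \<Rightarrow> 'v set set \<Rightarrow> ('v \<Rightarrow> 'a) topology"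
  where "polyhedral_product X A V K =
    subtopology (product_topology (\<lambda>_. X) V) (\<Union>I\<in>K. {x. \<forall>j\<in>V - I. x j \<in> A})"

definition quotient_topology :: "'a topology \<Rightarrow> ('a \<Rightarrow> 'b) \<Rightarrow> 'b topology"
  where "quotient_topology X q =
    topology (\<lambda>U. U \<subseteq> q ` topspace X \<and> openin X {x \<in> topspace X. q x \<in> U})"

lemma openin_quotient_topology:
  "openin (quotient_topology X q) U \<longleftrightarrow>
    U \<subseteq> q ` topspace X \<and> openin X {x \<in> topspace X. q x \<in> U}"
proof -
  have "istopology (\<lambda>U. U \<subseteq> q ` topspace X \<and> openin X {x \<in> topspace X. q x \<in> U})"
    unfolding istopology_def
  proof (intro conjI allI impI)
    fix S T
    assume S: "S \<subseteq> q ` topspace X \<and> openin X {x \<in> topspace X. q x \<in> S}"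
      and T: "T \<subseteq> q ` topspace X \<and> openin X {x \<in> topspace X. q x \<in> T}"
    have "{x \<in> topspace X. q x \<in> S \<inter> T} =
        {x \<in> topspace X. q x \<in> S} \<inter> {x \<in> topspace X. q x \<in> T}"
      by auto
    with S T show "openin X {x \<in> topspace X. q x \<in> S \<inter> T}"
      by auto
    show "S \<inter> T \<subseteq> q ` topspace X"
      using S by auto
  next
    fix \<K>
    assume K: "\<forall>S\<in>\<K>. S \<subseteq> q ` topspace X \<and> openin X {x \<in> topspace X. q x \<in> S}"
    have "{x \<in> topspace X. q x \<in> \<Union>\<K>} = (\<Union>S\<in>\<K>. {x \<in> topspace X. q x \<in> S})"
      by auto
    with K show "openin X {x \<in> topspace X. q x \<in> \<Union>\<K>}"
      by auto
    show "\<Union>\<K> \<subseteq> q ` topspace X"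
      using K by auto
  qed
  then show ?thesis
    unfolding quotient_topology_def by (simp only: topology_inverse')
qed

lemma topspace_quotient_topology [simp]: "topspace (quotient_topology X q) = q ` topspace X"
proof
  show "topspace (quotient_topology X q) \<subseteq> q ` topspace X"
    using openin_quotient_topology[of X q "topspace (quotient_topology X q)"] by simp
  have "{x \<in> topspace X. q x \<in> q ` topspace X} = topspace X"
    by auto
  then have "openin (quotient_topology X q) (q ` topspace X)"
    by (simp add: openin_quotient_topology)
  then show "q ` topspace X \<subseteq> topspace (quotient_topology X q)"
    by (rule openin_subset)
qed

lemma quotient_map_quotient_topology: "quotient_map X (quotient_topology X q) q"
  by (simp add: quotient_map_def openin_quotient_topology)

text \<open>
  The points of the smash power are the tuples without a coordinate equal to the base point,
  together with the constant tuple at the base point, which represents the collapsed fat wedge.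
\<close>

definition collapse_fat_wedge :: "'a \<Rightarrow> 'v set \<Rightarrow> ('v \<Rightarrow> 'a) \<Rightarrow> 'v \<Rightarrow> 'a"
  where "collapse_fat_wedge pt J x = (if \<exists>j\<in>J. x j = pt then \<lambda>j\<in>J. pt else x)"

definition smash_power :: "'a topology \<Rightarrow> 'a \<Rightarrow> 'v set \<Rightarrow> ('v \<Rightarrow> 'a) topology"
  where "smash_power X pt J =
    quotient_topology (product_topology (\<lambda>_. X) J) (collapse_fat_wedge pt J)"

definition polyhedral_smash ::
    "'a topology \<Rightarrow> 'a set \<Rightarrow> 'a \<Rightarrow> 'v set \<Rightarrow> 'v set set \<Rightarrow> ('v \<Rightarrow> 'a) topology"
  where "polyhedral_smash X A pt J L =
    subtopology (smash_power X pt J) (\<Union>\<sigma>\<in>L. {y. \<forall>j\<in>J - \<sigma>. y j \<in> A})"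

text \<open>The tuple indexed by \<open>g J\<close> obtained from a tuple \<open>x\<close> indexed by \<open>J\<close>.\<close>

definition permute_coords ::
    "('g, 'z) monoid_scheme \<Rightarrow> ('g \<Rightarrow> 'v \<Rightarrow> 'v) \<Rightarrow> 'v set \<Rightarrow> 'g \<Rightarrow> ('v \<Rightarrow> 'a) \<Rightarrow> 'v \<Rightarrow> 'a"
  where "permute_coords G \<phi> J g x = (\<lambda>i\<in>\<phi> g ` J. x (\<phi> (inv\<^bsub>G\<^esub> g) i))"


section \<open>The homology modules in the decomposition\<close>

definition product_homology_action ::
    "'a topology \<Rightarrow> 'a set \<Rightarrow> 'v set \<Rightarrow> 'v set set \<Rightarrow> ('g, 'z) monoid_scheme \<Rightarrow> ('g \<Rightarrow> 'v \<Rightarrow> 'v) \<Rightarrow> nat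
      \<Rightarrow> 'g \<Rightarrow> ('v \<Rightarrow> 'a, 'k) lin_chain set \<Rightarrow> ('v \<Rightarrow> 'a, 'k::comm_ring_1) lin_chain set"
  where "product_homology_action X A V K G \<phi> i g =
    reduced_homology_map i (polyhedral_product X A V K) (permute_coords G \<phi> V g)"

definition smash_homology ::
    "'a topology \<Rightarrow> 'a set \<Rightarrow> 'a \<Rightarrow> 'v set set \<Rightarrow> nat \<Rightarrow> 'v set
      \<Rightarrow> ('k::comm_ring_1, ('v \<Rightarrow> 'a, 'k) lin_chain set) module"
  where "smash_homology X A pt K i J =
    reduced_homology i (polyhedral_smash X A pt J (full_subcomplex K J))"

text \<open>The map from the module of \<open>J\<close> to the module of \<open>g J\<close>.\<close>

definition smash_homology_map ::
    "'a topology \<Rightarrow> 'a set \<Rightarrow> 'a \<Rightarrow> 'v set set \<Rightarrow> ('g, 'z) monoid_scheme \<Rightarrow> ('g \<Rightarrow> 'v \<Rightarrow> 'v) \<Rightarrow> nat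
      \<Rightarrow> 'v set \<Rightarrow> 'g \<Rightarrow> ('v \<Rightarrow> 'a, 'k) lin_chain set \<Rightarrow> ('v \<Rightarrow> 'a, 'k::comm_ring_1) lin_chain set"
  where "smash_homology_map X A pt K G \<phi> i J g =
    reduced_homology_map i
      (polyhedral_smash X A pt (\<phi> g ` J) (full_subcomplex K (\<phi> g ` J)))
      (permute_coords G \<phi> J g)"

text \<open>
  The action permuting the summands: the component of \<open>g f\<close> at \<open>J\<close> is the image of the component
  of \<open>f\<close> at \<open>J'\<close>, where \<open>J' = g\<inverse> J\<close>.
\<close>

definition smash_sum_action ::
    "'a topology \<Rightarrow> 'a set \<Rightarrow> 'a \<Rightarrow> 'v set set \<Rightarrow> ('g, 'z) monoid_scheme \<Rightarrow> ('g \<Rightarrow> 'v \<Rightarrow> 'v) \<Rightarrow> nat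
      \<Rightarrow> 'v set set \<Rightarrow> 'g \<Rightarrow> ('v set \<Rightarrow> ('v \<Rightarrow> 'a, 'k) lin_chain set)
      \<Rightarrow> 'v set \<Rightarrow> ('v \<Rightarrow> 'a, 'k::comm_ring_1) lin_chain set"
  where "smash_sum_action X A pt K G \<phi> i \<J> g f =
    (\<lambda>J\<in>\<J>. let J' = \<phi> (inv\<^bsub>G\<^esub> g) ` J in smash_homology_map X A pt K G \<phi> i J' g (f J'))"

definition orbit_representatives ::
    "('g, 'z) monoid_scheme \<Rightarrow> ('g \<Rightarrow> 'v \<Rightarrow> 'v) \<Rightarrow> 'v set set \<Rightarrow> 'v set set \<Rightarrow> bool"
  where "orbit_representatives G \<phi> \<J> T \<longleftrightarrow>
    T \<subseteq> \<J> \<and> (\<forall>\<O>\<in>orbits G \<J> (\<lambda>g J. \<phi> g ` J). \<exists>!J. J \<in> T \<inter> \<O>)"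

definition set_stabilizer ::
    "('g, 'z) monoid_scheme \<Rightarrow> ('g \<Rightarrow> 'v \<Rightarrow> 'v) \<Rightarrow> 'v set \<Rightarrow> 'g set"
  where "set_stabilizer G \<phi> J = stabilizer G (\<lambda>g J. \<phi> g ` J) J"

end

theory Submission
  imports Defs "HOL-Analysis.Abstract_Topological_Spaces"
begin

text \<open>
  Write \<open>Y\<close> for the polyhedral product and \<open>Q\<^sub>J\<close> for the polyhedral smash product on \<open>J\<close>.
  Restricting a tuple to \<open>J\<close> and collapsing the tuples with a coordinate at the base point is a map
  \<open>Y \<rightarrow> Q\<^sub>J\<close>, and the first isomorphism is the map from the homology of \<open>Y\<close> to the sum of the
  homologies of the \<open>Q\<^sub>J\<close> that these projections induce. It commutes with \<open>G\<close> because the projections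
  do: restricting \<open>g x\<close> to \<open>g J\<close> is \<open>g\<close> applied to the restriction of \<open>x\<close> to \<open>J\<close>. All the work is in
  the bijectivity, a statement about the spaces and their chains.

  Moving the coordinates outside \<open>J\<close> to the base point is a retraction \<open>r\<^sub>J\<close> of \<open>Y\<close> onto a subspace
  \<open>Y\<^sub>J\<close>, and \<open>r\<^sub>J r\<^sub>L\<close> is the retraction for \<open>J \<inter> L\<close>. On chains, the alternating sums \<open>e\<^sub>J\<close> of the
  \<open>r\<^sub>L\<close> with \<open>L \<subseteq> J\<close> (\<open>moebius_part\<close>) are therefore orthogonal idempotent chain maps whose sum is the
  identity. The operator \<open>e\<^sub>J\<close> kills every chain that is a sum of chains of the faces
  \<open>Y\<^bsub>J - {j}\<^esub>\<close> with \<open>j \<in> J\<close>, and it differs from \<open>r\<^sub>J\<close> by such sums. So the summand \<open>e\<^sub>J\<close> of the chains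
  of \<open>Y\<close> computes the homology of \<open>Y\<^sub>J\<close> relative to its faces, and it has to be compared with the
  homology of \<open>Q\<^sub>J\<close> relative to the base point, \<open>Q\<^sub>J\<close> being obtained from \<open>Y\<^sub>J\<close> by collapsing
  the union of the faces (\<open>homology_splitting_injective\<close>, \<open>homology_splitting_surjective\<close>). For the empty
  set the summand consists of the chains at the base point and does not contribute to reduced homology.

  This comparison is excision for a collapsed subspace (\<open>collapse_injective\<close>, \<open>collapse_surjective\<close>).
  It needs a homotopy of \<open>Y\<^sub>J\<close> that maps every face to itself and ends by moving a neighbourhood of every
  face into that face. Applying one homotopy of \<open>X\<close> to all coordinates gives it, provided that the
  homotopy fixes the base point, maps a neighbourhood of the base point to it in the end, and respects \<open>A\<close>.
  For a CW-pair such a homotopy is the first component of a retraction of \<open>X \<times> [0,1]\<close> to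
  \<open>X \<times> {0} \<union> {pt} \<times> [0,1]\<close> that is constructed cell by cell (\<open>based_cw_pair_contraction\<close>).

  The second isomorphism is algebra. The summands are permuted by \<open>G\<close>, and for every representative \<open>J\<close>
  of an orbit and every \<open>J'\<close> in the orbit some \<open>t\<close> is chosen with \<open>t J = J'\<close>; the component \<open>x\<close> at \<open>J'\<close>
  corresponds to \<open>t \<otimes> t\<^sup>-\<^sup>1 x\<close> in the module induced from the stabiliser of \<open>J\<close>
  (\<open>sum_isomorphic_induced\<close>).
\<close>

section \<open>Linear maps between free modules\<close>

lemma lookup_lin_scale [simp]: "Poly_Mapping.lookup (lin_scale r c) x = r * Poly_Mapping.lookup c x"
  by (simp add: lin_scale_def Poly_Mapping.map.rep_eq when_def)

lemma lin_scale_add_right: "lin_scale r (a + b) = lin_scale r a + lin_scale r b"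
  by (rule poly_mapping_eqI) (simp add: lookup_add distrib_left)

lemma lin_scale_add_left: "lin_scale (r + s) a = lin_scale r a + lin_scale s a"
  by (rule poly_mapping_eqI) (simp add: lookup_add distrib_right)

lemma lin_scale_lin_scale [simp]: "lin_scale r (lin_scale s a) = lin_scale (r * s) a"
  by (rule poly_mapping_eqI) (simp add: mult.assoc)

lemma lin_scale_one [simp]: "lin_scale 1 a = a"
  by (rule poly_mapping_eqI) simp

lemma lin_scale_zero [simp]: "lin_scale 0 a = 0" "lin_scale r 0 = 0"
  by (rule poly_mapping_eqI, simp)+

lemma lin_scale_single [simp]: "lin_scale r (Poly_Mapping.single x a) = Poly_Mapping.single x (r * a)"
  by (rule poly_mapping_eqI) (simp add: lookup_single when_def)

lemma lin_scale_minus_one: "lin_scale (-1) a = - a"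
  by (rule poly_mapping_eqI) simp

lemma lin_scale_sum: "lin_scale r (sum f I) = (\<Sum>i\<in>I. lin_scale r (f i))"
  by (induction I rule: infinite_finite_induct) (auto simp: lin_scale_add_right)

lemma keys_lin_scale: "Poly_Mapping.keys (lin_scale r c) \<subseteq> Poly_Mapping.keys c"
  by (auto simp: in_keys_iff)

definition lin_map :: "(('x \<Rightarrow>\<^sub>0 'k::comm_ring_1) \<Rightarrow> 'y \<Rightarrow>\<^sub>0 'k) \<Rightarrow> bool"
  where "lin_map F \<longleftrightarrow> (\<forall>a b. F (a + b) = F a + F b) \<and> (\<forall>r a. F (lin_scale r a) = lin_scale r (F a))"

lemma lin_map_add: "lin_map F \<Longrightarrow> F (a + b) = F a + F b"
  and lin_map_scale: "lin_map F \<Longrightarrow> F (lin_scale r a) = lin_scale r (F a)"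
  by (auto simp: lin_map_def)

lemma lin_map_zero: "lin_map F \<Longrightarrow> F 0 = 0"
  using lin_map_scale[of F 0 0] by simp

lemma lin_map_minus: "lin_map F \<Longrightarrow> F (- a) = - F a"
  using lin_map_scale[of F "-1" a] by (simp add: lin_scale_minus_one)

lemma lin_map_diff: "lin_map F \<Longrightarrow> F (a - b) = F a - F b"
  using lin_map_add[of F a "- b"] by (simp add: lin_map_minus)

lemma lin_map_sum: "lin_map F \<Longrightarrow> F (sum f I) = (\<Sum>i\<in>I. F (f i))"
  by (induction I rule: infinite_finite_induct) (auto simp: lin_map_add lin_map_zero)

lemma lin_expand: "c = (\<Sum>x\<in>Poly_Mapping.keys c. lin_scale (Poly_Mapping.lookup c x) (Poly_Mapping.single x 1))"
proof (rule poly_mapping_eqI)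
  fix y
  show "Poly_Mapping.lookup c y =
      Poly_Mapping.lookup (\<Sum>x\<in>Poly_Mapping.keys c. lin_scale (Poly_Mapping.lookup c x) (Poly_Mapping.single x 1)) y"
    by (auto simp: lookup_sum lookup_single when_def sum.delta in_keys_iff)
qed

lemma lin_extend_superset:
  assumes "finite S" "Poly_Mapping.keys c \<subseteq> S"
  shows "lin_extend F c = (\<Sum>x\<in>S. lin_scale (Poly_Mapping.lookup c x) (F x))"
  unfolding lin_extend_def
  by (rule sum.mono_neutral_left) (use assms in \<open>auto simp: in_keys_iff\<close>)

lemma lin_map_lin_extend: "lin_map (lin_extend F)"
  unfolding lin_map_def
proof (intro conjI allI)
  fix a b :: "'a \<Rightarrow>\<^sub>0 'b" and r
  let ?S = "Poly_Mapping.keys a \<union> Poly_Mapping.keys b"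
  have "lin_extend F (a + b) = (\<Sum>x\<in>?S. lin_scale (Poly_Mapping.lookup (a + b) x) (F x))"
    by (rule lin_extend_superset) (simp_all add: keys_add)
  also have "\<dots> = lin_extend F a + lin_extend F b"
    by (simp add: lin_extend_superset[of ?S] lookup_add lin_scale_add_left sum.distrib)
  finally show "lin_extend F (a + b) = lin_extend F a + lin_extend F b" .
  show "lin_extend F (lin_scale r a) = lin_scale r (lin_extend F a)"
    by (subst lin_extend_superset[of "Poly_Mapping.keys a"])
       (auto simp: keys_lin_scale lin_extend_def lin_scale_sum)
qed

lemma lin_extend_single [simp]: "lin_extend F (Poly_Mapping.single x a) = lin_scale a (F x)"
  by (subst lin_extend_superset[of "{x}"]) auto

lemma lin_map_eqI:
  assumes "lin_map F" "lin_map G"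
    and "\<And>x. x \<in> Poly_Mapping.keys c \<Longrightarrow> F (Poly_Mapping.single x 1) = G (Poly_Mapping.single x 1)"
  shows "F c = G c"
proof -
  let ?e = "\<lambda>x. lin_scale (Poly_Mapping.lookup c x) (Poly_Mapping.single x 1)"
  have "F (sum ?e (Poly_Mapping.keys c)) = G (sum ?e (Poly_Mapping.keys c))"
    unfolding lin_map_sum[OF assms(1)] lin_map_sum[OF assms(2)]
      lin_map_scale[OF assms(1)] lin_map_scale[OF assms(2)]
    by (intro sum.cong refl arg_cong[where f = "lin_scale _"] assms(3))
  then show ?thesis
    unfolding lin_expand[symmetric, of c] .
qed

lemma lin_map_comp: "\<lbrakk>lin_map F; lin_map G\<rbrakk> \<Longrightarrow> lin_map (\<lambda>c. F (G c))"
  by (auto simp: lin_map_def)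

lemma lin_map_ident: "lin_map (\<lambda>c. c)"
  by (auto simp: lin_map_def)

lemma lin_map_plus: "\<lbrakk>lin_map F; lin_map G\<rbrakk> \<Longrightarrow> lin_map (\<lambda>c. F c + G c)"
  by (auto simp: lin_map_def lin_scale_add_right)

lemma lin_scale_diff_right: "lin_scale r (a - b) = lin_scale r a - lin_scale r b"
  by (rule poly_mapping_eqI) (simp add: lookup_minus right_diff_distrib)

lemma lin_map_minus': "\<lbrakk>lin_map F; lin_map G\<rbrakk> \<Longrightarrow> lin_map (\<lambda>c. F c - G c)"
  by (auto simp: lin_map_def lin_scale_diff_right)

section \<open>Change of coefficients\<close>

definition of_int_chain :: "('x \<Rightarrow>\<^sub>0 int) \<Rightarrow> 'x \<Rightarrow>\<^sub>0 'k::comm_ring_1"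
  where "of_int_chain = Poly_Mapping.map of_int"

lemma lookup_of_int_chain [simp]:
  "Poly_Mapping.lookup (of_int_chain c) x = of_int (Poly_Mapping.lookup c x)"
  by (simp add: of_int_chain_def Poly_Mapping.map.rep_eq when_def)

lemma of_int_chain_simps [simp]:
  "of_int_chain 0 = 0" "of_int_chain (a - b) = of_int_chain a - of_int_chain b"
  "of_int_chain (a + b) = of_int_chain a + of_int_chain b"
  "of_int_chain (frag_of x) = Poly_Mapping.single x 1"
  "of_int_chain (frag_cmul k a) = lin_scale (of_int k) (of_int_chain a)"
  by (rule poly_mapping_eqI, simp add: lookup_minus lookup_add lookup_single when_def)+

lemma of_int_chain_sum: "of_int_chain (sum f I) = (\<Sum>i\<in>I. of_int_chain (f i))"
  by (induction I rule: infinite_finite_induct) auto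

lemma keys_of_int_chain: "Poly_Mapping.keys (of_int_chain c) \<subseteq> Poly_Mapping.keys c"
  by (auto simp: in_keys_iff)

text \<open>
  An additive operator on integral chains determines a linear operator over every ring of coefficients.
  The operators on singular chains and the identities between them are carried over from the integers in
  this way.
\<close>

definition scalar_ext :: "(('x \<Rightarrow>\<^sub>0 int) \<Rightarrow> 'y \<Rightarrow>\<^sub>0 int) \<Rightarrow> ('x \<Rightarrow>\<^sub>0 'k) \<Rightarrow> 'y \<Rightarrow>\<^sub>0 'k::comm_ring_1"
  where "scalar_ext T = lin_extend (\<lambda>x. of_int_chain (T (frag_of x)))"

lemma lin_map_scalar_ext [simp]: "lin_map (scalar_ext T)"
  by (simp add: scalar_ext_def lin_map_lin_extend)

lemma scalar_ext_single [simp]: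
  "scalar_ext T (Poly_Mapping.single x a) = lin_scale a (of_int_chain (T (frag_of x)))"
  by (simp add: scalar_ext_def)

definition additive_op :: "(('x \<Rightarrow>\<^sub>0 int) \<Rightarrow> 'y \<Rightarrow>\<^sub>0 int) \<Rightarrow> bool"
  where "additive_op T \<longleftrightarrow> (\<forall>a b. T (a - b) = T a - T b)"

lemma scalar_ext_of_int_chain:
  assumes "additive_op T"
  shows "scalar_ext T (of_int_chain c) = of_int_chain (T c)"
proof -
  have T: "T (a - b) = T a - T b" for a b
    using assms by (simp add: additive_op_def)
  have [simp]: "T 0 = 0"
    using T[of 0 0] by simp
  show ?thesis
    using subset_UNIV
    by (induction c rule: frag_induction) (auto simp: T lin_map_diff lin_map_zero)
qed

lemma scalar_ext_comp:
  assumes "additive_op T"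
  shows "scalar_ext T (scalar_ext T' c) = scalar_ext (\<lambda>a. T (T' a)) c"
  by (rule lin_map_eqI[where F = "\<lambda>c. scalar_ext T (scalar_ext T' c)"
        and G = "scalar_ext (\<lambda>a. T (T' a))"])
     (simp_all add: lin_map_comp[OF lin_map_scalar_ext lin_map_scalar_ext] scalar_ext_of_int_chain assms)

lemma scalar_ext_cong:
  assumes "\<And>x. x \<in> Poly_Mapping.keys c \<Longrightarrow> T (frag_of x) = T' (frag_of x)"
  shows "scalar_ext T c = scalar_ext T' c"
  using assms by (simp add: scalar_ext_def lin_extend_def)

lemma scalar_ext_plus: "scalar_ext (\<lambda>a. T a + T' a) c = scalar_ext T c + scalar_ext T' c"
  by (rule lin_map_eqI[where G = "\<lambda>c. scalar_ext T c + scalar_ext T' c"]) (simp_all add: lin_map_plus[OF lin_map_scalar_ext lin_map_scalar_ext])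

lemma scalar_ext_minus: "scalar_ext (\<lambda>a. T a - T' a) c = scalar_ext T c - scalar_ext T' c"
  by (rule lin_map_eqI[where G = "\<lambda>c. scalar_ext T c - scalar_ext T' c"]) (simp_all add: lin_map_minus'[OF lin_map_scalar_ext lin_map_scalar_ext])

lemma scalar_ext_ident: "scalar_ext (\<lambda>a. a) c = c"
  by (rule lin_map_eqI[where G = "\<lambda>c. c"]) (simp_all add: lin_map_ident)


section \<open>Chains with coefficients\<close>

abbreviation chains :: "nat \<Rightarrow> 'a topology \<Rightarrow> ('a, 'k::comm_ring_1) lin_chain set"
  where "chains p X \<equiv> {c. Poly_Mapping.keys c \<subseteq> singular_simplex_set p X}"

text \<open>
  The sum of the chain groups of the members of \<open>\<F>\<close>. In general it is smaller than the chain group of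
  their union.
\<close>

definition small_chains :: "nat \<Rightarrow> 'a topology \<Rightarrow> 'a set set \<Rightarrow> ('a, 'k::comm_ring_1) lin_chain set"
  where "small_chains p X \<F> =
    {c. \<forall>\<sigma>\<in>Poly_Mapping.keys c. \<exists>S\<in>\<F>. singular_simplex p (subtopology X S) \<sigma>}"

lemma small_chains_UNIV: "small_chains p X {UNIV} = chains p X"
  by (auto simp: small_chains_def)

lemma small_chains_sub: "small_chains p X \<F> \<subseteq> chains p X"
  by (auto simp: small_chains_def singular_simplex_subtopology)

lemma small_chains_chain: "c \<in> small_chains p X \<F> \<Longrightarrow> c \<in> chains p X"
  using small_chains_sub by blast

lemma small_chains_mono:
  assumes "c \<in> small_chains p X \<F>" "\<And>S. S \<in> \<F> \<Longrightarrow> \<exists>T\<in>\<G>. S \<inter> topspace X \<subseteq> T"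
  shows "c \<in> small_chains p X \<G>"
proof -
  have "\<exists>T\<in>\<G>. singular_simplex p (subtopology X T) \<sigma>"
    if "S \<in> \<F>" "singular_simplex p (subtopology X S) \<sigma>" for S \<sigma>
    using that assms(2)[OF that(1)]
    by (metis singular_simplex_mono subtopology_restrict inf_commute)
  then show ?thesis
    using assms(1) by (fastforce simp: small_chains_def)
qed

lemma small_chains_zero [simp]: "0 \<in> small_chains p X \<F>"
  by (simp add: small_chains_def)

lemma small_chains_add: "\<lbrakk>a \<in> small_chains p X \<F>; b \<in> small_chains p X \<F>\<rbrakk> \<Longrightarrow> a + b \<in> small_chains p X \<F>"
  using keys_add[of a b] by (fastforce simp: small_chains_def)

lemma small_chains_diff: "\<lbrakk>a \<in> small_chains p X \<F>; b \<in> small_chains p X \<F>\<rbrakk> \<Longrightarrow> a - b \<in> small_chains p X \<F>"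
  using keys_diff[of a b] by (fastforce simp: small_chains_def)

lemma small_chains_minus: "a \<in> small_chains p X \<F> \<Longrightarrow> - a \<in> small_chains p X \<F>"
  using small_chains_diff[of 0 p X \<F> a] by simp

lemma small_chains_sum: "(\<And>i. i \<in> I \<Longrightarrow> f i \<in> small_chains p X \<F>) \<Longrightarrow> sum f I \<in> small_chains p X \<F>"
  by (induction I rule: infinite_finite_induct) (auto simp: small_chains_add)

lemma small_chains_scale: "a \<in> small_chains p X \<F> \<Longrightarrow> lin_scale r a \<in> small_chains p X \<F>"
  using keys_lin_scale[of r a] by (fastforce simp: small_chains_def)

lemma chains_zero [simp]: "0 \<in> chains p X"
  and chains_add: "\<lbrakk>a \<in> chains p X; b \<in> chains p X\<rbrakk> \<Longrightarrow> a + b \<in> chains p X"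
  and chains_diff: "\<lbrakk>a \<in> chains p X; b \<in> chains p X\<rbrakk> \<Longrightarrow> a - b \<in> chains p X"
  and chains_scale: "a \<in> chains p X \<Longrightarrow> lin_scale r a \<in> chains p X"
  and chains_sum: "(\<And>i. i \<in> I \<Longrightarrow> f i \<in> chains p X) \<Longrightarrow> sum f I \<in> chains p X"
  unfolding small_chains_UNIV[symmetric]
  by (simp_all add: small_chains_add small_chains_diff small_chains_scale small_chains_sum)

lemma small_chains_split:
  assumes "c \<in> small_chains p X (\<F> \<union> \<G>)"
  obtains a b where "a \<in> small_chains p X \<F>" "b \<in> small_chains p X \<G>" "c = a + b"
proof
  let ?S = "{\<sigma> \<in> Poly_Mapping.keys c. \<exists>S\<in>\<F>. singular_simplex p (subtopology X S) \<sigma>}"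
  let ?e = "\<lambda>\<sigma>. Poly_Mapping.single \<sigma> (Poly_Mapping.lookup c \<sigma>)"
  show "sum ?e ?S \<in> small_chains p X \<F>"
    by (intro small_chains_sum) (auto simp: small_chains_def)
  show "sum ?e (Poly_Mapping.keys c - ?S) \<in> small_chains p X \<G>"
    by (intro small_chains_sum) (use assms in \<open>auto simp: small_chains_def\<close>)
  have "c = sum ?e (Poly_Mapping.keys c)"
    using lin_expand[of c] by simp
  then show "c = sum ?e ?S + sum ?e (Poly_Mapping.keys c - ?S)"
    by (subst add.commute) (subst sum.subset_diff[of ?S, symmetric], auto)
qed

lemma scalar_ext_small_chains:
  assumes "c \<in> small_chains p X \<F>"
    and "\<And>S d. \<lbrakk>S \<in> \<F>; singular_chain p (subtopology X S) d\<rbrakk>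
            \<Longrightarrow> \<exists>S'\<in>\<G>. singular_chain q (subtopology Y S') (T d)"
  shows "scalar_ext T c \<in> small_chains q Y \<G>"
proof -
  have "of_int_chain (T (frag_of \<sigma>)) \<in> small_chains q Y \<G>" if "\<sigma> \<in> Poly_Mapping.keys c" for \<sigma>
  proof -
    obtain S where "S \<in> \<F>" "singular_simplex p (subtopology X S) \<sigma>"
      using \<open>\<sigma> \<in> Poly_Mapping.keys c\<close> assms(1) by (auto simp: small_chains_def)
    then obtain S' where "S' \<in> \<G>" "singular_chain q (subtopology Y S') (T (frag_of \<sigma>))"
      using assms(2)[of S "frag_of \<sigma>"] by (auto simp: singular_chain_of)
    then show ?thesis
      using keys_of_int_chain[of "T (frag_of \<sigma>)"]
      by (fastforce simp: small_chains_def singular_chain_def)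
  qed
  then show ?thesis
    unfolding scalar_ext_def lin_extend_def by (intro small_chains_sum small_chains_scale)
qed

text \<open>Identities between integral chain operators only hold on singular chains, and carry over to
  the extensions of scalars.\<close>

lemma scalar_ext_cong_chains:
  assumes "c \<in> chains p X" "\<And>d. singular_chain p X d \<Longrightarrow> T d = T' d"
  shows "scalar_ext T c = scalar_ext T' c"
  by (rule scalar_ext_cong) (use assms in \<open>auto simp: singular_chain_of\<close>)

lemma additive_op_simps [simp]:
  "additive_op (chain_boundary p)" "additive_op (chain_map p f)" "additive_op (singular_subdivision p ^^ n)"
  by (simp_all add: additive_op_def chain_boundary_diff chain_map_diff singular_subdivision_power_diff)

text \<open>
  Contrary to \<^const>\<open>lin_boundary\<close> this boundary vanishes in degree 0, so that identities with
  the truncated difference \<open>p - Suc 0\<close> hold in all degrees.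
\<close>

definition bd :: "nat \<Rightarrow> ('a, 'k::comm_ring_1) lin_chain \<Rightarrow> ('a, 'k) lin_chain"
  where "bd p = scalar_ext (chain_boundary p)"

lemma bd_0 [simp]: "bd 0 c = 0"
  by (simp add: bd_def scalar_ext_def lin_extend_def chain_boundary_def)

lemma lin_boundary_eq_bd: "p \<noteq> 0 \<Longrightarrow> lin_boundary p = bd p"
  by (simp add: bd_def scalar_ext_def lin_boundary_def chain_boundary_of of_int_chain_sum)

lemma lin_chain_map_eq: "lin_chain_map p f = scalar_ext (chain_map p f)"
  by (simp add: lin_chain_map_def scalar_ext_def)

lemma lin_map_bd [simp]: "lin_map (bd p)"
  and lin_map_lin_chain_map [simp]: "lin_map (lin_chain_map p f)"
  by (simp_all add: bd_def lin_chain_map_eq)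

lemmas bd_simps = lin_map_bd[THEN lin_map_add] lin_map_bd[THEN lin_map_diff] lin_map_bd[THEN lin_map_zero]
  lin_map_bd[THEN lin_map_minus] lin_map_bd[THEN lin_map_scale] lin_map_bd[THEN lin_map_sum]

lemmas lin_chain_map_simps = lin_map_lin_chain_map[THEN lin_map_add] lin_map_lin_chain_map[THEN lin_map_diff]
  lin_map_lin_chain_map[THEN lin_map_zero] lin_map_lin_chain_map[THEN lin_map_minus]
  lin_map_lin_chain_map[THEN lin_map_scale] lin_map_lin_chain_map[THEN lin_map_sum]

lemma bd_small_chains: "c \<in> small_chains p X \<F> \<Longrightarrow> bd p c \<in> small_chains (p - Suc 0) X \<F>"
  unfolding bd_def by (erule scalar_ext_small_chains) (auto intro: singular_chain_boundary)

lemma bd_chains: "c \<in> chains p X \<Longrightarrow> bd p c \<in> chains (p - Suc 0) X"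
  using bd_small_chains[of c p X "{UNIV}"] by (simp only: small_chains_UNIV)

lemma bd_bd: "c \<in> chains p X \<Longrightarrow> bd (p - Suc 0) (bd p c) = 0"
  unfolding bd_def
  by (subst scalar_ext_comp[OF additive_op_simps(1)], subst scalar_ext_cong_chains[where T' = "\<lambda>_. 0"])
     (auto simp: chain_boundary_boundary scalar_ext_def lin_extend_def)

lemma lin_chain_map_small_chains:
  assumes "c \<in> small_chains p X \<F>" "continuous_map X Y f"
    and "\<And>S. S \<in> \<F> \<Longrightarrow> \<exists>S'\<in>\<G>. \<forall>x\<in>S \<inter> topspace X. f x \<in> S'"
  shows "lin_chain_map p f c \<in> small_chains p Y \<G>"
  unfolding lin_chain_map_eq
proof (rule scalar_ext_small_chains[OF assms(1)])
  fix S and d :: "'a chain"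
  assume S: "S \<in> \<F>" and d: "singular_chain p (subtopology X S) d"
  obtain S' where S': "S' \<in> \<G>" "\<forall>x\<in>S \<inter> topspace X. f x \<in> S'"
    using assms(3) S by blast
  then have "continuous_map (subtopology X S) (subtopology Y S') f"
    using assms(2) by (auto simp: continuous_map_in_subtopology continuous_map_from_subtopology)
  then show "\<exists>S'\<in>\<G>. singular_chain p (subtopology Y S') (chain_map p f d)"
    using S' d singular_chain_chain_map by blast
qed

lemma lin_chain_map_chains:
  "\<lbrakk>c \<in> chains p X; continuous_map X Y f\<rbrakk> \<Longrightarrow> lin_chain_map p f c \<in> chains p Y"
  using lin_chain_map_small_chains[of c p X "{UNIV}" Y f "{UNIV}"] by (simp only: small_chains_UNIV) simp

lemma bd_lin_chain_map: "c \<in> chains p X \<Longrightarrow> bd p (lin_chain_map p f c) = lin_chain_map (p - Suc 0) f (bd p c)"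
  unfolding bd_def lin_chain_map_eq
  by (subst scalar_ext_comp[OF additive_op_simps(1)], subst scalar_ext_comp[OF additive_op_simps(2)])
     (auto intro: scalar_ext_cong_chains simp: chain_boundary_chain_map)

lemma lin_chain_map_comp: "lin_chain_map p g (lin_chain_map p f c) = lin_chain_map p (g \<circ> f) c"
  unfolding lin_chain_map_eq
  by (subst scalar_ext_comp[OF additive_op_simps(2)]) (simp add: chain_map_compose comp_def[of "chain_map p g"])

lemma lin_chain_map_cong:
  "\<lbrakk>c \<in> chains p X; \<And>x. x \<in> topspace X \<Longrightarrow> f x = g x\<rbrakk> \<Longrightarrow> lin_chain_map p f c = lin_chain_map p g c"
  unfolding lin_chain_map_eq by (erule scalar_ext_cong_chains) (rule chain_map_eq)

lemma lin_chain_map_id: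
  assumes "c \<in> chains p X" "\<And>x. x \<in> topspace X \<Longrightarrow> f x = x"
  shows "lin_chain_map p f c = c"
proof -
  have "lin_chain_map p f c = scalar_ext (\<lambda>d. d) c"
    unfolding lin_chain_map_eq
    by (rule scalar_ext_cong_chains[OF assms(1)]) (simp add: assms(2) chain_map_id_gen)
  then show ?thesis
    by (simp add: scalar_ext_ident)
qed


section \<open>Barycentric subdivision\<close>

definition sd :: "nat \<Rightarrow> nat \<Rightarrow> ('a, 'k::comm_ring_1) lin_chain \<Rightarrow> ('a, 'k) lin_chain"
  where "sd n p = scalar_ext (singular_subdivision p ^^ n)"

lemma lin_map_sd [simp]: "lin_map (sd n p)"
  by (simp add: sd_def)

lemmas sd_simps = lin_map_sd[THEN lin_map_add] lin_map_sd[THEN lin_map_diff] lin_map_sd[THEN lin_map_zero]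
  lin_map_sd[THEN lin_map_minus] lin_map_sd[THEN lin_map_scale] lin_map_sd[THEN lin_map_sum]

lemma singular_chain_sd_iterate:
  "singular_chain p X c \<Longrightarrow> singular_chain p X ((singular_subdivision p ^^ n) c)"
  by (induction n) (auto simp: singular_chain_singular_subdivision)

lemma sd_small_chains: "c \<in> small_chains p X \<F> \<Longrightarrow> sd n p c \<in> small_chains p X \<F>"
  unfolding sd_def by (erule scalar_ext_small_chains) (auto intro: singular_chain_sd_iterate)

lemma sd_chains: "c \<in> chains p X \<Longrightarrow> sd n p c \<in> chains p X"
  using sd_small_chains[of c p X "{UNIV}"] by (simp only: small_chains_UNIV)

lemma sd_sd: "sd m p (sd n p c) = sd (m + n) p c"
  unfolding sd_def
  by (subst scalar_ext_comp[OF additive_op_simps(3)]) (simp add: funpow_add comp_def)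

lemma bd_sd:
  assumes "c \<in> chains p X"
  shows "bd p (sd n p c) = sd n (p - Suc 0) (bd p c)"
proof -
  have "chain_boundary p ((singular_subdivision p ^^ n) d)
      = (singular_subdivision (p - Suc 0) ^^ n) (chain_boundary p d)" if "singular_chain p X d" for d
    using that
  proof (induction n)
    case (Suc n)
    have "singular_chain p X ((singular_subdivision p ^^ n) d)"
      using Suc.prems by (rule singular_chain_sd_iterate)
    with Suc show ?case
      by (simp add: chain_boundary_singular_subdivision)
  qed simp
  then show ?thesis
    unfolding bd_def sd_def
    by (subst scalar_ext_comp[OF additive_op_simps(1)], subst scalar_ext_comp[OF additive_op_simps(3)])
       (auto intro: scalar_ext_cong_chains[OF assms])
qed

lemma lin_chain_map_sd:
  assumes "c \<in> chains p X"
  shows "lin_chain_map p f (sd n p c) = sd n p (lin_chain_map p f c)"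
proof -
  have "chain_map p f ((singular_subdivision p ^^ n) d)
      = (singular_subdivision p ^^ n) (chain_map p f d)" if "singular_chain p X d" for d
    using that
  proof (induction n)
    case (Suc n)
    have "singular_chain p X ((singular_subdivision p ^^ n) d)"
      using Suc.prems by (rule singular_chain_sd_iterate)
    from naturality_singular_subdivision[OF this, of f] Suc.IH[OF Suc.prems] show ?case
      by simp
  qed simp
  then show ?thesis
    unfolding lin_chain_map_eq sd_def
    by (subst scalar_ext_comp[OF additive_op_simps(2)], subst scalar_ext_comp[OF additive_op_simps(3)])
       (auto intro: scalar_ext_cong_chains[OF assms])
qed

text \<open>
  By compactness every simplex of the chain becomes small after finitely many subdivisions, and a chain has
  only finitely many simplices.
\<close>

lemma sd_small:
  fixes c :: "('a, 'k::comm_ring_1) lin_chain"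
  assumes "c \<in> chains p X" "\<And>U. U \<in> \<C> \<Longrightarrow> openin X U" "topspace X \<subseteq> \<Union>\<C>"
  obtains n where "\<And>m. n \<le> m \<Longrightarrow> sd m p c \<in> small_chains p X \<C>"
proof -
  define P where "P \<sigma> n \<longleftrightarrow> (\<forall>m f. n \<le> m \<longrightarrow> f \<in> Poly_Mapping.keys ((singular_subdivision p ^^ m) (frag_of \<sigma>))
      \<longrightarrow> (\<exists>V\<in>\<C>. f \<in> standard_simplex p \<rightarrow> V))" for \<sigma> n
  have "\<exists>n. P \<sigma> n" if "\<sigma> \<in> Poly_Mapping.keys c" for \<sigma>
  proof (rule sufficient_iterated_singular_subdivision_exists[of \<C> X p "frag_of \<sigma>"])
    show "singular_chain p X (frag_of \<sigma>)"
      using that assms(1) by (auto simp: singular_chain_of)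
    show "\<exists>n. P \<sigma> n" if "\<And>m f. \<lbrakk>n \<le> m; f \<in> Poly_Mapping.keys ((singular_subdivision p ^^ m) (frag_of \<sigma>))\<rbrakk>
        \<Longrightarrow> \<exists>V\<in>\<C>. f \<in> standard_simplex p \<rightarrow> V" for n
      unfolding P_def using that by (intro exI[of _ n]) simp
  qed (use assms(2,3) in auto)
  then obtain N where N: "\<And>\<sigma>. \<sigma> \<in> Poly_Mapping.keys c \<Longrightarrow> P \<sigma> (N \<sigma>)"
    by metis
  define n where "n = Max (insert 0 (N ` Poly_Mapping.keys c))"
  have "sd m p c \<in> small_chains p X \<C>" if "n \<le> m" for m
  proof -
    have "(of_int_chain ((singular_subdivision p ^^ m) (frag_of \<sigma>)) :: ('a, 'k) lin_chain) \<in> small_chains p X \<C>"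
      if \<sigma>: "\<sigma> \<in> Poly_Mapping.keys c" for \<sigma>
      unfolding small_chains_def
    proof (intro CollectI ballI)
      fix f
      assume "f \<in> Poly_Mapping.keys (of_int_chain ((singular_subdivision p ^^ m) (frag_of \<sigma>)) :: ('a, 'k) lin_chain)"
      then have f: "f \<in> Poly_Mapping.keys ((singular_subdivision p ^^ m) (frag_of \<sigma>))"
        by (rule subsetD[OF keys_of_int_chain])
      have "N \<sigma> \<le> m"
        using \<sigma> \<open>n \<le> m\<close> unfolding n_def by (simp add: Max_ge_iff)
      then obtain V where V: "V \<in> \<C>" "f \<in> standard_simplex p \<rightarrow> V"
        using N[OF \<sigma>] \<open>N \<sigma> \<le> m\<close> f unfolding P_def by blast
      have "singular_chain p X ((singular_subdivision p ^^ m) (frag_of \<sigma>))"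
        using \<sigma> assms(1) by (intro singular_chain_sd_iterate) (auto simp: singular_chain_of)
      then have "singular_simplex p X f"
        using f by (auto simp: singular_chain_def)
      then show "\<exists>V\<in>\<C>. singular_simplex p (subtopology X V) f"
        using V by (auto simp: singular_simplex_subtopology)
    qed
    then show ?thesis
      unfolding sd_def scalar_ext_def lin_extend_def by (intro small_chains_sum small_chains_scale)
  qed
  then show thesis
    by (rule that)
qed

text \<open>
  The homotopy between iterated subdivision and the identity does not depend on the space. Applied to the
  subspaces in \<open>\<F>\<close> it shows that small chains stay small.
\<close>

lemma sd_homotopy:
  obtains h :: "nat \<Rightarrow> ('a, 'k::comm_ring_1) lin_chain \<Rightarrow> ('a, 'k) lin_chain"
  where "\<And>p. lin_map (h p)"
    and "\<And>p X \<F> c. c \<in> small_chains p X \<F> \<Longrightarrow> h p c \<in> small_chains (Suc p) X \<F>"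
    and "\<And>p X c. c \<in> chains p X \<Longrightarrow> bd (Suc p) (h p c) + h (p - Suc 0) (bd p c) = sd n p c - c"
proof (rule chain_homotopic_iterated_singular_subdivision[of n])
  fix k :: "nat \<Rightarrow> 'a chain \<Rightarrow> 'a chain"
  assume k: "\<And>p c1 c2. k p (c1 - c2) = k p c1 - k p c2"
    "\<And>p X c. singular_chain p X c \<Longrightarrow> singular_chain (Suc p) X (k p c)"
    "\<And>p X c. singular_chain p X c
       \<Longrightarrow> chain_boundary (Suc p) (k p c) + k (p - Suc 0) (chain_boundary p c) = (singular_subdivision p ^^ n) c - c"
  have additive_k: "additive_op (k p)" for p
    by (simp add: additive_op_def k(1))
  show thesis
  proof (rule that[of "\<lambda>p. scalar_ext (k p)"])
    show "lin_map (scalar_ext (k p))" for p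
      by simp
    show "scalar_ext (k p) c \<in> small_chains (Suc p) X \<F>" if "c \<in> small_chains p X \<F>" for p X \<F> and c :: "('a, 'k) lin_chain"
    proof (rule scalar_ext_small_chains[OF that])
      show "\<exists>S'\<in>\<F>. singular_chain (Suc p) (subtopology X S') (k p d)"
        if "S \<in> \<F>" "singular_chain p (subtopology X S) d" for S d
        using that k(2) by (intro bexI[of _ S])
    qed
    show "bd (Suc p) (scalar_ext (k p) c) + scalar_ext (k (p - Suc 0)) (bd p c) = sd n p c - c"
      if "c \<in> chains p X" for p X and c :: "('a, 'k) lin_chain"
    proof -
      have "bd (Suc p) (scalar_ext (k p) c) = scalar_ext (\<lambda>d. chain_boundary (Suc p) (k p d)) c"
        unfolding bd_def
        by (rule scalar_ext_comp[OF additive_op_simps(1)])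
      moreover have "scalar_ext (k (p - Suc 0)) (bd p c) = scalar_ext (\<lambda>d. k (p - Suc 0) (chain_boundary p d)) c"
        unfolding bd_def by (rule scalar_ext_comp[OF additive_k])
      moreover have "sd n p c - c = scalar_ext (\<lambda>d. (singular_subdivision p ^^ n) d - d) c"
        unfolding scalar_ext_minus scalar_ext_ident sd_def by (rule refl)
      moreover have "scalar_ext (\<lambda>d. chain_boundary (Suc p) (k p d) + k (p - Suc 0) (chain_boundary p d)) c
          = scalar_ext (\<lambda>d. (singular_subdivision p ^^ n) d - d) c"
        using scalar_ext_cong_chains[OF that,
            of "\<lambda>d. chain_boundary (Suc p) (k p d) + k (p - Suc 0) (chain_boundary p d)"
              "\<lambda>d. (singular_subdivision p ^^ n) d - d"] k(3)
        by blast
      ultimately show ?thesis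
        by (simp only: scalar_ext_plus)
    qed
  qed
qed


section \<open>The chain homotopy of a homotopy\<close>

definition cylinder :: "nat \<Rightarrow> (real \<times> (nat \<Rightarrow> real)) topology"
  where "cylinder p = prod_topology (top_of_set {0..1}) (subtopology (powertop_real UNIV) (standard_simplex p))"

definition cylinder_map :: "('b \<Rightarrow> 'c) \<Rightarrow> real \<times> 'b \<Rightarrow> real \<times> 'c"
  where "cylinder_map g = (\<lambda>(t, x). (t, g x))"

text \<open>
  The prism over a simplex \<open>\<sigma>\<close> is the image, under \<open>\<sigma>\<close> times the interval, of a fixed chain \<open>P\<close> on the
  cylinder over the standard simplex.
\<close>

definition prism_op :: "(real \<times> (nat \<Rightarrow> real)) chain \<Rightarrow> nat \<Rightarrow> 'a chain \<Rightarrow> (real \<times> 'a) chain"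
  where "prism_op P q = frag_extend (\<lambda>\<sigma>. chain_map (Suc q) (cylinder_map \<sigma>) P)"

abbreviation end_map :: "real \<Rightarrow> nat \<Rightarrow> 'a chain \<Rightarrow> (real \<times> 'a) chain"
  where "end_map t q \<equiv> chain_map q (Pair t)"

definition simplex_id :: "nat \<Rightarrow> (nat \<Rightarrow> real) chain"
  where "simplex_id p = frag_of (restrict id (standard_simplex p))"

text \<open>
  The condition on a chain \<open>P\<close> on the cylinder that makes the boundary of a prism the top minus the bottom
  minus the prism over the boundary; \<open>P'\<close> is the chain for the faces.
\<close>

definition is_prism :: "nat \<Rightarrow> (real \<times> (nat \<Rightarrow> real)) chain \<Rightarrow> (real \<times> (nat \<Rightarrow> real)) chain \<Rightarrow> bool"
  where "is_prism q P' P \<longleftrightarrow> singular_chain (Suc q) (cylinder q) P \<and>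
    chain_boundary (Suc q) P
      = end_map 1 q (simplex_id q) - end_map 0 q (simplex_id q) - prism_op P' (q - Suc 0) (chain_boundary q (simplex_id q))"

lemma prism_op_diff: "prism_op P q (a - b) = prism_op P q a - prism_op P q b"
  by (simp add: prism_op_def frag_extend_diff)

lemma prism_op_zero [simp]: "prism_op P q 0 = 0"
  by (simp add: prism_op_def)

lemma topspace_cylinder: "topspace (cylinder p) = {0..1} \<times> standard_simplex p"
  by (simp add: cylinder_def)

lemma continuous_cylinder_map:
  assumes "continuous_map X Y g"
  shows "continuous_map (prod_topology Z X) (prod_topology Z Y) (cylinder_map g)"
proof -
  have "cylinder_map g = (\<lambda>z. (fst z, g (snd z)))"
    by (auto simp: cylinder_map_def)
  then show ?thesis
    using assms by (auto simp: continuous_map_pairwise comp_def intro: continuous_map_fst continuous_map_snd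
        continuous_map_compose[OF continuous_map_snd, unfolded comp_def])
qed

lemma singular_chain_prism_op:
  assumes "singular_chain (Suc q) (cylinder q) P" "singular_chain q X c"
  shows "singular_chain (Suc q) (prod_topology (top_of_set {0..1}) X) (prism_op P q c)"
  unfolding prism_op_def
proof (rule singular_chain_extend)
  fix \<sigma>
  assume "\<sigma> \<in> Poly_Mapping.keys c"
  then have "continuous_map (subtopology (powertop_real UNIV) (standard_simplex q)) X \<sigma>"
    using assms(2) by (auto simp: singular_chain_def singular_simplex_def)
  from continuous_cylinder_map[OF this]
  show "singular_chain (Suc q) (prod_topology (top_of_set {0..1}) X) (chain_map (Suc q) (cylinder_map \<sigma>) P)"
    using assms(1) unfolding cylinder_def by (rule singular_chain_chain_map[rotated])
qed

lemma prism_op_natural: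
  assumes "singular_chain (Suc q) (cylinder q) P"
  shows "chain_map (Suc q) (cylinder_map g) (prism_op P q c) = prism_op P q (chain_map q g c)"
  using subset_UNIV
proof (induction c rule: frag_induction)
  case (one \<sigma>)
  have "chain_map (Suc q) (cylinder_map g) (prism_op P q (frag_of \<sigma>))
      = chain_map (Suc q) (cylinder_map g \<circ> cylinder_map \<sigma>) P"
    by (simp add: prism_op_def chain_map_compose)
  also have "\<dots> = chain_map (Suc q) (cylinder_map (simplex_map q g \<sigma>)) P"
    by (rule chain_map_eq[OF assms]) (auto simp: topspace_cylinder cylinder_map_def simplex_map_def)
  finally show ?case
    by (simp add: prism_op_def)
qed (auto simp: prism_op_diff chain_map_diff)

text \<open>
  By naturality the formula for the boundary only has to be known for the identity of the standard simplex,
  and there it is the condition on \<open>P\<close>.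
\<close>

lemma chain_boundary_prism_op:
  assumes P: "is_prism q P' P" and P': "q \<noteq> 0 \<Longrightarrow> singular_chain q (cylinder (q - Suc 0)) P'"
    and c: "singular_chain q X c"
  shows "chain_boundary (Suc q) (prism_op P q c)
    = end_map 1 q c - end_map 0 q c - prism_op P' (q - Suc 0) (chain_boundary q c)"
  using c unfolding singular_chain_def
proof (induction c rule: frag_induction)
  case (one \<sigma>)
  then have \<sigma>: "singular_simplex q X \<sigma>"
    by simp
  have sc: "singular_chain q (subtopology (powertop_real UNIV) (standard_simplex q)) (simplex_id q)"
    unfolding simplex_id_def singular_chain_of by (simp add: singular_simplex_def id_def)
  have \<sigma>_id: "chain_map q \<sigma> (simplex_id q) = frag_of \<sigma>"
    unfolding simplex_id_def by (rule singular_simplex_chain_map_id[OF \<sigma>])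
  have ends: "chain_map q (cylinder_map \<sigma>) (end_map t q (simplex_id q)) = end_map t q (frag_of \<sigma>)" for t
  proof -
    have "cylinder_map \<sigma> \<circ> Pair t = Pair t \<circ> \<sigma>"
      by (auto simp: fun_eq_iff cylinder_map_def)
    then have "chain_map q (cylinder_map \<sigma>) (end_map t q (simplex_id q)) = end_map t q (chain_map q \<sigma> (simplex_id q))"
      by (metis chain_map_compose comp_apply)
    then show ?thesis
      by (simp only: \<sigma>_id)
  qed
  have lower: "chain_map q (cylinder_map \<sigma>) (prism_op P' (q - Suc 0) (chain_boundary q (simplex_id q)))
      = prism_op P' (q - Suc 0) (chain_boundary q (frag_of \<sigma>))"
  proof (cases "q = 0")
    case False
    then have "chain_map q (cylinder_map \<sigma>) (prism_op P' (q - Suc 0) (chain_boundary q (simplex_id q)))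
        = prism_op P' (q - Suc 0) (chain_map (q - Suc 0) \<sigma> (chain_boundary q (simplex_id q)))"
      using prism_op_natural[of "q - Suc 0" P' \<sigma>] P' by simp
    then show ?thesis
      by (simp add: \<sigma>_id chain_boundary_chain_map[OF sc, symmetric])
  qed (simp add: chain_boundary_def)
  have "chain_boundary (Suc q) (prism_op P q (frag_of \<sigma>)) = chain_map q (cylinder_map \<sigma>) (chain_boundary (Suc q) P)"
    using P chain_boundary_chain_map[of "Suc q" "cylinder q" P] by (simp add: prism_op_def is_prism_def)
  also have "\<dots> = end_map 1 q (frag_of \<sigma>) - end_map 0 q (frag_of \<sigma>)
      - prism_op P' (q - Suc 0) (chain_boundary q (frag_of \<sigma>))"
    using P unfolding is_prism_def by (simp only: chain_map_diff ends lower)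
  finally show ?case .
next
  case (diff a b)
  then show ?case
    by (simp add: prism_op_diff chain_boundary_diff chain_map_diff)
qed auto

text \<open>
  The cylinder over a simplex is convex, hence contractible.
\<close>

lemma cylinder_cycle_is_boundary:
  assumes z: "singular_chain q (cylinder q) z" "chain_boundary q z = 0"
    and z0: "q = 0 \<Longrightarrow> \<exists>a b. z = frag_of a - frag_of b"
  shows "\<exists>P. singular_chain (Suc q) (cylinder q) P \<and> chain_boundary (Suc q) P = z"
proof -
  define e :: "nat \<Rightarrow> real" where "e = (\<lambda>j. if j = 0 then 1 else 0)"
  (* The straight line to the point pt in the cylinder; e is a vertex of the simplex. *)
  define h where "h = (\<lambda>(s::real, t::real, x::nat \<Rightarrow> real). ((1 - s) * t, \<lambda>i. (1 - s) * x i + s * e i))"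
  define pt :: "real \<times> (nat \<Rightarrow> real)" where "pt = (0, e)"
  have e: "e \<in> standard_simplex q"
    unfolding e_def by (rule basis_in_standard_simplex[THEN iffD2]) simp
  have "homotopic_with (\<lambda>h. h \<in> {} \<rightarrow> {}) (cylinder q) (cylinder q) id (\<lambda>_. pt)"
    unfolding homotopic_with_def
  proof (intro exI[of _ h] conjI allI ballI)
    let ?D = "prod_topology (top_of_set {0..1::real}) (cylinder q)"
    have s: "continuous_map ?D euclideanreal (\<lambda>z. fst z)"
      using continuous_map_fst continuous_map_into_fulltopology by blast
    have "continuous_map ?D (top_of_set {0..1}) (fst \<circ> snd)"
      unfolding cylinder_def by (rule continuous_map_compose[OF continuous_map_snd continuous_map_fst])
    then have t: "continuous_map ?D euclideanreal (\<lambda>z. fst (snd z))"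
      unfolding comp_def by (rule continuous_map_into_fulltopology)
    have "continuous_map ?D (subtopology (powertop_real UNIV) (standard_simplex q)) (snd \<circ> snd)"
      unfolding cylinder_def by (rule continuous_map_compose[OF continuous_map_snd continuous_map_snd])
    then have "continuous_map ?D (powertop_real UNIV) (\<lambda>z. snd (snd z))"
      unfolding comp_def by (rule continuous_map_into_fulltopology)
    then have x: "continuous_map ?D euclideanreal (\<lambda>z. snd (snd z) i)" for i
      by (rule continuous_map_componentwise_UNIV[THEN iffD1, rule_format])
    have "continuous_map ?D euclideanreal (\<lambda>z. (1 - fst z) * fst (snd z))"
      by (intro continuous_intros s t)
    moreover have "continuous_map ?D (powertop_real UNIV) (\<lambda>z i. (1 - fst z) * snd (snd z) i + fst z * e i)"
      unfolding continuous_map_componentwise_UNIV by (intro allI continuous_intros s x) auto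
    ultimately have "continuous_map ?D (prod_topology euclideanreal (powertop_real UNIV)) h"
      unfolding h_def case_prod_unfold continuous_map_pairwise comp_def by simp
    moreover have "h \<in> topspace ?D \<rightarrow> {0..1} \<times> standard_simplex q"
      using convex_standard_simplex[OF _ e]
      by (auto simp: topspace_cylinder h_def mult_le_one)
    ultimately have "continuous_map ?D (subtopology (prod_topology euclideanreal (powertop_real UNIV))
        ({0..1} \<times> standard_simplex q)) h"
      unfolding continuous_map_in_subtopology by blast
    then show "continuous_map ?D (cylinder q) h"
      by (simp only: cylinder_def subtopology_Times)
  qed (auto simp: h_def pt_def)
  from homotopic_imp_homologous_rel_chain_maps[OF this, of q z]
  have hom: "homologous_rel q (cylinder q) {} z (chain_map q (\<lambda>_. pt) z)"
    using z by (simp add: singular_cycle chain_map_ident)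
  have "singular_relboundary q (cylinder q) {} (chain_map q (\<lambda>_. pt) z)"
  proof (cases "q = 0")
    case True
    then obtain a b where "z = frag_of a - frag_of b"
      using z0 by blast
    then have "chain_map q (\<lambda>_. pt) z = 0"
      by (simp add: chain_map_diff simplex_map_def comp_def)
    then show ?thesis
      by simp
  next
    case False
    let ?pt = "subtopology (cylinder q) {pt}"
    have pt: "topspace ?pt = {pt}"
      using e by (auto simp: topspace_cylinder pt_def)
    have "continuous_map (cylinder q) ?pt (\<lambda>_. pt)"
      using e by (simp add: continuous_map_in_subtopology topspace_cylinder pt_def)
    then have "singular_chain q ?pt (chain_map q (\<lambda>_. pt) z)"
      using z(1) singular_chain_chain_map by blast
    moreover have "chain_boundary q (chain_map q (\<lambda>_. pt) z) = 0"
      by (simp add: chain_boundary_chain_map[OF z(1)] z(2))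
    ultimately have "singular_relboundary q ?pt {} (chain_map q (\<lambda>_. pt) z)"
      using False singular_boundary_eq_cycle_singleton[OF pt] by (simp add: singular_cycle)
    then show ?thesis
      unfolding singular_boundary using singular_chain_subtopology by blast
  qed
  then have "singular_relboundary q (cylinder q) {} z"
    using hom unfolding homologous_rel_def by (metis diff_add_cancel singular_relboundary_add)
  then show ?thesis
    by (simp add: singular_boundary)
qed

text \<open>
  The chains are chosen by recursion on the dimension (the method of acyclic models): the required boundary
  is a cycle by the choice for the faces, hence a boundary.
\<close>

primrec prism_chain :: "nat \<Rightarrow> (real \<times> (nat \<Rightarrow> real)) chain" where
  "prism_chain 0 = (SOME P. is_prism 0 0 P)"
| "prism_chain (Suc q) = (SOME P. is_prism (Suc q) (prism_chain q) P)"

lemma singular_chain_simplex_id: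
  "singular_chain q (subtopology (powertop_real UNIV) (standard_simplex q)) (simplex_id q)"
  unfolding simplex_id_def singular_chain_of by (simp add: singular_simplex_def id_def)

lemma singular_chain_end_map:
  assumes "singular_chain q X c" "t \<in> {0..1}"
  shows "singular_chain q (prod_topology (top_of_set {0..1::real}) X) (end_map t q c)"
  using assms(1) by (rule singular_chain_chain_map) (use assms(2) in \<open>auto simp: continuous_map_pairwise comp_def\<close>)

lemma is_prism_prism_chain: "is_prism q (prism_chain (q - Suc 0)) (prism_chain q)"
proof (induction q rule: less_induct)
  case (less q)
  note sid = singular_chain_simplex_id[of q]
  show ?case
  proof (cases q)
    case 0
    let ?z = "end_map 1 0 (simplex_id 0) - end_map 0 0 (simplex_id 0)"
    have "singular_chain 0 (cylinder 0) ?z"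
      unfolding cylinder_def
      by (intro singular_chain_diff singular_chain_end_map singular_chain_simplex_id) auto
    then have "\<exists>P. singular_chain (Suc 0) (cylinder 0) P \<and> chain_boundary (Suc 0) P = ?z"
      by (rule cylinder_cycle_is_boundary) (auto simp: chain_boundary_def simplex_id_def)
    then have "\<exists>P. is_prism 0 0 P"
      by (simp add: is_prism_def chain_boundary_def)
    then have "is_prism 0 0 (prism_chain 0)"
      by (simp add: someI_ex)
    then show ?thesis
      by (simp add: 0 is_prism_def chain_boundary_def)
  next
    case (Suc r)
    let ?b = "chain_boundary q (simplex_id q)"
    let ?z = "end_map 1 q (simplex_id q) - end_map 0 q (simplex_id q) - prism_op (prism_chain r) r ?b"
    have prev: "is_prism r (prism_chain (r - Suc 0)) (prism_chain r)"
      using less[of r] Suc by simp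
    have prev': "r \<noteq> 0 \<Longrightarrow> singular_chain r (cylinder (r - Suc 0)) (prism_chain (r - Suc 0))"
      using less[of "r - Suc 0"] Suc by (simp add: is_prism_def)
    have b: "singular_chain r (subtopology (powertop_real UNIV) (standard_simplex q)) ?b"
      using singular_chain_boundary[OF sid] Suc by simp
    have ends: "singular_chain q (cylinder q) (end_map t q (simplex_id q))" if "t \<in> {0..1}" for t
      unfolding cylinder_def using that by (intro singular_chain_end_map sid)
    have "singular_chain q (cylinder q) (prism_op (prism_chain r) r ?b)"
      using singular_chain_prism_op[OF _ b, of "prism_chain r"] prev Suc
      by (simp add: is_prism_def cylinder_def)
    then have z: "singular_chain q (cylinder q) ?z"
      by (intro singular_chain_diff ends) auto
    have "chain_boundary r ?b = 0"
      using chain_boundary_boundary[OF sid] Suc by simp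
    then have "chain_boundary q (prism_op (prism_chain r) r ?b) = end_map 1 r ?b - end_map 0 r ?b"
      using chain_boundary_prism_op[OF prev prev' b] Suc by simp
    moreover have "chain_boundary q (end_map t q (simplex_id q)) = end_map t r ?b" for t
      using chain_boundary_chain_map[OF sid] Suc by simp
    ultimately have "chain_boundary q ?z = 0"
      by (simp add: chain_boundary_diff)
    with z have "\<exists>P. singular_chain (Suc q) (cylinder q) P \<and> chain_boundary (Suc q) P = ?z"
      by (rule cylinder_cycle_is_boundary) (simp add: Suc)
    then have "\<exists>P. is_prism q (prism_chain r) P"
      by (simp add: is_prism_def Suc)
    then have "is_prism q (prism_chain r) (prism_chain q)"
      by (simp add: someI_ex Suc)
    then show ?thesis
      by (simp add: Suc)
  qed
qed

definition homotopy_op :: "(real \<times> 'a \<Rightarrow> 'b) \<Rightarrow> nat \<Rightarrow> ('a, 'k::comm_ring_1) lin_chain \<Rightarrow> ('b, 'k) lin_chain"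
  where "homotopy_op H q = scalar_ext (\<lambda>c. chain_map (Suc q) H (prism_op (prism_chain q) q c))"

lemma lin_map_homotopy_op [simp]: "lin_map (homotopy_op H q)"
  by (simp add: homotopy_op_def)

text \<open>
  The prism over a simplex lies over that simplex, so its image lies in every set that contains the
  whole track of the simplex under \<open>H\<close>.
\<close>

lemma homotopy_op_small_chains:
  assumes "c \<in> small_chains q X \<F>" and H: "continuous_map (prod_topology (top_of_set {0..1}) X) Y H"
    and "\<And>S. S \<in> \<F> \<Longrightarrow> \<exists>S'\<in>\<G>. \<forall>t\<in>{0..1}. \<forall>x\<in>S \<inter> topspace X. H (t, x) \<in> S'"
  shows "homotopy_op H q c \<in> small_chains (Suc q) Y \<G>"
  unfolding homotopy_op_def
proof (rule scalar_ext_small_chains[OF assms(1)])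
  fix S and d :: "'a chain"
  assume S: "S \<in> \<F>" and d: "singular_chain q (subtopology X S) d"
  obtain S' where S': "S' \<in> \<G>" "\<forall>t\<in>{0..1}. \<forall>x\<in>S \<inter> topspace X. H (t, x) \<in> S'"
    using assms(3)[OF S] by blast
  have "singular_chain (Suc q) (prod_topology (top_of_set {0..1}) (subtopology X S)) (prism_op (prism_chain q) q d)"
    using is_prism_prism_chain[of q] d by (intro singular_chain_prism_op) (auto simp: is_prism_def)
  moreover have "continuous_map (prod_topology (top_of_set {0..1}) (subtopology X S)) (subtopology Y S') H"
  proof -
    have "prod_topology (top_of_set {0..1::real}) (subtopology X S)
        = subtopology (prod_topology (top_of_set {0..1}) X) (UNIV \<times> S)"
      by (metis subtopology_Times subtopology_UNIV)
    then show ?thesis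
      using continuous_map_from_subtopology[OF H, of "UNIV \<times> S"] S'(2)
      by (auto simp: continuous_map_in_subtopology Pi_iff)
  qed
  ultimately have "singular_chain (Suc q) (subtopology Y S') (chain_map (Suc q) H (prism_op (prism_chain q) q d))"
    by (rule singular_chain_chain_map)
  with S'(1) show "\<exists>S'\<in>\<G>. singular_chain (Suc q) (subtopology Y S') (chain_map (Suc q) H (prism_op (prism_chain q) q d))"
    by (rule bexI[rotated])
qed

lemma bd_homotopy_op:
  assumes "c \<in> chains q X"
  shows "bd (Suc q) (homotopy_op H q c) + homotopy_op H (q - Suc 0) (bd q c)
    = lin_chain_map q (\<lambda>x. H (1, x)) c - lin_chain_map q (\<lambda>x. H (0, x)) c"
proof -
  let ?D = "\<lambda>q c. chain_map (Suc q) H (prism_op (prism_chain q) q c)"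
  have add: "additive_op (?D q)" for q
    by (simp add: additive_op_def prism_op_diff chain_map_diff)
  have "chain_boundary (Suc q) (?D q d) + ?D (q - Suc 0) (chain_boundary q d)
      = chain_map q (\<lambda>x. H (1, x)) d - chain_map q (\<lambda>x. H (0, x)) d" if d: "singular_chain q X d" for d
  proof -
    have pr: "is_prism r (prism_chain (r - Suc 0)) (prism_chain r)" for r
      by (rule is_prism_prism_chain)
    have prev: "singular_chain q (cylinder (q - Suc 0)) (prism_chain (q - Suc 0))" if "q \<noteq> 0"
      using pr[of "q - Suc 0"] that by (simp add: is_prism_def)
    have pc: "singular_chain (Suc q) (prod_topology (top_of_set {0..1}) X) (prism_op (prism_chain q) q d)"
      using pr[of q] d by (intro singular_chain_prism_op) (auto simp: is_prism_def)
    have "chain_boundary (Suc q) (?D q d)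
        = chain_map q H (end_map 1 q d - end_map 0 q d - prism_op (prism_chain (q - Suc 0)) (q - Suc 0) (chain_boundary q d))"
      using chain_boundary_chain_map[OF pc, of H] chain_boundary_prism_op[OF pr prev d] by simp
    moreover have "chain_map q H (end_map t q d) = chain_map q (\<lambda>x. H (t, x)) d" for t
      using comp_apply[of "chain_map q H" "end_map t q" d] unfolding chain_map_compose[symmetric] by (simp add: comp_def)
    moreover have "chain_map q H (prism_op (prism_chain (q - Suc 0)) (q - Suc 0) (chain_boundary q d))
        = ?D (q - Suc 0) (chain_boundary q d)"
      by (cases "q = 0") (simp_all add: chain_boundary_def)
    ultimately show ?thesis
      by (simp add: chain_map_diff)
  qed
  from scalar_ext_cong_chains[OF assms this] show ?thesis
    unfolding homotopy_op_def bd_def lin_chain_map_eq scalar_ext_plus scalar_ext_minus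
      scalar_ext_comp[OF additive_op_simps(1)] scalar_ext_comp[OF add] .
qed


section \<open>Collapsing a family of closed subsets\<close>

lemma small_chains_singleton: "small_chains p X {S} = chains p (subtopology X S)"
  by (auto simp: small_chains_def)

lemma small_chains_Int:
  "\<lbrakk>c \<in> small_chains p X {S}; c \<in> small_chains p X {T}\<rbrakk> \<Longrightarrow> c \<in> small_chains p X {S \<inter> T}"
  by (auto simp: small_chains_def singular_simplex_subtopology)

lemma small_chains_from_subtopology:
  assumes "c \<in> small_chains p (subtopology X S) \<F>"
  shows "c \<in> small_chains p X \<F>"
proof -
  have "singular_simplex p (subtopology X T) \<sigma>"
    if "singular_simplex p (subtopology (subtopology X S) T) \<sigma>" for T \<sigma>
    using that by (simp add: singular_simplex_subtopology)
  then show ?thesis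
    using assms unfolding small_chains_def by blast
qed

text \<open>A degree raising operator applied to a boundary; in degree 0 the boundary vanishes.\<close>

lemma homotopy_of_bd_small_chains:
  assumes "\<And>p. lin_map (h p)" "bd p c \<in> small_chains (p - Suc 0) X \<F>"
    and "\<And>p c. c \<in> small_chains p X \<F> \<Longrightarrow> h p c \<in> small_chains (Suc p) Y \<G>"
  shows "h (p - Suc 0) (bd p c) \<in> small_chains p Y \<G>"
proof (cases p)
  case 0
  then show ?thesis
    by (simp add: lin_map_zero assms(1))
next
  case (Suc r)
  then show ?thesis
    using assms(3)[of "bd p c" r] assms(2) by simp
qed

text \<open>
  Subdivision is chain homotopic to the identity by a homotopy that keeps small chains small. Hence a chain
  with small boundary may be subdivided before it is compared with small chains.
\<close>

lemma sd_imp_homologous_small: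
  assumes c: "c \<in> chains p X" and bdc: "bd p c \<in> small_chains (p - Suc 0) X \<F>"
    and d: "d \<in> chains (Suc p) X" and small: "sd n p c - bd (Suc p) d \<in> small_chains p X \<F>"
  shows "\<exists>d'\<in>chains (Suc p) X. c - bd (Suc p) d' \<in> small_chains p X \<F>"
proof (rule sd_homotopy[where 'a = 'a and 'k = 'b and n = n])
  fix h :: "nat \<Rightarrow> ('a, 'b) lin_chain \<Rightarrow> ('a, 'b) lin_chain"
  assume lin: "\<And>p. lin_map (h p)"
    and h_small: "\<And>p X \<F> c. c \<in> small_chains p X \<F> \<Longrightarrow> h p c \<in> small_chains (Suc p) X \<F>"
    and h_eq: "\<And>p (X :: 'a topology) c. c \<in> chains p X \<Longrightarrow> bd (Suc p) (h p c) + h (p - Suc 0) (bd p c) = sd n p c - c"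
  have hc: "h p c \<in> chains (Suc p) X"
    using h_small[of c p X "{UNIV}"] c by (simp only: small_chains_UNIV)
  have "bd (Suc p) (h p c) = sd n p c - c - h (p - Suc 0) (bd p c)"
    using h_eq[OF c] by (simp add: eq_diff_eq)
  then have "c - bd (Suc p) (d - h p c) = (sd n p c - bd (Suc p) d) - h (p - Suc 0) (bd p c)"
    by (simp add: bd_simps)
  moreover have "h (p - Suc 0) (bd p c) \<in> small_chains p X \<F>"
    by (rule homotopy_of_bd_small_chains[OF lin bdc]) (rule h_small)
  ultimately have "c - bd (Suc p) (d - h p c) \<in> small_chains p X \<F>"
    using small small_chains_diff by metis
  then show ?thesis
    using chains_diff[OF d hc] by (rule bexI)
qed

text \<open>
  The map \<open>q\<close> collapses the union of the sets \<open>F i\<close> to the point \<open>z\<close>. The homotopy \<open>H\<close> maps every \<open>F i\<close>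
  to itself and moves the neighbourhood \<open>U i\<close> into \<open>F i\<close>. Chains on \<open>B\<close> are considered relative to sums of
  chains of the single \<open>F i\<close>, and not relative to the chains of their union.
\<close>

locale collapse =
  fixes B :: "'a topology" and Q :: "'b topology" and q :: "'a \<Rightarrow> 'b"
    and I :: "'i set" and F U :: "'i \<Rightarrow> 'a set" and H :: "real \<times> 'a \<Rightarrow> 'a" and z :: 'b
  assumes q: "quotient_map B Q q"
    and q_eq: "\<lbrakk>x \<in> topspace B; y \<in> topspace B; q x = q y\<rbrakk> \<Longrightarrow> x = y \<or> q x = z"
    and q_z: "x \<in> topspace B \<Longrightarrow> q x = z \<longleftrightarrow> (\<exists>i\<in>I. x \<in> F i)"
    and z: "z \<in> topspace Q"
    and fibre_closed: "closedin B {x \<in> topspace B. q x = z}"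
    and U: "i \<in> I \<Longrightarrow> openin B (U i)"
    and F_U: "i \<in> I \<Longrightarrow> F i \<inter> topspace B \<subseteq> U i"
    and H: "continuous_map (prod_topology (top_of_set {0..1}) B) B H"
    and H_0: "x \<in> topspace B \<Longrightarrow> H (0, x) = x"
    and H_F: "\<lbrakk>i \<in> I; x \<in> F i \<inter> topspace B; t \<in> {0..1}\<rbrakk> \<Longrightarrow> H (t, x) \<in> F i"
    and H_U: "\<lbrakk>i \<in> I; x \<in> U i\<rbrakk> \<Longrightarrow> H (1, x) \<in> F i"
begin

definition nbhd :: "'a set"
  where "nbhd = (\<Union>i\<in>I. U i)"

definition rest :: "'a set"
  where "rest = {x \<in> topspace B. q x \<noteq> z}"

definition punctured :: "'b set"
  where "punctured = topspace Q - {z}"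

lemma q_image: "q ` topspace B = topspace Q"
  using q by (simp add: quotient_map_def)

lemma q_surj: "y \<in> topspace Q \<Longrightarrow> \<exists>x\<in>topspace B. y = q x"
  unfolding q_image[symmetric] by blast

lemma q_cont: "continuous_map B Q q"
  using q by (rule quotient_imp_continuous_map)

lemma q_in: "x \<in> topspace B \<Longrightarrow> q x \<in> topspace Q"
  using q_image by blast

lemma nbhd_sub: "nbhd \<subseteq> topspace B"
  using U openin_subset by (fastforce simp: nbhd_def)

lemma fibre_sub_nbhd: "\<lbrakk>x \<in> topspace B; q x = z\<rbrakk> \<Longrightarrow> x \<in> nbhd"
  using q_z F_U by (fastforce simp: nbhd_def)

lemma openin_rest: "openin B rest"
proof -
  have "rest = topspace B - {x \<in> topspace B. q x = z}"
    by (auto simp: rest_def)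
  then show ?thesis
    using fibre_closed by (simp add: openin_diff)
qed

lemma openin_punctured: "openin Q punctured"
proof -
  have "{x \<in> topspace B. q x \<in> punctured} = rest"
    using q_in by (auto simp: rest_def punctured_def)
  moreover have "punctured \<subseteq> topspace Q"
    by (auto simp: punctured_def)
  ultimately show ?thesis
    using q[unfolded quotient_map_def, THEN conjunct2, rule_format, of punctured] openin_rest by simp
qed

lemma openin_q_nbhd: "openin Q (q ` nbhd)"
proof -
  have "{x \<in> topspace B. q x \<in> q ` nbhd} = nbhd"
  proof
    show "{x \<in> topspace B. q x \<in> q ` nbhd} \<subseteq> nbhd"
    proof clarify
      fix x y
      assume "x \<in> topspace B" "y \<in> nbhd" "q x = q y"
      then show "x \<in> nbhd"
        using q_eq[of x y] nbhd_sub fibre_sub_nbhd[of x] by auto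
    qed
  qed (use nbhd_sub in auto)
  moreover have "openin B nbhd"
    unfolding nbhd_def using U by blast
  moreover have "q ` nbhd \<subseteq> topspace Q"
    using nbhd_sub q_in by blast
  ultimately show ?thesis
    using q[unfolded quotient_map_def, THEN conjunct2, rule_format, of "q ` nbhd"] by simp
qed

lemma z_in_q_nbhd: "z \<in> q ` nbhd"
proof -
  obtain x where "x \<in> topspace B" "q x = z"
    using z unfolding q_image[symmetric] by blast
  then show ?thesis
    using fibre_sub_nbhd by blast
qed

text \<open>
  Away from the fibre of \<open>z\<close>, which is closed, the quotient map is a homeomorphism.
\<close>

lemma inverse_off_fibre:
  obtains g where "continuous_map (subtopology Q punctured) (subtopology B rest) g"
    "\<And>x. x \<in> rest \<Longrightarrow> g (q x) = x" "\<And>y. y \<in> punctured \<Longrightarrow> q (g y) = y"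
proof -
  have "{x \<in> topspace B. q x \<in> punctured} = rest"
    using q_in by (auto simp: rest_def punctured_def)
  then have "quotient_map (subtopology B rest) (subtopology Q punctured) q"
    using quotient_map_restriction[OF q] openin_punctured by blast
  moreover have "inj_on q (topspace (subtopology B rest))"
    using q_eq by (auto simp: inj_on_def rest_def)
  ultimately have "homeomorphic_map (subtopology B rest) (subtopology Q punctured) q"
    by (simp add: homeomorphic_map_def)
  then obtain g where "homeomorphic_maps (subtopology B rest) (subtopology Q punctured) q g"
    by (auto simp: homeomorphic_map_maps)
  then have g: "continuous_map (subtopology Q punctured) (subtopology B rest) g"
      "\<forall>x\<in>topspace (subtopology B rest). g (q x) = x" "\<forall>y\<in>topspace (subtopology Q punctured). q (g y) = y"
    by (auto simp: homeomorphic_maps_def)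
  moreover have "rest \<subseteq> topspace B" "punctured \<subseteq> topspace Q"
    by (auto simp: rest_def punctured_def)
  ultimately show thesis
    by (intro that[of g]) auto
qed

lemma lift_punctured:
  assumes "d \<in> small_chains p Q {punctured}"
  shows "\<exists>d'\<in>small_chains p B {rest}. lin_chain_map p q d' = d"
proof (rule inverse_off_fibre)
  fix g
  assume g: "continuous_map (subtopology Q punctured) (subtopology B rest) g"
    "\<And>x. x \<in> rest \<Longrightarrow> g (q x) = x" "\<And>y. y \<in> punctured \<Longrightarrow> q (g y) = y"
  have d: "d \<in> chains p (subtopology Q punctured)"
    using assms by (simp only: small_chains_singleton)
  have "lin_chain_map p g d \<in> small_chains p B {rest}"
    unfolding small_chains_singleton by (rule lin_chain_map_chains[OF d g(1)])
  moreover have "lin_chain_map p q (lin_chain_map p g d) = d"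
    unfolding lin_chain_map_comp by (rule lin_chain_map_id[OF d]) (simp add: g(3))
  ultimately show ?thesis
    by (rule bexI[rotated])
qed

text \<open>
  A chain away from the fibre can be recovered from its image, so it is as close to the fibre as its
  image is to \<open>z\<close>.
\<close>

lemma small_upstairs:
  assumes e: "e \<in> small_chains p B {rest}" and qe: "lin_chain_map p q e \<in> small_chains p Q {q ` nbhd}"
  shows "e \<in> chains p (subtopology B nbhd)"
proof (rule inverse_off_fibre)
  fix g
  assume g: "continuous_map (subtopology Q punctured) (subtopology B rest) g"
    "\<And>x. x \<in> rest \<Longrightarrow> g (q x) = x" "\<And>y. y \<in> punctured \<Longrightarrow> q (g y) = y"
  have "lin_chain_map p q e \<in> small_chains p Q {punctured}"
    by (rule lin_chain_map_small_chains[OF e q_cont]) (auto simp: rest_def punctured_def q_in)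
  from small_chains_Int[OF qe this]
  have qe': "lin_chain_map p q e \<in> chains p (subtopology Q (q ` nbhd \<inter> punctured))"
    by (simp only: small_chains_singleton)
  have "g y \<in> nbhd" if y: "y \<in> q ` nbhd \<inter> punctured" for y
  proof -
    obtain x where x: "x \<in> nbhd" "y = q x"
      using y by blast
    then have "x \<in> rest"
      using y nbhd_sub by (auto simp: rest_def punctured_def)
    then show ?thesis
      using g(2) x by simp
  qed
  moreover have "continuous_map (subtopology Q (q ` nbhd \<inter> punctured)) B g"
  proof -
    have "continuous_map (subtopology Q punctured) B g"
      using g(1) continuous_map_into_fulltopology by blast
    then show ?thesis
      by (rule continuous_map_from_subtopology_mono) auto
  qed
  ultimately have "continuous_map (subtopology Q (q ` nbhd \<inter> punctured)) (subtopology B nbhd) g"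
    by (auto simp: continuous_map_in_subtopology)
  from lin_chain_map_chains[OF qe' this]
  have "lin_chain_map p g (lin_chain_map p q e) \<in> chains p (subtopology B nbhd)" .
  moreover have "lin_chain_map p g (lin_chain_map p q e) = e"
    unfolding lin_chain_map_comp
    by (rule lin_chain_map_id[of e p "subtopology B rest"])
       (use e g(2) in \<open>auto simp: small_chains_singleton\<close>)
  ultimately show ?thesis
    by (simp only:)
qed

lemma sd_small_in_nbhd:
  assumes "e \<in> chains p (subtopology B nbhd)"
  shows "\<exists>m. sd m p e \<in> small_chains p B (U ` I)"
proof (rule sd_small[OF assms, of "U ` I"])
  show "openin (subtopology B nbhd) V" if V: "V \<in> U ` I" for V
  proof -
    have "V \<subseteq> nbhd" "openin B V"
      using V U by (auto simp: nbhd_def)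
    then show ?thesis
      by (metis inf.absorb_iff2 openin_subtopology_Int2)
  qed
  show "topspace (subtopology B nbhd) \<subseteq> \<Union> (U ` I)"
    by (auto simp: nbhd_def)
  fix n
  assume "\<And>m. n \<le> m \<Longrightarrow> sd m p e \<in> small_chains p (subtopology B nbhd) (U ` I)"
  then have "sd n p e \<in> small_chains p (subtopology B nbhd) (U ` I)"
    by simp
  from small_chains_from_subtopology[OF this] show "\<exists>m. sd m p e \<in> small_chains p B (U ` I)"
    by (rule exI)
qed

text \<open>
  The end of the homotopy turns chains that are small for the neighbourhoods into chains that are small for
  the sets themselves.
\<close>

lemma deform_small:
  assumes c: "c \<in> chains p B" and bdc: "bd p c \<in> small_chains (p - Suc 0) B (F ` I)"
    and d: "d \<in> chains (Suc p) B" and small: "c - bd (Suc p) d \<in> small_chains p B (U ` I)"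
  shows "\<exists>d'\<in>chains (Suc p) B. c - bd (Suc p) d' \<in> small_chains p B (F ` I)"
proof -
  let ?h = "\<lambda>p. lin_chain_map p (\<lambda>x. H (1, x))"
  have cont: "continuous_map B B (\<lambda>x. H (1, x))"
    using continuous_map_compose[OF _ H, of B "\<lambda>x. (1, x)"]
    by (simp add: continuous_map_pairwise comp_def)
  have hd: "?h (Suc p) d \<in> chains (Suc p) B"
    by (rule lin_chain_map_chains[OF d cont])
  have Dc: "homotopy_op H p c \<in> chains (Suc p) B"
    using homotopy_op_small_chains[of c p B "{UNIV}" B H "{UNIV}"] c H by (simp only: small_chains_UNIV) auto
  have "?h p (c - bd (Suc p) d) \<in> small_chains p B (F ` I)"
    by (rule lin_chain_map_small_chains[OF small cont]) (use H_U in auto)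
  moreover have "?h p (c - bd (Suc p) d) = ?h p c - bd (Suc p) (?h (Suc p) d)"
    using bd_lin_chain_map[OF d, of "\<lambda>x. H (1, x)"] by (simp add: lin_chain_map_simps)
  moreover have "homotopy_op H (p - Suc 0) (bd p c) \<in> small_chains p B (F ` I)"
  proof (rule homotopy_of_bd_small_chains[OF lin_map_homotopy_op bdc], erule homotopy_op_small_chains[OF _ H])
    show "\<exists>S'\<in>F ` I. \<forall>t\<in>{0..1}. \<forall>x\<in>S \<inter> topspace B. H (t, x) \<in> S'" if "S \<in> F ` I" for S
      using that H_F by (intro bexI[of _ S]) auto
  qed
  ultimately have "?h p c - bd (Suc p) (?h (Suc p) d) - homotopy_op H (p - Suc 0) (bd p c) \<in> small_chains p B (F ` I)"
    using small_chains_diff by simp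
  moreover have "bd (Suc p) (homotopy_op H p c) = ?h p c - c - homotopy_op H (p - Suc 0) (bd p c)"
  proof -
    have "lin_chain_map p (\<lambda>x. H (0, x)) c = c"
      by (rule lin_chain_map_id[OF c]) (rule H_0)
    with bd_homotopy_op[OF c, of H] show ?thesis
      by (simp add: eq_diff_eq)
  qed
  moreover from this have "c - bd (Suc p) (?h (Suc p) d - homotopy_op H p c)
      = ?h p c - bd (Suc p) (?h (Suc p) d) - homotopy_op H (p - Suc 0) (bd p c)"
    by (simp add: bd_simps)
  ultimately have "c - bd (Suc p) (?h (Suc p) d - homotopy_op H p c) \<in> small_chains p B (F ` I)"
    by simp
  then show ?thesis
    using chains_diff[OF hd Dc] by (rule bexI)
qed

text \<open>
  After subdivision both \<open>c\<close> and the chain \<open>d\<close> split into a part away from the fibre of \<open>z\<close> and a part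
  near it. The first part of \<open>d\<close> lifts to \<open>B\<close>, and subtracting the boundary of the lift from \<open>c\<close> leaves a
  chain near the fibre, which is deformed into the sets \<open>F i\<close>.
\<close>

lemma collapse_injective:
  assumes c: "c \<in> chains p B" and bdc: "bd p c \<in> small_chains (p - Suc 0) B (F ` I)"
    and d: "d \<in> chains (Suc p) Q" and e: "e \<in> chains p (subtopology Q {z})"
    and eq: "lin_chain_map p q c = bd (Suc p) d + e"
  shows "\<exists>d'\<in>chains (Suc p) B. c - bd (Suc p) d' \<in> small_chains p B (F ` I)"
proof -
  (* The sets U i cover the fibre of z, the set rest covers its complement. *)
  obtain n1 where n1: "\<And>m. n1 \<le> m \<Longrightarrow> sd m p c \<in> small_chains p B ({rest} \<union> U ` I)"
  proof (rule sd_small[OF c, of "{rest} \<union> U ` I"])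
    show "openin B V" if "V \<in> {rest} \<union> U ` I" for V
      using that openin_rest U by blast
    show "topspace B \<subseteq> \<Union> ({rest} \<union> U ` I)"
      using fibre_sub_nbhd by (auto simp: rest_def nbhd_def)
  qed (rule that)
  obtain n2 where n2: "\<And>m. n2 \<le> m \<Longrightarrow> sd m (Suc p) d \<in> small_chains (Suc p) Q ({punctured} \<union> {q ` nbhd})"
  proof (rule sd_small[OF d, of "{punctured} \<union> {q ` nbhd}"])
    show "openin Q V" if "V \<in> {punctured} \<union> {q ` nbhd}" for V
      using that openin_punctured openin_q_nbhd by blast
    show "topspace Q \<subseteq> \<Union> ({punctured} \<union> {q ` nbhd})"
      using z_in_q_nbhd by (auto simp: punctured_def)
  qed (rule that)
  define n where "n = max n1 n2"
  obtain a b where a: "a \<in> small_chains p B {rest}" and b: "b \<in> small_chains p B (U ` I)"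
    and ab: "sd n p c = a + b"
    by (rule small_chains_split[OF n1[of n]]) (auto simp: n_def)
  obtain d1 d2 where d1: "d1 \<in> small_chains (Suc p) Q {punctured}"
    and d2: "d2 \<in> small_chains (Suc p) Q {q ` nbhd}" and d12: "sd n (Suc p) d = d1 + d2"
    by (rule small_chains_split[OF n2[of n]]) (auto simp: n_def)
  obtain d1' where d1': "d1' \<in> small_chains (Suc p) B {rest}" "lin_chain_map (Suc p) q d1' = d1"
    using lift_punctured[OF d1] by (rule bexE)
  have bd_sd_d: "bd (Suc p) (sd n (Suc p) d) = sd n p (bd (Suc p) d)"
    using bd_sd[OF d] by simp
  have "lin_chain_map p q (a + b) = bd (Suc p) (d1 + d2) + sd n p e"
    unfolding ab[symmetric] d12[symmetric] bd_sd_d lin_chain_map_sd[OF c] eq by (simp add: sd_simps)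
  then have qa: "lin_chain_map p q a - bd (Suc p) d1 = bd (Suc p) d2 + sd n p e - lin_chain_map p q b"
    by (simp add: lin_chain_map_simps bd_simps algebra_simps)
  have "lin_chain_map p q b \<in> small_chains p Q {q ` nbhd}"
    by (rule lin_chain_map_small_chains[OF b q_cont]) (auto simp: nbhd_def)
  moreover have "bd (Suc p) d2 \<in> small_chains p Q {q ` nbhd}"
    using bd_small_chains[OF d2] by simp
  moreover have "sd n p e \<in> small_chains p Q {q ` nbhd}"
  proof (rule small_chains_mono)
    show "sd n p e \<in> small_chains p Q {{z}}"
      unfolding small_chains_singleton by (rule sd_chains[OF e])
  qed (use z_in_q_nbhd in auto)
  ultimately have qa_small: "lin_chain_map p q a - bd (Suc p) d1 \<in> small_chains p Q {q ` nbhd}"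
    unfolding qa by (intro small_chains_diff small_chains_add)
  (* The image of ?f is near z by qa_small, hence ?f is near the fibre. *)
  let ?f = "a - bd (Suc p) d1'"
  have bd_d1': "bd (Suc p) d1' \<in> small_chains p B {rest}"
    using bd_small_chains[OF d1'(1)] by simp
  have "bd (Suc p) d1 = lin_chain_map p q (bd (Suc p) d1')"
    unfolding d1'(2)[symmetric] using bd_lin_chain_map[OF small_chains_chain[OF d1'(1)]] by simp
  then have "lin_chain_map p q ?f \<in> small_chains p Q {q ` nbhd}"
    using qa_small by (simp add: lin_chain_map_simps)
  with small_chains_diff[OF a bd_d1'] have "?f \<in> chains p (subtopology B nbhd)"
    by (rule small_upstairs)
  from sd_small_in_nbhd[OF this] obtain m where m: "sd m p ?f \<in> small_chains p B (U ` I)"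
    by (elim exE)
  have "sd (m + n) p c - bd (Suc p) (sd m (Suc p) d1') = sd m p ?f + sd m p b"
    using bd_sd[OF small_chains_chain[OF d1'(1)], of m] unfolding sd_sd[symmetric] ab
    by (simp add: sd_simps)
  then have "sd (m + n) p c - bd (Suc p) (sd m (Suc p) d1') \<in> small_chains p B (U ` I)"
    using small_chains_add[OF m sd_small_chains[OF b]] by simp
  moreover have "bd p c \<in> small_chains (p - Suc 0) B (U ` I)"
    by (rule small_chains_mono[OF bdc]) (use F_U in auto)
  moreover have "sd m (Suc p) d1' \<in> chains (Suc p) B"
    by (rule sd_chains[OF small_chains_chain[OF d1'(1)]])
  ultimately have "\<exists>d'\<in>chains (Suc p) B. c - bd (Suc p) d' \<in> small_chains p B (U ` I)"
    by (intro sd_imp_homologous_small[OF c])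
  then show ?thesis
    by (rule bexE) (rule deform_small[OF c bdc])
qed

text \<open>
  The homotopy of \<open>Q\<close> induced by \<open>H\<close>. The choice of the preimage does not matter because \<open>H\<close> keeps the
  fibre of \<open>z\<close> in itself.
\<close>

definition descended :: "real \<times> 'b \<Rightarrow> 'b"
  where "descended = (\<lambda>(t, y). q (H (t, inv_into (topspace B) q y)))"

lemma H_in: "\<lbrakk>t \<in> {0..1}; x \<in> topspace B\<rbrakk> \<Longrightarrow> H (t, x) \<in> topspace B"
  using continuous_map_image_subset_topspace[OF H] by (auto simp: image_subset_iff)

lemma q_H_z: "\<lbrakk>t \<in> {0..1}; x \<in> topspace B; q x = z\<rbrakk> \<Longrightarrow> q (H (t, x)) = z"
  using q_z H_F H_in by (metis IntI)

lemma descended_q: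
  assumes "t \<in> {0..1}" "x \<in> topspace B"
  shows "descended (t, q x) = q (H (t, x))"
proof -
  let ?y = "inv_into (topspace B) q (q x)"
  have y: "?y \<in> topspace B" "q ?y = q x"
    using assms(2) by (auto intro: inv_into_into f_inv_into_f)
  then have "?y = x \<or> q x = z"
    using q_eq[of ?y x] assms(2) by auto
  then show ?thesis
    using q_H_z[OF assms(1), of x] q_H_z[OF assms(1), of ?y] y assms(2) by (auto simp: descended_def)
qed

lemma continuous_descended: "continuous_map (prod_topology (top_of_set {0..1}) Q) Q descended"
proof (rule continuous_compose_quotient_map)
  show "quotient_map (prod_topology (top_of_set {0..1::real}) B) (prod_topology (top_of_set {0..1}) Q) (\<lambda>(t, x). (t, q x))"
  proof (rule quotient_map_prod_right[OF _ _ q])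
    have "compact_space (top_of_set {0..1::real})"
      by (simp add: compact_space_subtopology)
    then show "locally_compact_space (top_of_set {0..1::real})"
      by (rule compact_imp_locally_compact_space)
    show "Hausdorff_space (top_of_set {0..1::real}) \<or> regular_space (top_of_set {0..1::real})"
      by (simp add: Hausdorff_space_subtopology)
  qed
  show "continuous_map (prod_topology (top_of_set {0..1}) B) Q (descended \<circ> (\<lambda>(t, x). (t, q x)))"
    by (rule continuous_map_eq[OF continuous_map_compose[OF H q_cont]]) (auto simp: descended_q)
qed

lemma descended_0: "y \<in> topspace Q \<Longrightarrow> descended (0, y) = y"
  using q_surj[of y] descended_q[of 0] H_0 by auto

lemma descended_z: "t \<in> {0..1} \<Longrightarrow> descended (t, z) = z"
  using q_surj[OF z] descended_q q_H_z by (metis)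

lemma descended_nbhd:
  assumes "y \<in> q ` nbhd"
  shows "descended (1, y) = z"
proof -
  obtain x i where x: "y = q x" "i \<in> I" "x \<in> U i"
    using assms by (auto simp: nbhd_def)
  then have x_in: "x \<in> topspace B"
    using nbhd_sub by (auto simp: nbhd_def)
  have "q (H (1, x)) = z"
    using q_z[OF H_in[of 1 x]] x_in H_U[OF x(2,3)] x(2) by auto
  then show ?thesis
    using descended_q[of 1 x] x_in x(1) by simp
qed

text \<open>
  The part of \<open>d\<close> away from \<open>z\<close> lifts to \<open>B\<close>, and the end of the homotopy moves the boundary of the lift,
  which is near the fibre, into the sets \<open>F i\<close>. Downstairs the same homotopy moves the rest of \<open>d\<close> to \<open>z\<close>.
\<close>

lemma collapse_surjective:
  assumes d: "d \<in> chains p Q" and bdd: "bd p d \<in> chains (p - Suc 0) (subtopology Q {z})"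
  shows "\<exists>c\<in>chains p B. bd p c \<in> small_chains (p - Suc 0) B (F ` I) \<and>
    (\<exists>d'\<in>chains (Suc p) Q. lin_chain_map p q c - d - bd (Suc p) d' \<in> chains p (subtopology Q {z}))"
proof -
  let ?h = "\<lambda>p. lin_chain_map p (\<lambda>x. H (1, x))"
  let ?k = "\<lambda>p. lin_chain_map p (\<lambda>y. descended (1, y))"
  have contH: "continuous_map B B (\<lambda>x. H (1, x))"
    using continuous_map_compose[OF _ H, of B "\<lambda>x. (1, x)"]
    by (simp add: continuous_map_pairwise comp_def)
  have contD: "continuous_map Q Q (\<lambda>y. descended (1, y))"
    using continuous_map_compose[OF _ continuous_descended, of Q "\<lambda>x. (1, x)"]
    by (simp add: continuous_map_pairwise comp_def)
  obtain n where n: "\<And>m. n \<le> m \<Longrightarrow> sd m p d \<in> small_chains p Q ({punctured} \<union> {q ` nbhd})"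
  proof (rule sd_small[OF d, of "{punctured} \<union> {q ` nbhd}"])
    show "openin Q V" if "V \<in> {punctured} \<union> {q ` nbhd}" for V
      using that openin_punctured openin_q_nbhd by blast
    show "topspace Q \<subseteq> \<Union> ({punctured} \<union> {q ` nbhd})"
      using z_in_q_nbhd by (auto simp: punctured_def)
  qed (rule that)
  obtain d1 d2 where d1: "d1 \<in> small_chains p Q {punctured}"
    and d2: "d2 \<in> small_chains p Q {q ` nbhd}" and d12: "sd n p d = d1 + d2"
    by (rule small_chains_split[OF n[of n]]) auto
  obtain d1' where d1': "d1' \<in> small_chains p B {rest}" "lin_chain_map p q d1' = d1"
    using lift_punctured[OF d1] by (rule bexE)
  have d1'c: "d1' \<in> chains p B"
    by (rule small_chains_chain[OF d1'(1)])
  let ?f = "bd p d1'"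
  have "lin_chain_map (p - Suc 0) q ?f = bd p d1"
    using bd_lin_chain_map[OF d1'c, of q] d1'(2) by simp
  also have "\<dots> = sd n (p - Suc 0) (bd p d) - bd p d2"
    using bd_sd[OF d, of n] d12 by (simp add: bd_simps eq_diff_eq)
  also have "\<dots> \<in> small_chains (p - Suc 0) Q {q ` nbhd}"
  proof (intro small_chains_diff bd_small_chains d2, rule small_chains_mono)
    show "sd n (p - Suc 0) (bd p d) \<in> small_chains (p - Suc 0) Q {{z}}"
      unfolding small_chains_singleton by (rule sd_chains[OF bdd])
  qed (use z_in_q_nbhd in auto)
  finally have "?f \<in> chains (p - Suc 0) (subtopology B nbhd)"
    by (rule small_upstairs[OF bd_small_chains[OF d1'(1)]])
  from sd_small_in_nbhd[OF this] obtain m where m: "sd m (p - Suc 0) ?f \<in> small_chains (p - Suc 0) B (U ` I)"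
    by (elim exE)
  define c where "c = ?h p (sd m p d1')"
  have c: "c \<in> chains p B"
    unfolding c_def by (intro lin_chain_map_chains[OF _ contH] sd_chains d1'c)
  have "bd p c = ?h (p - Suc 0) (sd m (p - Suc 0) ?f)"
    unfolding c_def bd_lin_chain_map[OF sd_chains[OF d1'c]] bd_sd[OF d1'c] ..
  then have bdc: "bd p c \<in> small_chains (p - Suc 0) B (F ` I)"
    using lin_chain_map_small_chains[OF m contH, of "F ` I"] H_U by auto
  define s where "s = sd (m + n) p d"
  have s: "s \<in> chains p Q"
    unfolding s_def by (rule sd_chains[OF d])
  have bds: "bd p s \<in> chains (p - Suc 0) (subtopology Q {z})"
    unfolding s_def bd_sd[OF d] by (rule sd_chains[OF bdd])
  have "lin_chain_map p q c = ?k p (lin_chain_map p q (sd m p d1'))"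
    unfolding c_def lin_chain_map_comp
    by (rule lin_chain_map_cong[OF sd_chains[OF d1'c]]) (simp add: descended_q)
  also have "\<dots> = ?k p (s - sd m p d2)"
    unfolding lin_chain_map_sd[OF d1'c] d1'(2) s_def sd_sd[symmetric] d12 by (simp add: sd_simps)
  finally have qc: "lin_chain_map p q c = ?k p s - ?k p (sd m p d2)"
    by (simp add: lin_chain_map_simps)
  have kd2: "?k p (sd m p d2) \<in> small_chains p Q {{z}}"
    by (rule lin_chain_map_small_chains[OF sd_small_chains[OF d2] contD]) (auto simp: descended_nbhd)
  have Ds: "homotopy_op descended p s \<in> chains (Suc p) Q"
    using homotopy_op_small_chains[of s p Q "{UNIV}" Q descended "{UNIV}"] s continuous_descended
    by (simp only: small_chains_UNIV) auto
  have bds': "bd p s \<in> small_chains (p - Suc 0) Q {{z}}"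
    unfolding small_chains_singleton by (rule bds)
  have bdd': "bd p d \<in> small_chains (p - Suc 0) Q {{z}}"
    unfolding small_chains_singleton by (rule bdd)
  have Dbds: "homotopy_op descended (p - Suc 0) (bd p s) \<in> small_chains p Q {{z}}"
  proof (rule homotopy_of_bd_small_chains[OF lin_map_homotopy_op bds'], erule homotopy_op_small_chains[OF _ continuous_descended])
    show "\<exists>S'\<in>{{z}}. \<forall>t\<in>{0..1}. \<forall>x\<in>S \<inter> topspace Q. descended (t, x) \<in> S'" if "S \<in> {{z}}" for S
      using that by (auto simp: descended_z)
  qed
  have "lin_chain_map p (\<lambda>y. descended (0, y)) s = s"
    by (rule lin_chain_map_id[OF s]) (rule descended_0)
  with bd_homotopy_op[OF s, of descended]
  have Ds_eq: "?k p s = bd (Suc p) (homotopy_op descended p s) + homotopy_op descended (p - Suc 0) (bd p s) + s"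
    by (simp add: eq_diff_eq)
  have "\<exists>d'\<in>chains (Suc p) Q. lin_chain_map p q c - d - bd (Suc p) d' \<in> small_chains p Q {{z}}"
  proof (rule sd_homotopy[where 'a = 'b and 'k = 'c and n = "m + n"])
    fix h :: "nat \<Rightarrow> ('b, 'c) lin_chain \<Rightarrow> ('b, 'c) lin_chain"
    assume lin: "\<And>p. lin_map (h p)"
      and h_small: "\<And>p X \<F> c. c \<in> small_chains p X \<F> \<Longrightarrow> h p c \<in> small_chains (Suc p) X \<F>"
      and h_eq: "\<And>p (X :: 'b topology) c. c \<in> chains p X
        \<Longrightarrow> bd (Suc p) (h p c) + h (p - Suc 0) (bd p c) = sd (m + n) p c - c"
    have hd: "h p d \<in> chains (Suc p) Q"
      using h_small[of d p Q "{UNIV}"] d by (simp only: small_chains_UNIV)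
    have hbd: "h (p - Suc 0) (bd p d) \<in> small_chains p Q {{z}}"
      by (rule homotopy_of_bd_small_chains[OF lin bdd']) (rule h_small)
    have s_eq: "s = bd (Suc p) (h p d) + h (p - Suc 0) (bd p d) + d"
      using h_eq[OF d] by (simp add: s_def)
    have "lin_chain_map p q c - d - bd (Suc p) (homotopy_op descended p s + h p d)
        = homotopy_op descended (p - Suc 0) (bd p s) + h (p - Suc 0) (bd p d) - ?k p (sd m p d2)"
      unfolding qc Ds_eq by (subst (3) s_eq) (simp add: bd_simps algebra_simps)
    also have "\<dots> \<in> small_chains p Q {{z}}"
      by (intro small_chains_diff small_chains_add Dbds hbd kd2)
    finally show ?thesis
      using chains_add[OF Ds hd] by (rule bexI)
  qed
  then show ?thesis
    unfolding small_chains_singleton using c bdc by (intro bexI[of _ c] conjI)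
qed

end


section \<open>Commuting retractions split a group\<close>

text \<open>
  By Moebius inversion in the lattice of subsets this is the alternating sum of \<open>r L c\<close> over the
  subsets \<open>L\<close> of \<open>J\<close>. The recursion says the same without signs: \<open>r J\<close> is the sum of the parts for the
  subsets of \<open>J\<close>. On infinite sets, where the recursion would not end, the value is a dummy.
\<close>

function moebius_part :: "('v set \<Rightarrow> 'c \<Rightarrow> 'c::ab_group_add) \<Rightarrow> 'v set \<Rightarrow> 'c \<Rightarrow> 'c" where
  "moebius_part r J c = (if finite J then r J c - (\<Sum>L\<in>{L. L \<subset> J}. moebius_part r L c) else 0)"
  by auto
termination
  by (relation "measure (\<lambda>(r, J, c). card J)") (auto intro: psubset_card_mono)

declare moebius_part.simps [simp del]

locale retractions =
  fixes V :: "'v set" and r :: "'v set \<Rightarrow> 'c::ab_group_add \<Rightarrow> 'c"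
  assumes finite_V: "finite V"
    and r_add: "J \<subseteq> V \<Longrightarrow> r J (a + b) = r J a + r J b"
    and r_comp: "\<lbrakk>J \<subseteq> V; L \<subseteq> V\<rbrakk> \<Longrightarrow> r J (r L c) = r (J \<inter> L) c"
begin

abbreviation part :: "'v set \<Rightarrow> 'c \<Rightarrow> 'c"
  where "part \<equiv> moebius_part r"

lemma finite_sub: "J \<subseteq> V \<Longrightarrow> finite J"
  using finite_V by (rule rev_finite_subset)

lemma part_eq: "J \<subseteq> V \<Longrightarrow> part J c = r J c - (\<Sum>L\<in>{L. L \<subset> J}. part L c)"
  using finite_sub[of J] by (subst moebius_part.simps) simp

lemma r_zero: "J \<subseteq> V \<Longrightarrow> r J 0 = 0"
  using r_add[of J 0 0] by simp

lemma r_diff: "J \<subseteq> V \<Longrightarrow> r J (a - b) = r J a - r J b"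
  using r_add[of J "a - b" b] by (simp add: eq_diff_eq)

lemma r_sum: "J \<subseteq> V \<Longrightarrow> r J (sum f S) = (\<Sum>s\<in>S. r J (f s))"
  by (induction S rule: infinite_finite_induct) (auto simp: r_add r_zero)

lemma r_eq_sum_part:
  assumes "J \<subseteq> V"
  shows "r J c = (\<Sum>L\<in>Pow J. part L c)"
proof -
  have "Pow J = insert J {L. L \<subset> J}" "J \<notin> {L. L \<subset> J}" "finite {L. L \<subset> J}"
    using finite_sub[OF assms] by (auto intro: finite_subset[of _ "Pow J"])
  then show ?thesis
    using part_eq[OF assms, of c] by simp
qed

lemma sum_part_below:
  assumes J: "J \<subseteq> V" and M: "M \<subseteq> V"
  shows "r (M \<inter> J) c - (\<Sum>L\<in>{L. L \<subset> J}. if L \<subseteq> M then part L c else 0) = (if J \<subseteq> M then part J c else 0)"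
proof -
  have fin: "finite {L. L \<subset> J}"
    using finite_sub[OF J] by (auto intro: finite_subset[of _ "Pow J"])
  have "r (M \<inter> J) c = (\<Sum>L\<in>Pow (M \<inter> J). part L c)"
    using J by (intro r_eq_sum_part) auto
  moreover have "(\<Sum>L\<in>{L. L \<subset> J}. if L \<subseteq> M then part L c else 0) = (\<Sum>L\<in>{L. L \<subset> J \<and> L \<subseteq> M}. part L c)"
    using fin by (simp add: sum.inter_filter[symmetric] cong: conj_cong)
  moreover have "Pow (M \<inter> J) = (if J \<subseteq> M then insert J {L. L \<subset> J \<and> L \<subseteq> M} else {L. L \<subset> J \<and> L \<subseteq> M})"
    by auto
  moreover have "finite {L. L \<subset> J \<and> L \<subseteq> M}"
    using fin by (rule rev_finite_subset) auto
  ultimately show ?thesis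
    by (cases "J \<subseteq> M") simp_all
qed

text \<open>
  The parts are simultaneous eigenvectors of the retractions.
\<close>

lemma r_part:
  assumes "J \<subseteq> V" and M: "M \<subseteq> V"
  shows "r M (part J c) = (if J \<subseteq> M then part J c else 0)"
  using finite_sub[OF assms(1)] assms(1)
proof (induction J rule: finite_psubset_induct)
  case (psubset J)
  have "r M (part J c) = r (M \<inter> J) c - (\<Sum>L\<in>{L. L \<subset> J}. r M (part L c))"
    using psubset.prems M by (simp add: part_eq[of J] r_diff r_sum r_comp)
  also have "(\<Sum>L\<in>{L. L \<subset> J}. r M (part L c)) = (\<Sum>L\<in>{L. L \<subset> J}. if L \<subseteq> M then part L c else 0)"
    by (rule sum.cong) (use psubset in auto)
  finally show ?case
    using sum_part_below[OF psubset.prems M] by simp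
qed

lemma part_r:
  assumes "J \<subseteq> V" and M: "M \<subseteq> V"
  shows "part J (r M c) = (if J \<subseteq> M then part J c else 0)"
  using finite_sub[OF assms(1)] assms(1)
proof (induction J rule: finite_psubset_induct)
  case (psubset J)
  have "part J (r M c) = r (M \<inter> J) c - (\<Sum>L\<in>{L. L \<subset> J}. part L (r M c))"
    using psubset.prems M by (simp add: part_eq[of J] r_comp Int_commute)
  also have "(\<Sum>L\<in>{L. L \<subset> J}. part L (r M c)) = (\<Sum>L\<in>{L. L \<subset> J}. if L \<subseteq> M then part L c else 0)"
    by (rule sum.cong) (use psubset in auto)
  finally show ?case
    using sum_part_below[OF psubset.prems M] by simp
qed

lemma part_zero: "J \<subseteq> V \<Longrightarrow> part J 0 = 0"
proof (induction J rule: measure_induct_rule[of card])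
  case (less J)
  have "(\<Sum>L\<in>{L. L \<subset> J}. part L 0) = 0"
    using less finite_sub[of J] by (intro sum.neutral) (auto intro: psubset_card_mono)
  then show ?case
    using less.prems by (simp add: part_eq r_zero)
qed

lemma part_part:
  assumes J: "J \<subseteq> V"
  shows "part J (part J c) = part J c"
proof -
  have "part L (part J c) = 0" if "L \<subset> J" for L
  proof -
    have "part L (part J c) = part L (r L (part J c))"
      using part_r[of L L "part J c"] that J by auto
    also have "\<dots> = 0"
      using that J by (subst r_part) (auto simp: part_zero)
    finally show ?thesis .
  qed
  then have "part J (part J c) = r J (part J c)"
    using part_eq[OF J, of "part J c"] by simp
  then show ?thesis
    using r_part[OF J J] by simp
qed

end


section \<open>Reduced cycles\<close>

lemma singular_simplex_point:
  assumes "singular_simplex p (subtopology X {z}) \<sigma>"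
  shows "\<sigma> = restrict (\<lambda>_. z) (standard_simplex p)"
proof
  fix x
  have \<sigma>: "singular_simplex p X \<sigma>" "\<sigma> ` standard_simplex p \<subseteq> {z}"
    using assms unfolding singular_simplex_subtopology by simp_all
  then have "\<sigma> \<in> extensional (standard_simplex p)"
    by (simp add: singular_simplex_def)
  with \<sigma>(2) show "\<sigma> x = restrict (\<lambda>_. z) (standard_simplex p) x"
    by (auto simp: extensional_def image_subset_iff)
qed

lemma single_eq_0_iff: "Poly_Mapping.single s a = 0 \<longleftrightarrow> a = 0"
  by (metis lookup_single_eq lookup_zero single_zero)

lemma single_sum: "Poly_Mapping.single s (sum f S) = (\<Sum>x\<in>S. Poly_Mapping.single s (f x))"
  by (induction S rule: infinite_finite_induct) (auto simp: single_add)

lemma chain_at_point: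
  assumes "c \<in> chains p (subtopology X {z})"
  obtains a where "c = Poly_Mapping.single (restrict (\<lambda>_. z) (standard_simplex p)) a"
proof -
  let ?s = "restrict (\<lambda>_. z) (standard_simplex p)"
  have "\<sigma> = ?s" if "\<sigma> \<in> Poly_Mapping.keys c" for \<sigma>
    using that assms by (intro singular_simplex_point) auto
  then have "c = Poly_Mapping.single ?s (Poly_Mapping.lookup c ?s)"
    by (intro poly_mapping_eqI) (metis in_keys_iff lookup_single_eq lookup_single_not_eq)
  then show thesis
    by (rule that)
qed

text \<open>
  All faces of a constant simplex agree, so that its boundary is an alternating sum of equal terms.
\<close>

lemma bd_at_point:
  fixes a :: "'k::comm_ring_1"
  assumes "z \<in> topspace X"
  shows "bd p (Poly_Mapping.single (restrict (\<lambda>_. z) (standard_simplex p)) a) =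
    (if p = 0 \<or> odd p then 0 else Poly_Mapping.single (restrict (\<lambda>_. z) (standard_simplex (p - Suc 0))) a)"
proof -
  have "singular_chain p (subtopology X {z}) (frag_of (restrict (\<lambda>_. z) (standard_simplex p)))"
    using assms by (auto simp: singular_chain_of singular_simplex_def)
  from chain_boundary_of_singleton[OF _ this] show ?thesis
    using assms by (auto simp: bd_def)
qed

lemma lin_chain_map_const:
  "lin_chain_map p (\<lambda>_. z) c = Poly_Mapping.single (restrict (\<lambda>_. z) (standard_simplex p))
     (\<Sum>\<sigma>\<in>Poly_Mapping.keys c. Poly_Mapping.lookup c \<sigma>)"
proof -
  have "simplex_map p (\<lambda>_. z) \<sigma> = restrict (\<lambda>_. z) (standard_simplex p)" for \<sigma> :: "(nat \<Rightarrow> real) \<Rightarrow> 'c"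
    by (simp add: simplex_map_def comp_def)
  then show ?thesis
    by (simp add: lin_chain_map_def lin_extend_def single_sum)
qed

text \<open>
  The augmentation is the chain map to a point; the point \<open>z\<close> is arbitrary and may be in any type.
\<close>

lemma reduced_cycles_iff:
  "c \<in> reduced_cycles p X \<longleftrightarrow> c \<in> chains p X \<and> bd p c = 0 \<and> (p = 0 \<longrightarrow> lin_chain_map 0 (\<lambda>_. z) c = 0)"
proof (cases "p = 0")
  case True
  with True show ?thesis
    by (auto simp: reduced_cycles_def lin_chain_map_const single_eq_0_iff)
qed (auto simp: reduced_cycles_def lin_boundary_eq_bd)

lemma boundaries_eq: "boundaries p X = bd (Suc p) ` chains (Suc p) X"
  by (simp add: boundaries_def lin_boundary_eq_bd)

lemma reduced_cycles_chains: "c \<in> reduced_cycles p X \<Longrightarrow> c \<in> chains p X"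
  by (simp add: reduced_cycles_def)

lemma reduced_cycles_bd: "c \<in> reduced_cycles p X \<Longrightarrow> bd p c = 0"
  using reduced_cycles_iff[of c p X "()"] by simp

lemma reduced_cycles_zero [simp]: "0 \<in> reduced_cycles p X"
  and reduced_cycles_add: "\<lbrakk>a \<in> reduced_cycles p X; b \<in> reduced_cycles p X\<rbrakk> \<Longrightarrow> a + b \<in> reduced_cycles p X"
  and reduced_cycles_diff: "\<lbrakk>a \<in> reduced_cycles p X; b \<in> reduced_cycles p X\<rbrakk> \<Longrightarrow> a - b \<in> reduced_cycles p X"
  and reduced_cycles_scale: "a \<in> reduced_cycles p X \<Longrightarrow> lin_scale t a \<in> reduced_cycles p X"
  unfolding reduced_cycles_iff[where z = "()"]
  by (simp_all only: chains_zero chains_add chains_diff chains_scale bd_simps lin_chain_map_simps) simp_all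

lemma boundaries_zero [simp]: "0 \<in> boundaries p X"
  unfolding boundaries_eq by (rule image_eqI[of _ _ 0]) (simp_all add: bd_simps)

lemma boundaries_add:
  assumes "a \<in> boundaries p X" "b \<in> boundaries p X"
  shows "a + b \<in> boundaries p X"
proof -
  obtain c d where "c \<in> chains (Suc p) X" "a = bd (Suc p) c" "d \<in> chains (Suc p) X" "b = bd (Suc p) d"
    using assms by (auto simp: boundaries_eq)
  then show ?thesis
    unfolding boundaries_eq by (intro image_eqI[of _ _ "c + d"] chains_add) (simp_all only: bd_simps)
qed

lemma boundaries_scale:
  assumes "a \<in> boundaries p X"
  shows "lin_scale t a \<in> boundaries p X"
proof -
  obtain c where "c \<in> chains (Suc p) X" "a = bd (Suc p) c"
    using assms by (auto simp: boundaries_eq)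
  then show ?thesis
    unfolding boundaries_eq by (intro image_eqI[of _ _ "lin_scale t c"] chains_scale) (simp_all only: bd_simps)
qed

lemma boundaries_sum: "(\<And>i. i \<in> S \<Longrightarrow> f i \<in> boundaries p X) \<Longrightarrow> sum f S \<in> boundaries p X"
  by (induction S rule: infinite_finite_induct) (auto simp: boundaries_add)

lemma boundaries_sub_reduced_cycles:
  fixes c :: "('a, 'k::comm_ring_1) lin_chain"
  assumes "c \<in> boundaries p X"
  shows "c \<in> reduced_cycles p X"
proof -
  obtain d where d: "d \<in> chains (Suc p) X" "c = bd (Suc p) d"
    using assms by (auto simp: boundaries_eq)
  have "lin_chain_map 0 (\<lambda>_. ()) c = 0" if "p = 0"
  proof -
    have "lin_chain_map 0 (\<lambda>_. ()) c = bd (Suc 0) (lin_chain_map (Suc 0) (\<lambda>_. ()) d)"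
      using bd_lin_chain_map[OF d(1), of "\<lambda>_. ()"] d(2) that by simp
    also have "\<dots> = 0"
      unfolding lin_chain_map_const
      by (subst bd_at_point[of _ "discrete_topology UNIV"]) auto
    finally show ?thesis .
  qed
  moreover have "bd p c = 0"
    using bd_bd[OF d(1)] d(2) by simp
  moreover have "c \<in> chains p X"
    using bd_chains[OF d(1)] d(2) by simp
  ultimately show ?thesis
    unfolding reduced_cycles_iff[where z = "()"] by blast
qed

lemma lin_chain_map_reduced_cycles:
  assumes "c \<in> reduced_cycles p X" "continuous_map X Y f"
  shows "lin_chain_map p f c \<in> reduced_cycles p Y"
proof -
  have c: "c \<in> chains p X" "bd p c = 0" "p = 0 \<longrightarrow> lin_chain_map 0 (\<lambda>_. ()) c = 0"
    using assms(1) reduced_cycles_iff[of c p X "()"] by auto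
  have "lin_chain_map p f c \<in> chains p Y"
    using lin_chain_map_chains[OF c(1) assms(2)] .
  moreover have "bd p (lin_chain_map p f c) = 0"
    unfolding bd_lin_chain_map[OF c(1)] c(2) by (simp add: lin_chain_map_simps)
  moreover have "p = 0 \<longrightarrow> lin_chain_map 0 (\<lambda>_. ()) (lin_chain_map p f c) = 0"
    using c(3) by (auto simp: lin_chain_map_comp comp_def)
  ultimately show ?thesis
    unfolding reduced_cycles_iff[where z = "()"] by blast
qed

lemma lin_chain_map_boundaries:
  assumes "c \<in> boundaries p X" "continuous_map X Y f"
  shows "lin_chain_map p f c \<in> boundaries p Y"
proof -
  obtain d where d: "d \<in> chains (Suc p) X" "c = bd (Suc p) d"
    using assms by (auto simp: boundaries_eq)
  have "lin_chain_map p f c = bd (Suc p) (lin_chain_map (Suc p) f d)"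
    using bd_lin_chain_map[OF d(1), of f] d(2) by simp
  then show ?thesis
    unfolding boundaries_eq by (rule image_eqI) (rule lin_chain_map_chains[OF d(1) assms(2)])
qed

text \<open>
  The reduced homology of a point vanishes. In degree 0 this is the place where the augmentation is used.
\<close>

lemma reduced_cycle_at_point_is_boundary:
  fixes t :: "('a, 'k::comm_ring_1) lin_chain"
  assumes z: "z \<in> topspace X" and t: "t \<in> reduced_cycles p X" "t \<in> chains p (subtopology X {z})"
  shows "t \<in> boundaries p X"
proof -
  let ?s = "\<lambda>p. restrict (\<lambda>_. z) (standard_simplex p)"
  obtain a where a: "t = Poly_Mapping.single (?s p) a"
    using t(2) by (rule chain_at_point)
  consider "p = 0" | "odd p" | "p \<noteq> 0" "even p"
    by auto
  then show ?thesis
  proof cases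
    case 1
    then have "lin_chain_map 0 (\<lambda>_. z) t = 0"
      using t(1) reduced_cycles_iff[of t p X z] by simp
    moreover have "lin_chain_map 0 (\<lambda>_. z) t = t"
      using t(2) 1 by (intro lin_chain_map_id[of t 0 "subtopology X {z}"]) auto
    ultimately show ?thesis
      by simp
  next
    case 2
    have "bd (Suc p) (Poly_Mapping.single (?s (Suc p)) a) = t"
      using 2 a bd_at_point[OF z, of "Suc p" a] by simp
    moreover have "Poly_Mapping.single (?s (Suc p)) a \<in> chains (Suc p) X"
      using z by (auto simp: singular_simplex_def)
    ultimately show ?thesis
      unfolding boundaries_eq by (metis image_eqI)
  next
    case 3
    have "bd p t = 0"
      using t(1) by (rule reduced_cycles_bd)
    then have "a = 0"
      using 3 a bd_at_point[OF z, of p a] by (simp add: single_eq_0_iff)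
    then show ?thesis
      using a by simp
  qed
qed

lemma reduced_cycle_boundary_mod_point:
  assumes z: "z \<in> topspace X" and c: "c \<in> reduced_cycles p X"
    and d: "d \<in> chains (Suc p) X" and small: "c - bd (Suc p) d \<in> chains p (subtopology X {z})"
  shows "c \<in> boundaries p X"
proof -
  have b: "bd (Suc p) d \<in> boundaries p X"
    unfolding boundaries_eq using d by (rule imageI)
  then have "c - bd (Suc p) d \<in> boundaries p X"
    using reduced_cycles_diff[OF c boundaries_sub_reduced_cycles] small
    by (intro reduced_cycle_at_point_is_boundary[OF z]) auto
  from boundaries_add[OF this b] show ?thesis
    by simp
qed


section \<open>The homology splitting\<close>

lemma lin_map_sum_ops:
  assumes "\<And>i. i \<in> S \<Longrightarrow> lin_map (F i)"
  shows "lin_map (\<lambda>c. \<Sum>i\<in>S. F i c)"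
  using assms
  by (induction S rule: infinite_finite_induct) (auto simp: lin_map_plus lin_map_def[of "\<lambda>_. 0"])


text \<open>
  A space with commuting retractions \<open>r J\<close>, together with quotients of the images of the \<open>r J\<close> by the
  union of the images of the \<open>r (J - {j})\<close> with \<open>j \<in> J\<close>.
\<close>

locale splitting =
  fixes Y :: "'a topology" and V :: "'v set" and r :: "'v set \<Rightarrow> 'a \<Rightarrow> 'a"
    and Q :: "'v set \<Rightarrow> 'b topology" and q :: "'v set \<Rightarrow> 'a \<Rightarrow> 'b"
    and N :: "'v \<Rightarrow> 'a set" and H :: "real \<times> 'a \<Rightarrow> 'a" and base :: 'a
  assumes finite_V: "finite V"
    and r_cont: "J \<subseteq> V \<Longrightarrow> continuous_map Y Y (r J)"
    and r_comp: "\<lbrakk>J \<subseteq> V; L \<subseteq> V\<rbrakk> \<Longrightarrow> r J (r L x) = r (J \<inter> L) x"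
    and r_V: "x \<in> topspace Y \<Longrightarrow> r V x = x"
    and r_empty: "x \<in> topspace Y \<Longrightarrow> r {} x = base"
    and base: "base \<in> topspace Y"
    and proj_cont: "\<lbrakk>J \<subseteq> V; J \<noteq> {}\<rbrakk> \<Longrightarrow> continuous_map Y (Q J) (q J)"
    and q_r: "\<lbrakk>J \<subseteq> V; J \<noteq> {}; x \<in> topspace Y\<rbrakk> \<Longrightarrow> q J (r J x) = q J x"
    and collapse: "\<lbrakk>J \<subseteq> V; J \<noteq> {}\<rbrakk> \<Longrightarrow>
      collapse (subtopology Y {x. r J x = x}) (Q J) (q J) J (\<lambda>j. {x. r (J - {j}) x = x})
        (\<lambda>j. {x \<in> topspace Y. r J x = x} \<inter> N j) H (q J base)"
begin

definition piece :: "'v set \<Rightarrow> 'a set"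
  where "piece J = {x. r J x = x}"

definition faces :: "'v set \<Rightarrow> 'a set set"
  where "faces J = (\<lambda>j. piece (J - {j})) ` J"

definition r_chain :: "nat \<Rightarrow> 'v set \<Rightarrow> ('a, 'k::comm_ring_1) lin_chain \<Rightarrow> ('a, 'k) lin_chain"
  where "r_chain p J = lin_chain_map p (r J)"

abbreviation e :: "nat \<Rightarrow> 'v set \<Rightarrow> ('a, 'k::comm_ring_1) lin_chain \<Rightarrow> ('a, 'k) lin_chain"
  where "e p \<equiv> moebius_part (r_chain p)"

lemma retractions_r_chain: "retractions V (r_chain p :: _ \<Rightarrow> ('a, 'k::comm_ring_1) lin_chain \<Rightarrow> _)"
proof
  show "r_chain p J (r_chain p L c) = r_chain p (J \<inter> L) c"
    if "J \<subseteq> V" "L \<subseteq> V" for J L and c :: "('a, 'k) lin_chain"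
  proof -
    have "r J \<circ> r L = r (J \<inter> L)"
      using r_comp[OF that] by auto
    then show ?thesis
      by (simp only: r_chain_def lin_chain_map_comp)
  qed
qed (simp_all add: finite_V r_chain_def lin_chain_map_simps)

lemmas e_eq = retractions.part_eq[OF retractions_r_chain]
lemmas r_chain_e = retractions.r_part[OF retractions_r_chain]
lemmas e_r_chain = retractions.part_r[OF retractions_r_chain]
lemmas e_e = retractions.part_part[OF retractions_r_chain]
lemmas r_chain_eq_sum = retractions.r_eq_sum_part[OF retractions_r_chain]

lemma finite_sub: "J \<subseteq> V \<Longrightarrow> finite J"
  using finite_V by (rule rev_finite_subset)

lemma e_induct [consumes 1, case_names step]:
  assumes "J \<subseteq> V" "\<And>J. \<lbrakk>J \<subseteq> V; \<And>L. L \<subset> J \<Longrightarrow> P L\<rbrakk> \<Longrightarrow> P J"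
  shows "P J"
  using finite_sub[OF assms(1)] assms(1)
proof (induction J rule: finite_psubset_induct)
  case (psubset J)
  show ?case
  proof (rule assms(2)[OF psubset.prems])
    show "P L" if "L \<subset> J" for L
      using psubset.IH[OF that] that psubset.prems by auto
  qed
qed

lemma lin_map_e: "J \<subseteq> V \<Longrightarrow> lin_map (e p J :: ('a, 'k::comm_ring_1) lin_chain \<Rightarrow> ('a, 'k) lin_chain)"
proof (induction J rule: e_induct)
  case (step J)
  have "lin_map (\<lambda>c :: ('a, 'k) lin_chain. \<Sum>L\<in>{L. L \<subset> J}. e p L c)"
    by (rule lin_map_sum_ops) (simp add: step(2))
  from lin_map_minus'[OF _ this, of "r_chain p J"] show ?case
    unfolding e_eq[OF step(1), abs_def] by (simp add: r_chain_def)
qed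

lemma r_chain_chains: "\<lbrakk>c \<in> chains p Y; J \<subseteq> V\<rbrakk> \<Longrightarrow> r_chain p J c \<in> chains p Y"
  unfolding r_chain_def by (rule lin_chain_map_chains[OF _ r_cont])

lemma bd_r_chain: "c \<in> chains p Y \<Longrightarrow> bd p (r_chain p J c) = r_chain (p - Suc 0) J (bd p c)"
  unfolding r_chain_def by (rule bd_lin_chain_map)

lemma e_chains:
  assumes c: "c \<in> chains p Y"
  shows "J \<subseteq> V \<Longrightarrow> e p J c \<in> chains p Y"
proof (induction J rule: e_induct)
  case (step J)
  then show ?case
    unfolding e_eq[OF step(1)]
    by (intro chains_diff chains_sum r_chain_chains[OF c]) auto
qed

lemma bd_e:
  assumes c: "c \<in> chains p Y"
  shows "J \<subseteq> V \<Longrightarrow> bd p (e p J c) = e (p - Suc 0) J (bd p c)"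
proof (induction J rule: e_induct)
  case (step J)
  then show ?case
    unfolding e_eq[OF step(1)] by (simp add: bd_simps bd_r_chain[OF c])
qed

lemma piece_mono:
  assumes "L \<subseteq> J" "J \<subseteq> V"
  shows "piece L \<subseteq> piece J"
proof
  fix x
  assume "x \<in> piece L"
  then have x: "r L x = x"
    by (simp add: piece_def)
  have "r J (r L x) = r (J \<inter> L) x"
    using assms by (intro r_comp) auto
  moreover have "J \<inter> L = L"
    using assms by auto
  ultimately show "x \<in> piece J"
    using x by (simp add: piece_def)
qed

lemma r_in_piece: "J \<subseteq> V \<Longrightarrow> r J x \<in> piece J"
  using r_comp[of J J x] by (simp add: piece_def)

lemma piece_sub_face:
  assumes "L \<subset> J" "J \<subseteq> V"
  shows "\<exists>S\<in>faces J. piece L \<subseteq> S"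
proof -
  obtain j where "j \<in> J" "L \<subseteq> J - {j}"
    using assms by blast
  moreover have "J - {j} \<subseteq> V"
    using assms by blast
  ultimately show ?thesis
    using piece_mono[of L "J - {j}"] by (auto simp: faces_def)
qed

lemma r_chain_piece:
  assumes "c \<in> chains p Y" "J \<subseteq> V"
  shows "r_chain p J c \<in> small_chains p Y {piece J}"
  unfolding r_chain_def
  by (rule lin_chain_map_small_chains[of c p Y "{UNIV}"]) (use assms r_cont r_in_piece in \<open>auto simp: small_chains_UNIV\<close>)

lemma e_piece:
  assumes "c \<in> chains p Y" "J \<subseteq> V"
  shows "e p J c \<in> small_chains p Y {piece J}"
  using r_chain_piece[OF e_chains[OF assms] assms(2)] r_chain_e[OF assms(2) assms(2), of p c] by simp

text \<open>
  By the recursion the difference is, up to the sign, the sum of the parts for the proper subsets of \<open>J\<close>.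
\<close>

lemma e_minus_r_chain:
  assumes c: "c \<in> chains p Y" and J: "J \<subseteq> V"
  shows "e p J c - r_chain p J c \<in> small_chains p Y (faces J)"
proof -
  have "e p L c \<in> small_chains p Y (faces J)" if "L \<subset> J" for L
    by (rule small_chains_mono[OF e_piece[OF c]]) (use that J piece_sub_face[of L J] in auto)
  then have "- (\<Sum>L\<in>{L. L \<subset> J}. e p L c) \<in> small_chains p Y (faces J)"
    by (intro small_chains_minus small_chains_sum) auto
  then show ?thesis
    by (simp add: e_eq[OF J])
qed

lemma r_chain_fixed: "\<lbrakk>c \<in> small_chains p Y {piece J}; J \<subseteq> V\<rbrakk> \<Longrightarrow> r_chain p J c = c"
  unfolding r_chain_def small_chains_singleton
  by (rule lin_chain_map_id) (auto simp: piece_def)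

text \<open>
  A chain in the face without \<open>j\<close> is fixed by the retraction to this face, and the part for \<open>J\<close> of a chain
  in the image of that retraction is zero.
\<close>

lemma e_faces:
  fixes c :: "('a, 'k::comm_ring_1) lin_chain"
  assumes c: "c \<in> small_chains p Y (faces J)" and J: "J \<subseteq> V"
  shows "e p J c = 0"
proof -
  have "e p J c = (\<lambda>_. 0 :: ('a, 'k) lin_chain) c"
  proof (rule lin_map_eqI[OF lin_map_e[OF J]])
    fix \<sigma>
    assume "\<sigma> \<in> Poly_Mapping.keys c"
    then obtain j where j: "j \<in> J" "singular_simplex p (subtopology Y (piece (J - {j}))) \<sigma>"
      using c by (auto simp: small_chains_def faces_def)
    let ?s = "Poly_Mapping.single \<sigma> 1 :: ('a, 'k) lin_chain"
    have "?s \<in> small_chains p Y {piece (J - {j})}"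
      using j by (auto simp: small_chains_def)
    then have "?s = r_chain p (J - {j}) ?s"
      using J by (intro r_chain_fixed[symmetric]) auto
    then have "e p J ?s = e p J (r_chain p (J - {j}) ?s)"
      by (rule arg_cong)
    also have "\<dots> = 0"
      using J j by (subst e_r_chain) auto
    finally show "e p J ?s = 0" .
  qed (simp add: lin_map_def)
  then show ?thesis
    by simp
qed

lemma q_faces:
  assumes c: "c \<in> small_chains p Y (faces J)" and J: "J \<subseteq> V" "J \<noteq> {}"
  shows "lin_chain_map p (q J) c \<in> chains p (subtopology (Q J) {q J base})"
proof -
  interpret collapse "subtopology Y {x. r J x = x}" "Q J" "q J" J "\<lambda>j. {x. r (J - {j}) x = x}"
      "\<lambda>j. {x \<in> topspace Y. r J x = x} \<inter> N j" H "q J base"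
    by (rule collapse[OF J])
  have "q J x = q J base" if "j \<in> J" "x \<in> topspace Y" "x \<in> piece (J - {j})" for j x
  proof -
    have "x \<in> piece J"
      using piece_mono[of "J - {j}" J] that J by auto
    then show ?thesis
      using q_z[of x] that by (auto simp: piece_def)
  qed
  then have "\<exists>S'\<in>{{q J base}}. \<forall>x\<in>S \<inter> topspace Y. q J x \<in> S'" if "S \<in> faces J" for S
    using that by (auto simp: faces_def)
  from lin_chain_map_small_chains[OF c proj_cont[OF J] this] show ?thesis
    by (simp only: small_chains_singleton)
qed

lemma q_r_chain:
  assumes "c \<in> chains p Y" "J \<subseteq> V" "J \<noteq> {}"
  shows "lin_chain_map p (q J) (r_chain p J c) = lin_chain_map p (q J) c"
  unfolding r_chain_def lin_chain_map_comp
  by (rule lin_chain_map_cong[OF assms(1)]) (use q_r assms in auto)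

text \<open>
  It suffices that every part \<open>e p J c\<close> is a boundary. Its image in the quotient bounds up to the base
  point, so it bounds in the image of \<open>r J\<close> up to chains in the faces.
\<close>

theorem homology_splitting_injective:
  fixes c :: "('a, 'k::comm_ring_1) lin_chain"
  assumes c: "c \<in> reduced_cycles p Y"
    and proj: "\<And>J. \<lbrakk>J \<subseteq> V; J \<noteq> {}\<rbrakk> \<Longrightarrow> lin_chain_map p (q J) c \<in> boundaries p (Q J)"
  shows "c \<in> boundaries p Y"
proof -
  have cc: "c \<in> chains p Y"
    using c by (rule reduced_cycles_chains)
  have "e p J c \<in> boundaries p Y" if J: "J \<subseteq> V" for J
  proof (cases "J = {}")
    case True
    have e: "e p J c = lin_chain_map p (r {}) c"
      using e_eq[OF J, of p c] True by (simp add: r_chain_def)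
    have "lin_chain_map p (r {}) c \<in> reduced_cycles p Y"
      by (rule lin_chain_map_reduced_cycles[OF c r_cont]) simp
    moreover have "lin_chain_map p (r {}) c \<in> chains p (subtopology Y {base})"
      unfolding small_chains_singleton[symmetric]
      by (rule lin_chain_map_small_chains[of c p Y "{UNIV}"])
         (use cc r_cont[of "{}"] r_empty in \<open>auto simp: small_chains_UNIV\<close>)
    ultimately show ?thesis
      unfolding e by (intro reduced_cycle_at_point_is_boundary[OF base])
  next
    case False
    interpret collapse "subtopology Y {x. r J x = x}" "Q J" "q J" J "\<lambda>j. {x. r (J - {j}) x = x}"
        "\<lambda>j. {x \<in> topspace Y. r J x = x} \<inter> N j" H "q J base"
      by (rule collapse[OF J False])
    have ec: "e p J c \<in> chains p (subtopology Y {x. r J x = x})"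
      using e_piece[OF cc J] by (simp only: small_chains_singleton piece_def)
    have bdec: "bd p (e p J c) = 0"
      unfolding bd_e[OF cc J] reduced_cycles_bd[OF c] by (rule lin_map_zero[OF lin_map_e[OF J]])
    obtain d where d: "d \<in> chains (Suc p) (Q J)" "lin_chain_map p (q J) c = bd (Suc p) d"
      using proj[OF J False] by (auto simp: boundaries_eq)
    let ?t = "lin_chain_map p (q J) (e p J c - r_chain p J c)"
    have t: "?t \<in> chains p (subtopology (Q J) {q J base})"
      by (rule q_faces[OF e_minus_r_chain[OF cc J] J False])
    have "lin_chain_map p (q J) (e p J c) = bd (Suc p) d + ?t"
      using q_r_chain[OF cc J False] d(2) by (simp add: lin_chain_map_simps)
    with t have "\<exists>d'\<in>chains (Suc p) (subtopology Y {x. r J x = x}).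
        e p J c - bd (Suc p) d' \<in> small_chains p (subtopology Y {x. r J x = x}) ((\<lambda>j. {x. r (J - {j}) x = x}) ` J)"
      by (intro collapse_injective[OF ec _ d(1)]) (simp_all add: bdec)
    then obtain d' where d': "d' \<in> chains (Suc p) (subtopology Y (piece J))"
      "e p J c - bd (Suc p) d' \<in> small_chains p (subtopology Y (piece J)) (faces J)"
      unfolding piece_def[symmetric] faces_def[symmetric] by (rule bexE)
    have d'Y: "d' \<in> chains (Suc p) Y"
      using d'(1) small_chains_chain[of d' "Suc p" Y "{piece J}"] by (simp only: small_chains_singleton)
    (* Applying e removes the remainder in the faces. *)
    have "0 = e p J (e p J c - bd (Suc p) d')"
      by (rule e_faces[OF small_chains_from_subtopology[OF d'(2)] J, symmetric])
    also have "\<dots> = e p J c - bd (Suc p) (e (Suc p) J d')"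
      using bd_e[OF d'Y J] by (simp add: lin_map_diff[OF lin_map_e[OF J]] e_e[OF J])
    finally have "e p J c = bd (Suc p) (e (Suc p) J d')"
      by simp
    then show ?thesis
      unfolding boundaries_eq by (rule image_eqI) (rule e_chains[OF d'Y J])
  qed
  then have "(\<Sum>J\<in>Pow V. e p J c) \<in> boundaries p Y"
    by (intro boundaries_sum) auto
  moreover have "r_chain p V c = c"
    unfolding r_chain_def by (rule lin_chain_map_id[OF cc r_V])
  ultimately show ?thesis
    using r_chain_eq_sum[of V p c] by simp
qed

text \<open>
  The given cycles lift to chains with boundary in the faces. Their parts are cycles, and the projection
  to the quotient for \<open>M\<close> does not see the parts for other sets.
\<close>

theorem homology_splitting_surjective:
  fixes D :: "'v set \<Rightarrow> ('b, 'k::comm_ring_1) lin_chain"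
  assumes D: "\<And>J. \<lbrakk>J \<subseteq> V; J \<noteq> {}\<rbrakk> \<Longrightarrow> D J \<in> reduced_cycles p (Q J)"
  obtains c where "c \<in> reduced_cycles p Y"
    "\<And>J. \<lbrakk>J \<subseteq> V; J \<noteq> {}\<rbrakk> \<Longrightarrow> lin_chain_map p (q J) c - D J \<in> boundaries p (Q J)"
proof -
  (* A lift of D J, up to boundaries and chains at the base point, relative to the faces. *)
  define good where "good J c \<longleftrightarrow> c \<in> small_chains p Y {piece J} \<and> bd p c \<in> small_chains (p - Suc 0) Y (faces J)
      \<and> (\<exists>d\<in>chains (Suc p) (Q J). lin_chain_map p (q J) c - D J - bd (Suc p) d \<in> chains p (subtopology (Q J) {q J base}))"
    for J c
  have "\<exists>c. good J c" if J: "J \<subseteq> V" "J \<noteq> {}" for J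
  proof -
    interpret collapse "subtopology Y {x. r J x = x}" "Q J" "q J" J "\<lambda>j. {x. r (J - {j}) x = x}"
        "\<lambda>j. {x \<in> topspace Y. r J x = x} \<inter> N j" H "q J base"
      by (rule collapse[OF J])
    have "bd p (D J) \<in> chains (p - Suc 0) (subtopology (Q J) {q J base})"
      using reduced_cycles_bd[OF D[OF J]] by simp
    from collapse_surjective[OF reduced_cycles_chains[OF D[OF J]] this]
    obtain c where c: "c \<in> chains p (subtopology Y (piece J))"
      "bd p c \<in> small_chains (p - Suc 0) (subtopology Y (piece J)) (faces J) \<and>
       (\<exists>d\<in>chains (Suc p) (Q J). lin_chain_map p (q J) c - D J - bd (Suc p) d \<in> chains p (subtopology (Q J) {q J base}))"
      unfolding piece_def[symmetric] faces_def[symmetric] by (rule bexE)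
    have "good J c"
      unfolding good_def small_chains_singleton
      using c(1) small_chains_from_subtopology[OF c(2)[THEN conjunct1]] c(2)[THEN conjunct2] by (intro conjI)
    then show ?thesis
      by (rule exI)
  qed
  then obtain C where C: "\<And>J. \<lbrakk>J \<subseteq> V; J \<noteq> {}\<rbrakk> \<Longrightarrow> good J (C J)"
    by metis
  have C1: "C J \<in> small_chains p Y {piece J}" if "J \<subseteq> V" "J \<noteq> {}" for J
    using C[OF that] by (simp add: good_def)
  have C1': "C J \<in> chains p Y" if "J \<subseteq> V" "J \<noteq> {}" for J
    by (rule small_chains_chain[OF C1[OF that]])
  have C2: "bd p (C J) \<in> small_chains (p - Suc 0) Y (faces J)" if "J \<subseteq> V" "J \<noteq> {}" for J
    using C[OF that] by (simp add: good_def)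
  define \<J> where "\<J> = Pow V - {{}}"
  have fin: "finite \<J>"
    using finite_V by (simp add: \<J>_def)
  define c where "c = (\<Sum>J\<in>\<J>. e p J (C J))"
  have cc: "c \<in> chains p Y"
    unfolding c_def by (intro chains_sum e_chains C1') (auto simp: \<J>_def)
  have "bd p (e p J (C J)) = 0" if "J \<in> \<J>" for J
  proof -
    have J: "J \<subseteq> V" "J \<noteq> {}"
      using that by (auto simp: \<J>_def)
    show ?thesis
      unfolding bd_e[OF C1'[OF J] J(1)] by (rule e_faces[OF C2[OF J] J(1)])
  qed
  then have "bd p c = 0"
    by (simp add: c_def bd_simps)
  (* The augmentation is the retraction for the empty set, which kills the parts for all other sets. *)
  moreover have "lin_chain_map 0 (\<lambda>_. base) c = 0" if "p = 0"
  proof -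
    have "lin_chain_map 0 (\<lambda>_. base) c = r_chain 0 {} c"
      unfolding r_chain_def using cc that by (intro lin_chain_map_cong[of c 0 Y]) (auto simp: r_empty)
    also have "\<dots> = (\<Sum>J\<in>\<J>. r_chain 0 {} (e p J (C J)))"
      by (simp add: c_def r_chain_def lin_chain_map_simps)
    also have "\<dots> = 0"
      using that by (intro sum.neutral) (auto simp: \<J>_def r_chain_e)
    finally show ?thesis .
  qed
  ultimately have c: "c \<in> reduced_cycles p Y"
    unfolding reduced_cycles_iff[where z = base] using cc by blast
  have "lin_chain_map p (q M) c - D M \<in> boundaries p (Q M)" if M: "M \<subseteq> V" "M \<noteq> {}" for M
  proof -
    have M_in: "M \<in> \<J>"
      using M by (simp add: \<J>_def)
    obtain d where d: "d \<in> chains (Suc p) (Q M)"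
      "lin_chain_map p (q M) (C M) - D M - bd (Suc p) d \<in> chains p (subtopology (Q M) {q M base})"
      using C[OF M] unfolding good_def by blast
    (* The projection factors through r M, which maps the part for J to 0 or, if J is a proper subset of M,
       leaves it in a face of M. *)
    have other: "lin_chain_map p (q M) (e p J (C J)) \<in> chains p (subtopology (Q M) {q M base})"
      if J: "J \<in> \<J> - {M}" for J
    proof -
      have J': "J \<subseteq> V" "J \<noteq> {}" "J \<noteq> M"
        using J by (auto simp: \<J>_def)
      have "lin_chain_map p (q M) (e p J (C J)) = lin_chain_map p (q M) (r_chain p M (e p J (C J)))"
        by (rule q_r_chain[OF e_chains[OF C1'[OF J'(1,2)] J'(1)] M, symmetric])
      moreover have "r_chain p M (e p J (C J)) \<in> small_chains p Y (faces M)"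
      proof (cases "J \<subseteq> M")
        case True
        then have "J \<subset> M"
          using J'(3) by blast
        from piece_sub_face[OF this M(1)] have "e p J (C J) \<in> small_chains p Y (faces M)"
          by (intro small_chains_mono[OF e_piece[OF C1'[OF J'(1,2)] J'(1)]]) blast
        with True show ?thesis
          by (simp add: r_chain_e[OF J'(1) M(1)])
      next
        case False
        then show ?thesis
          by (simp add: r_chain_e[OF J'(1) M(1)])
      qed
      ultimately show ?thesis
        using q_faces[OF _ M] by simp
    qed
    have main: "lin_chain_map p (q M) (e p M (C M) - C M) \<in> chains p (subtopology (Q M) {q M base})"
      using q_faces[OF e_minus_r_chain[OF C1'[OF M] M(1)] M] r_chain_fixed[OF C1[OF M] M(1)] by simp
    have "lin_chain_map p (q M) c = lin_chain_map p (q M) (e p M (C M))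
        + (\<Sum>J\<in>\<J> - {M}. lin_chain_map p (q M) (e p J (C J)))"
      using fin M_in by (simp add: c_def lin_chain_map_simps sum.remove)
    then have "lin_chain_map p (q M) c - D M - bd (Suc p) d
        = (lin_chain_map p (q M) (C M) - D M - bd (Suc p) d) + lin_chain_map p (q M) (e p M (C M) - C M)
        + (\<Sum>J\<in>\<J> - {M}. lin_chain_map p (q M) (e p J (C J)))"
      by (simp add: lin_chain_map_simps)
    also have "\<dots> \<in> chains p (subtopology (Q M) {q M base})"
      by (intro chains_add chains_sum other main d(2))
    finally have small: "lin_chain_map p (q M) c - D M - bd (Suc p) d \<in> chains p (subtopology (Q M) {q M base})" .
    have "q M base \<in> topspace (Q M)"
      using proj_cont[OF M] base by (auto simp: continuous_map_def)
    then show ?thesis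
      using reduced_cycles_diff[OF lin_chain_map_reduced_cycles[OF c proj_cont[OF M]] D[OF M]] d(1) small
      by (rule reduced_cycle_boundary_mod_point)
  qed
  with c show thesis
    by (rule that)
qed

end


section \<open>Contracting a neighbourhood of the base point of a CW-complex\<close>

definition radius :: "nat \<Rightarrow> (nat \<Rightarrow> real) \<Rightarrow> real"
  where "radius n v = sqrt (\<Sum>i<n. (v i)\<^sup>2)"

definition dilate :: "real \<Rightarrow> (nat \<Rightarrow> real) \<Rightarrow> nat \<Rightarrow> real"
  where "dilate c v = (\<lambda>i. c * v i)"

abbreviation disk_top :: "nat \<Rightarrow> (nat \<Rightarrow> real) topology"
  where "disk_top n \<equiv> subtopology (Euclidean_space n) (closed_disk n)"

lemma radius_dilate: "radius n (dilate c v) = \<bar>c\<bar> * radius n v"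
  by (simp add: radius_def dilate_def power_mult_distrib sum_distrib_left[symmetric] real_sqrt_mult)

lemma closed_disk_iff: "v \<in> closed_disk n \<longleftrightarrow> v \<in> topspace (Euclidean_space n) \<and> radius n v \<le> 1"
  by (simp add: closed_disk_def radius_def)

lemma open_disk_iff: "v \<in> open_disk n \<longleftrightarrow> v \<in> topspace (Euclidean_space n) \<and> radius n v < 1"
  by (simp add: open_disk_def radius_def)

lemma dilate_in_Euclidean: "v \<in> topspace (Euclidean_space n) \<Longrightarrow> dilate c v \<in> topspace (Euclidean_space n)"
  by (simp add: topspace_Euclidean_space dilate_def)

lemma dilate_one [simp]: "dilate 1 v = v"
  by (simp add: dilate_def)

lemma closed_disk_0: "closed_disk 0 = {\<lambda>_. 0}" "open_disk 0 = {\<lambda>_. 0}"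
  by (auto simp: closed_disk_def open_disk_def topspace_Euclidean_space)

lemma topspace_disk_top [simp]: "topspace (disk_top n) = closed_disk n"
  by (auto simp: closed_disk_def)

lemma disk_top_eq: "disk_top n = subtopology (powertop_real UNIV) (closed_disk n)"
proof -
  have "{x. \<forall>i\<ge>n. x i = 0} \<inter> closed_disk n = closed_disk n"
    by (auto simp: closed_disk_def topspace_Euclidean_space)
  then show ?thesis
    by (simp add: Euclidean_space_def subtopology_subtopology)
qed

lemma continuous_coordinate: "continuous_map (disk_top n) euclideanreal (\<lambda>v. v i)"
  unfolding disk_top_eq by (intro continuous_map_from_subtopology continuous_map_product_projection) simp

lemma continuous_radius: "continuous_map (disk_top n) euclideanreal (radius n)"
  unfolding radius_def[abs_def]
  by (intro continuous_map_sqrt continuous_map_sum continuous_map_real_pow continuous_coordinate) auto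

text \<open>
  The disk is a closed subset of a product of intervals.
\<close>

lemma compact_space_disk: "compact_space (disk_top n)"
proof -
  let ?P = "powertop_real UNIV"
  have "continuous_map ?P euclideanreal (\<lambda>v. \<Sum>i<n. (v i)\<^sup>2)"
    by (intro continuous_map_sum continuous_map_real_pow continuous_map_product_projection) auto
  then have "closedin ?P {v \<in> topspace ?P. (\<Sum>i<n. (v i)\<^sup>2) \<in> {..1}}"
    by (rule closedin_continuous_map_preimage) auto
  moreover have "closedin ?P {v \<in> topspace ?P. v i \<in> {0}}" for i
    by (rule closedin_continuous_map_preimage[of _ euclideanreal]) (auto intro: continuous_map_product_projection)
  then have "closedin ?P (\<Inter>i\<in>{n..}. {v \<in> topspace ?P. v i \<in> {0}})"
    by (intro closedin_Inter) auto
  moreover have "closed_disk n = {v \<in> topspace ?P. (\<Sum>i<n. (v i)\<^sup>2) \<in> {..1}} \<inter> (\<Inter>i\<in>{n..}. {v \<in> topspace ?P. v i \<in> {0}})"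
    by (auto simp: closed_disk_def topspace_Euclidean_space)
  ultimately have closed: "closedin ?P (closed_disk n)"
    by (simp only: closedin_Int)
  have bounded: "closed_disk n \<subseteq> (\<Pi>\<^sub>E i\<in>UNIV. {-1..1})"
  proof
    fix v
    assume v: "v \<in> closed_disk n"
    have "\<bar>v i\<bar> \<le> 1" for i
    proof (cases "i < n")
      case True
      then have "(v i)\<^sup>2 \<le> (\<Sum>i<n. (v i)\<^sup>2)"
        by (intro member_le_sum) auto
      then have "(v i)\<^sup>2 \<le> 1"
        using v by (auto simp: closed_disk_def)
      then show ?thesis
        by (simp add: abs_square_le_1)
    next
      case False
      then show ?thesis
        using v by (simp add: closed_disk_def topspace_Euclidean_space)
    qed
    then show "v \<in> (\<Pi>\<^sub>E i\<in>UNIV. {-1..1})"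
      by (auto simp: abs_le_iff minus_le_iff)
  qed
  have "compactin ?P (\<Pi>\<^sub>E i\<in>UNIV. {-1..1})"
    by (simp add: compactin_PiE)
  from closed_compactin[OF this bounded closed] show ?thesis
    unfolding disk_top_eq by (rule compact_space_subtopology)
qed

lemma continuous_dilate:
  assumes "continuous_map Z euclideanreal c" "continuous_map Z (disk_top n) f"
    and "\<And>z. z \<in> topspace Z \<Longrightarrow> dilate (c z) (f z) \<in> closed_disk n"
  shows "continuous_map Z (disk_top n) (\<lambda>z. dilate (c z) (f z))"
proof -
  have "continuous_map Z euclideanreal (\<lambda>z. f z i)" for i
    using continuous_map_compose[OF assms(2) continuous_coordinate[of n i]] by (simp add: comp_def)
  then have "continuous_map Z (powertop_real UNIV) (\<lambda>z. dilate (c z) (f z))"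
    unfolding continuous_map_componentwise_UNIV dilate_def
    by (intro allI continuous_map_real_mult assms(1))
  then show ?thesis
    unfolding disk_top_eq using assms(3) by (auto simp: continuous_map_in_subtopology)
qed

locale based_cw =
  fixes X :: "'a topology" and C :: "'a cell set" and pt :: 'a and e0 :: "'a cell"
  assumes cw: "cw_structure X C"
    and e0: "e0 \<in> C" "fst e0 = 0" "open_cell e0 = {pt}"
begin

lemma Hausdorff: "Hausdorff_space X"
  using cw by (simp add: cw_structure_def)

lemma cell_continuous: "(n, \<Phi>) \<in> C \<Longrightarrow> continuous_map (disk_top n) X \<Phi>"
  using cw by (auto simp: cw_structure_def)

lemma cell_inj: "(n, \<Phi>) \<in> C \<Longrightarrow> inj_on \<Phi> (open_disk n)"
proof -
  assume "(n, \<Phi>) \<in> C"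
  then have "embedding_map (subtopology (Euclidean_space n) (open_disk n)) X \<Phi>"
    using cw by (auto simp: cw_structure_def)
  moreover have "topspace (subtopology (Euclidean_space n) (open_disk n)) = open_disk n"
    by (auto simp: open_disk_def)
  ultimately show ?thesis
    by (metis embedding_map_def homeomorphic_map_def)
qed

lemma cells_cover: "topspace X = (\<Union>e\<in>C. open_cell e)"
  using cw by (simp add: cw_structure_def)

lemma cells_disjoint:
  assumes "e \<in> C" "e' \<in> C" "x \<in> open_cell e" "x \<in> open_cell e'"
  shows "e = e'"
proof (rule ccontr)
  assume "e \<noteq> e'"
  have "pairwise (\<lambda>e e'. disjnt (open_cell e) (open_cell e')) C"
    using cw by (simp add: cw_structure_def)
  from pairwiseD[OF this assms(1,2) \<open>e \<noteq> e'\<close>]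
  have "disjnt (open_cell e) (open_cell e')" .
  then show False
    using assms(3,4) by (simp only: disjnt_iff) blast
qed

lemma frontier_lower:
  "e \<in> C \<Longrightarrow> \<exists>F\<subseteq>C. finite F \<and> (\<forall>e'\<in>F. fst e' < fst e) \<and> cell_frontier e \<subseteq> (\<Union>e'\<in>F. open_cell e')"
  using cw by (simp add: cw_structure_def)

lemma weak_topology: "\<lbrakk>S \<subseteq> topspace X; \<And>e. e \<in> C \<Longrightarrow> closedin X (S \<inter> closed_cell e)\<rbrakk> \<Longrightarrow> closedin X S"
  using cw by (simp add: cw_structure_def)

lemma open_disk_sub: "open_disk n \<subseteq> closed_disk n"
  by (auto simp: open_disk_def closed_disk_def)

lemma closed_cell_eq: "closed_cell e = open_cell e \<union> cell_frontier e"
  using open_disk_sub[of "fst e"] by (auto simp: closed_cell_def open_cell_def cell_frontier_def)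

lemma open_cell_sub: "open_cell e \<subseteq> closed_cell e"
  by (simp add: closed_cell_eq)

lemma closedin_closed_cell: "e \<in> C \<Longrightarrow> closedin X (closed_cell e)"
proof -
  assume e: "e \<in> C"
  have "compactin (disk_top (fst e)) (closed_disk (fst e))"
    using compact_space_disk[of "fst e"] unfolding compact_space_def topspace_disk_top .
  moreover have "continuous_map (disk_top (fst e)) X (snd e)"
    using cell_continuous[of "fst e" "snd e"] e by simp
  ultimately have "compactin X (snd e ` closed_disk (fst e))"
    by (rule image_compactin)
  from compactin_imp_closedin[OF Hausdorff this] show ?thesis
    by (simp only: closed_cell_def)
qed

lemma closed_cell_sub: "e \<in> C \<Longrightarrow> closed_cell e \<subseteq> topspace X"
  using closedin_closed_cell closedin_subset by blast

text \<open>Only the cells that meet \<open>S\<close> have to be tested: on a cell that misses \<open>S\<close> the closure finiteness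
  reduces the condition to cells of smaller dimension.\<close>

lemma closedin_cellwise:
  assumes S: "S \<subseteq> topspace X"
    and cells: "\<And>e. e \<in> C \<Longrightarrow> closedin X (S \<inter> closed_cell e) \<or> S \<inter> open_cell e = {}"
  shows "closedin X S"
proof (rule weak_topology[OF S])
  fix e
  assume "e \<in> C"
  then show "closedin X (S \<inter> closed_cell e)"
  proof (induction "fst e" arbitrary: e rule: less_induct)
    case less
    show ?case
    proof (cases "S \<inter> open_cell e = {}")
      case True
      obtain F where F: "F \<subseteq> C" "finite F" "\<forall>e'\<in>F. fst e' < fst e" "cell_frontier e \<subseteq> (\<Union>e'\<in>F. open_cell e')"
        using frontier_lower[OF less.prems] by blast
      have "S \<inter> closed_cell e = closed_cell e \<inter> (\<Union>e'\<in>F. S \<inter> closed_cell e')"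
      proof (intro equalityI subsetI)
        fix x
        assume x: "x \<in> S \<inter> closed_cell e"
        then have "x \<in> cell_frontier e"
          using True by (auto simp: closed_cell_eq)
        then have "x \<in> (\<Union>e'\<in>F. open_cell e')"
          by (rule subsetD[OF F(4)])
        then obtain e' where e': "e' \<in> F" "x \<in> open_cell e'"
          by (rule UN_E)
        have "x \<in> closed_cell e'"
          by (rule subsetD[OF open_cell_sub e'(2)])
        with x e'(1) show "x \<in> closed_cell e \<inter> (\<Union>e'\<in>F. S \<inter> closed_cell e')"
          by (intro IntI UN_I[of e']) simp_all
      next
        fix x
        assume "x \<in> closed_cell e \<inter> (\<Union>e'\<in>F. S \<inter> closed_cell e')"
        then show "x \<in> S \<inter> closed_cell e"
          by (elim IntE UN_E) simp
      qed
      moreover have "closedin X (\<Union>e'\<in>F. S \<inter> closed_cell e')"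
      proof (rule closedin_Union)
        have "closedin X (S \<inter> closed_cell e')" if "e' \<in> F" for e'
          using less.hyps[of e'] F(1,3) that by (simp only: subsetD)
        then show "closedin X S'" if "S' \<in> (\<lambda>e'. S \<inter> closed_cell e') ` F" for S'
          using that by (elim imageE) simp
      qed (simp add: F(2))
      ultimately show ?thesis
        using closedin_closed_cell[OF less.prems] by (simp add: closedin_Int)
    next
      case False
      then show ?thesis
        using cells[OF less.prems] by blast
    qed
  qed
qed

lemma closedin_subcomplex:
  assumes "cw_subcomplex C A"
  shows "closedin X A"
proof -
  obtain D where D: "D \<subseteq> C" "A = (\<Union>e\<in>D. open_cell e)" "\<forall>e\<in>D. closed_cell e \<subseteq> A"
    using assms by (auto simp: cw_subcomplex_def)
  show ?thesis
  proof (rule closedin_cellwise)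
    show "A \<subseteq> topspace X"
      using D cells_cover by auto
    show "closedin X (A \<inter> closed_cell e) \<or> A \<inter> open_cell e = {}" if e: "e \<in> C" for e
    proof (cases "e \<in> D")
      case True
      then have "A \<inter> closed_cell e = closed_cell e"
        using D(3) by auto
      then show ?thesis
        using closedin_closed_cell[OF e] by simp
    next
      case False
      then have "A \<inter> open_cell e = {}"
        using D(1,2) e cells_disjoint by blast
      then show ?thesis
        by simp
    qed
  qed
qed

text \<open>
  Every point lies in exactly one open cell and has coordinates in its open disk.
\<close>

definition cell_of :: "'a \<Rightarrow> 'a cell"
  where "cell_of x = (THE e. e \<in> C \<and> x \<in> open_cell e)"

definition dim_of :: "'a \<Rightarrow> nat"
  where "dim_of x = fst (cell_of x)"

definition coord_of :: "'a \<Rightarrow> nat \<Rightarrow> real"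
  where "coord_of x = inv_into (open_disk (dim_of x)) (snd (cell_of x)) x"

lemma cell_of_eq: "\<lbrakk>e \<in> C; x \<in> open_cell e\<rbrakk> \<Longrightarrow> cell_of x = e"
  unfolding cell_of_def using cells_disjoint by blast

lemma cell_point:
  assumes e: "(n, \<Phi>) \<in> C" and v: "v \<in> open_disk n"
  shows "cell_of (\<Phi> v) = (n, \<Phi>)" "dim_of (\<Phi> v) = n" "coord_of (\<Phi> v) = v"
proof -
  show *: "cell_of (\<Phi> v) = (n, \<Phi>)"
    using assms by (intro cell_of_eq) (auto simp: open_cell_def)
  then show "dim_of (\<Phi> v) = n"
    by (simp add: dim_of_def)
  with * show "coord_of (\<Phi> v) = v"
    using inv_into_f_f[OF cell_inj[OF e] v] by (simp add: coord_of_def)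
qed

lemma point_cases:
  assumes "x \<in> topspace X"
  obtains n \<Phi> v where "(n, \<Phi>) \<in> C" "v \<in> open_disk n" "x = \<Phi> v"
  using assms unfolding cells_cover open_cell_def by force

text \<open>
  A retraction of the cylinder on \<open>X\<close> to the union of the bottom and the interval over the base point,
  built over one cell after the other: a closed cell times the interval is projected radially, from a
  point above the top, to its bottom and its side, and the side is mapped by what is already defined in
  lower dimensions. The centre of the projection lies at height 2 above the origin of the disk, so the ray
  through the point \<open>v\<close> at height \<open>s\<close> meets the bottom at \<open>2 v / (2 - s)\<close> if this lies in the disk, and
  otherwise the side, at height \<open>2 - (2 - s) / |v|\<close>. The second component of the value is the
  height, and the first argument bounds the dimension of the cells that are passed on the way down.
\<close>

primrec retr :: "nat \<Rightarrow> 'a \<Rightarrow> real \<Rightarrow> 'a \<times> real" where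
  "retr 0 x s = (x, if x = pt then s else 0)"
| "retr (Suc k) x s =
    (let n = dim_of x; \<Phi> = snd (cell_of x); v = coord_of x; a = radius n v in
     if n = 0 then (x, if x = pt then s else 0)
     else if 2 * a \<le> 2 - s then (\<Phi> (dilate (2 / (2 - s)) v), 0)
     else retr k (\<Phi> (dilate (1 / a) v)) (2 - (2 - s) / a))"

definition retraction :: "'a \<Rightarrow> real \<Rightarrow> 'a \<times> real"
  where "retraction x = retr (dim_of x) x"

lemma side_parameters:
  assumes "s \<in> {0..1}" "v \<in> closed_disk n" "\<not> 2 * radius n v \<le> 2 - s"
  shows "2 - (2 - s) / radius n v \<in> {0..1}" "radius n (dilate (1 / radius n v) v) = 1"
    "dilate (1 / radius n v) v \<in> closed_disk n - open_disk n"
proof -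
  let ?a = "radius n v"
  have a: "?a \<le> 1" "1 / 2 < ?a" "2 - s < 2 * ?a"
    using assms by (auto simp: closed_disk_iff)
  have "(2 - s) / ?a \<ge> 2 - s"
    using a assms(1) by (simp add: le_divide_eq mult_left_le)
  moreover have "(2 - s) / ?a \<le> 2"
    using a by (simp add: divide_le_eq)
  ultimately show "2 - (2 - s) / ?a \<in> {0..1}"
    using assms(1) by auto
  show 1: "radius n (dilate (1 / ?a) v) = 1"
    using a by (simp add: radius_dilate)
  then show "dilate (1 / ?a) v \<in> closed_disk n - open_disk n"
    using assms(2) dilate_in_Euclidean by (auto simp: closed_disk_iff open_disk_iff)
qed

lemma inner_parameters:
  assumes "s \<in> {0..1}" "v \<in> closed_disk n" "2 * radius n v \<le> 2 - s"
  shows "dilate (2 / (2 - s)) v \<in> closed_disk n"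
  using assms dilate_in_Euclidean by (auto simp: closed_disk_iff radius_dilate divide_le_eq)

lemma dim_of_frontier:
  assumes "(n, \<Phi>) \<in> C" "v \<in> closed_disk n - open_disk n"
  shows "dim_of (\<Phi> v) < n" "\<Phi> v \<in> topspace X"
proof -
  have "\<Phi> v \<in> cell_frontier (n, \<Phi>)"
    using assms(2) by (auto simp: cell_frontier_def)
  then obtain e' where e': "e' \<in> C" "fst e' < n" "\<Phi> v \<in> open_cell e'"
    using frontier_lower[OF assms(1)] by fastforce
  then show "dim_of (\<Phi> v) < n" "\<Phi> v \<in> topspace X"
    using cell_of_eq[OF e'(1,3)] cells_cover by (auto simp: dim_of_def)
qed

lemma retr_stable:
  assumes "x \<in> topspace X" "s \<in> {0..1}" "dim_of x \<le> k"
  shows "retr k x s = retraction x s"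
  using assms
proof (induction k arbitrary: x s rule: less_induct)
  case (less k)
  show ?case
  proof (cases "dim_of x")
    case 0
    then show ?thesis
      by (cases k) (simp_all add: retraction_def)
  next
    case (Suc m)
    then obtain k' where k': "k = Suc k'" "m \<le> k'"
      using less.prems by (cases k) auto
    obtain n \<Phi> v where x: "(n, \<Phi>) \<in> C" "v \<in> open_disk n" "x = \<Phi> v"
      using less.prems(1) by (rule point_cases)
    note pt = cell_point[OF x(1,2), folded x(3)]
    have n: "n = Suc m"
      using pt(2) Suc by simp
    have v: "v \<in> closed_disk n"
      using x(2) open_disk_sub by blast
    show ?thesis
    proof (cases "2 * radius n v \<le> 2 - s")
      case True
      then show ?thesis
        using pt n by (simp add: retraction_def k'(1))
    next
      case False
      let ?y = "\<Phi> (dilate (1 / radius n v) v)" and ?s = "2 - (2 - s) / radius n v"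
      note y = side_parameters[OF less.prems(2) v False]
      have "dim_of ?y < n" "?y \<in> topspace X"
        using dim_of_frontier[OF x(1) y(3)] by auto
      then have "retr k' ?y ?s = retraction ?y ?s" "retr m ?y ?s = retraction ?y ?s"
        using less.IH[of k' ?y ?s] less.IH[of m ?y ?s] k' Suc pt(2) y(1) by auto
      then show ?thesis
        using pt n False by (simp add: retraction_def k'(1) Let_def)
    qed
  qed
qed

lemma retraction_0:
  assumes "x \<in> topspace X"
  shows "retraction x 0 = (x, 0)"
proof (cases "dim_of x")
  case (Suc m)
  obtain n \<Phi> v where x: "(n, \<Phi>) \<in> C" "v \<in> open_disk n" "x = \<Phi> v"
    using assms by (rule point_cases)
  note pt = cell_point[OF x(1,2), folded x(3)]
  have "n = Suc m"
    using pt(2) Suc by simp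
  then show ?thesis
    using pt x by (simp add: retraction_def open_disk_iff)
qed (simp add: retraction_def)

lemma retraction_dim_0: "dim_of x = 0 \<Longrightarrow> retraction x s = (x, if x = pt then s else 0)"
  by (simp add: retraction_def)

text \<open>
  The defining formula extends from the open to the closed disk: on the sphere the projection does nothing.
\<close>

lemma retraction_cell:
  assumes e: "(n, \<Phi>) \<in> C" and n: "n \<noteq> 0" and v: "v \<in> closed_disk n" and s: "s \<in> {0..1}"
  shows "retraction (\<Phi> v) s = (if 2 * radius n v \<le> 2 - s then (\<Phi> (dilate (2 / (2 - s)) v), 0)
    else retraction (\<Phi> (dilate (1 / radius n v) v)) (2 - (2 - s) / radius n v))"
proof (cases "v \<in> open_disk n")
  case True
  note pt = cell_point[OF e True]
  obtain m where m: "n = Suc m"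
    using n by (cases n) auto
  show ?thesis
  proof (cases "2 * radius n v \<le> 2 - s")
    case True
    then show ?thesis
      using pt m by (simp add: retraction_def)
  next
    case False
    note y = side_parameters[OF s v False]
    have "retr m (\<Phi> (dilate (1 / radius n v) v)) (2 - (2 - s) / radius n v)
        = retraction (\<Phi> (dilate (1 / radius n v) v)) (2 - (2 - s) / radius n v)"
      using dim_of_frontier[OF e y(3)] y(1) m by (intro retr_stable) auto
    then show ?thesis
      using pt m False by (simp add: retraction_def Let_def)
  qed
next
  case False
  then have r: "radius n v = 1"
    using v by (auto simp: closed_disk_iff open_disk_iff)
  have "\<Phi> v \<in> topspace X"
    using dim_of_frontier(2)[OF e] v False by blast
  then show ?thesis
    using r s retraction_0 by (cases "s = 0") auto
qed

lemma retraction_base: "retraction pt s = (pt, s)"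
proof -
  have "cell_of pt = e0"
    using e0 by (intro cell_of_eq) auto
  then show ?thesis
    using e0 by (simp add: dim_of_def retraction_def)
qed

text \<open>
  The values lie in the union of the bottom and the interval over the base point.
\<close>

lemma retraction_height:
  assumes "x \<in> topspace X" "s \<in> {0..1}" "snd (retraction x s) \<noteq> 0"
  shows "fst (retraction x s) = pt"
  using assms
proof (induction "dim_of x" arbitrary: x s rule: less_induct)
  case less
  obtain n \<Phi> v where x: "(n, \<Phi>) \<in> C" "v \<in> open_disk n" "x = \<Phi> v"
    using less.prems(1) by (rule point_cases)
  have v: "v \<in> closed_disk n" and n: "dim_of x = n"
    using x open_disk_sub cell_point[OF x(1,2)] by auto
  show ?case
  proof (cases "n = 0")
    case True
    then show ?thesis
      using less.prems(3) n by (auto simp: retraction_dim_0 split: if_splits)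
  next
    case False
    note eq = retraction_cell[OF x(1) False v less.prems(2), folded x(3)]
    have side: "\<not> 2 * radius n v \<le> 2 - s"
      using less.prems(3) eq by auto
    note y = side_parameters[OF less.prems(2) v side]
    show ?thesis
      using less.hyps[OF _ _ y(1)] dim_of_frontier[OF x(1) y(3)] n less.prems(3) side eq by simp
  qed
qed

text \<open>
  Neither the projection in a cell nor the passage to the boundary of the cell leaves a subcomplex.
\<close>

lemma retraction_subcomplex:
  assumes "cw_subcomplex C A" and "x \<in> A" "s \<in> {0..1}"
  shows "fst (retraction x s) \<in> A"
  using assms(2,3)
proof (induction "dim_of x" arbitrary: x s rule: less_induct)
  case less
  obtain D where D: "D \<subseteq> C" "A = (\<Union>e\<in>D. open_cell e)" "\<forall>e\<in>D. closed_cell e \<subseteq> A"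
    using assms(1) by (auto simp: cw_subcomplex_def)
  obtain n \<Phi> where e: "(n, \<Phi>) \<in> D" "x \<in> open_cell (n, \<Phi>)"
    using less.prems(1) D(2) by auto
  then obtain v where v: "v \<in> open_disk n" "x = \<Phi> v"
    by (auto simp: open_cell_def)
  have eC: "(n, \<Phi>) \<in> C"
    using e D(1) by blast
  have v': "v \<in> closed_disk n"
    by (rule subsetD[OF open_disk_sub v(1)])
  have cell: "\<Phi> u \<in> A" if "u \<in> closed_disk n" for u
    using D(3) e(1) that by (force simp: closed_cell_def)
  have n: "dim_of x = n"
    using cell_point[OF eC v(1)] v(2) by simp
  show ?case
  proof (cases "n = 0")
    case True
    then show ?thesis
      using n less.prems(1) by (simp add: retraction_dim_0)
  next
    case False
    note eq = retraction_cell[OF eC False v' less.prems(2), folded v(2)]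
    show ?thesis
    proof (cases "2 * radius n v \<le> 2 - s")
      case True
      then show ?thesis
        using eq cell[OF inner_parameters[OF less.prems(2) v' True]] by simp
    next
      case side: False
      note y = side_parameters[OF less.prems(2) v' side]
      show ?thesis
        using less.hyps[OF _ _ y(1)] dim_of_frontier[OF eC y(3)] cell n y(3) side eq by simp
    qed
  qed
qed

abbreviation unit_interval :: "real topology"
  where "unit_interval \<equiv> top_of_set {0..1}"

definition retraction_map :: "real \<times> 'a \<Rightarrow> 'a \<times> real"
  where "retraction_map = (\<lambda>(s, x). retraction x s)"

text \<open>
  A finite union of closed cells is a quotient of the sum of the disks, and taking the product with the
  interval preserves this because everything is compact.
\<close>

lemma continuous_on_closed_cells:
  assumes F: "finite F" "F \<subseteq> C"
    and cont: "\<And>n \<Phi>. (n, \<Phi>) \<in> F \<Longrightarrow>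
      continuous_map (prod_topology unit_interval (disk_top n)) Z (\<lambda>(s, v). f (s, \<Phi> v))"
  shows "continuous_map (prod_topology unit_interval (subtopology X (\<Union>e\<in>F. closed_cell e))) Z f"
proof -
  let ?X = "subtopology X (\<Union>e\<in>F. closed_cell e)"
  let ?P = "prod_topology unit_interval ?X"
  have one: "continuous_map (subtopology ?P (UNIV \<times> closed_cell e)) Z f" if e: "e \<in> F" for e
  proof -
    obtain n \<Phi> where e_eq: "e = (n, \<Phi>)"
      by (cases e)
    have sub: "subtopology ?P (UNIV \<times> closed_cell e) = prod_topology unit_interval (subtopology X (closed_cell e))"
    proof -
      have "(\<Union>e\<in>F. closed_cell e) \<inter> closed_cell e = closed_cell e"
        using e by auto
      then show ?thesis
        by (metis subtopology_Times subtopology_UNIV subtopology_subtopology)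
    qed
    let ?g = "\<lambda>(s, v). (s, \<Phi> v)"
    have \<Phi>: "continuous_map (disk_top n) X \<Phi>"
      using cell_continuous F e e_eq by auto
    then have \<Phi>': "continuous_map (disk_top n) (subtopology X (closed_cell e)) \<Phi>"
      by (auto simp: continuous_map_in_subtopology closed_cell_def e_eq)
    have g: "continuous_map (prod_topology unit_interval (disk_top n)) (prod_topology unit_interval (subtopology X (closed_cell e))) ?g"
      unfolding case_prod_unfold continuous_map_pairwise comp_def
      using continuous_map_compose[OF continuous_map_snd \<Phi>'] continuous_map_fst by (auto simp: comp_def)
    have "compact_space (prod_topology unit_interval (disk_top n))"
      by (auto simp: compact_space_prod_topology compact_space_disk compact_space_subtopology)
    moreover have "Hausdorff_space (prod_topology unit_interval (subtopology X (closed_cell e)))"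
      using Hausdorff by (auto simp: Hausdorff_space_prod_topology Hausdorff_space_subtopology)
    ultimately have "closed_map (prod_topology unit_interval (disk_top n)) (prod_topology unit_interval (subtopology X (closed_cell e))) ?g"
      using g by (intro continuous_imp_closed_map)
    moreover have "?g ` topspace (prod_topology unit_interval (disk_top n))
        = topspace (prod_topology unit_interval (subtopology X (closed_cell e)))"
    proof -
      have "closed_cell e \<subseteq> topspace X"
        by (rule closed_cell_sub[OF subsetD[OF F(2) e]])
      then have t: "topspace (subtopology X (closed_cell e)) = \<Phi> ` closed_disk n"
        by (simp add: closed_cell_def e_eq inf_absorb2)
      show ?thesis
        unfolding topspace_prod_topology t topspace_disk_top by force
    qed
    ultimately have "quotient_map (prod_topology unit_interval (disk_top n)) (prod_topology unit_interval (subtopology X (closed_cell e))) ?g"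
      using g by (intro continuous_closed_imp_quotient_map)
    moreover have "continuous_map (prod_topology unit_interval (disk_top n)) Z (f \<circ> ?g)"
      using cont[of n \<Phi>] e e_eq by (simp add: comp_def case_prod_unfold)
    ultimately show ?thesis
      unfolding sub by (rule continuous_compose_quotient_map)
  qed
  show ?thesis
  proof (rule pasting_lemma_closed[where I = F and T = "\<lambda>e. topspace ?P \<inter> (UNIV \<times> closed_cell e)" and f = "\<lambda>_. f"])
    show "closedin ?P (topspace ?P \<inter> (UNIV \<times> closed_cell e))" if "e \<in> F" for e
    proof -
      have "closedin ?X (closed_cell e)"
        using closedin_closed_cell[of e] F that by (intro closedin_subset_topspace) auto
      then have "closedin ?P (topspace unit_interval \<times> closed_cell e)"
        by (simp add: closedin_prod_Times_iff)
      moreover have "topspace ?P \<inter> (UNIV \<times> closed_cell e) = topspace unit_interval \<times> closed_cell e"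
        using that F closed_cell_sub[of e] by auto
      ultimately show ?thesis
        by simp
    qed
    show "continuous_map (subtopology ?P (topspace ?P \<inter> (UNIV \<times> closed_cell e))) Z f" if "e \<in> F" for e
      using one[OF that] by (metis subtopology_restrict)
  qed (use F in auto)
qed

text \<open>
  The two cases of the formula are continuous on closed parts of the cylinder over the disk. The case of
  the side uses the lower-dimensional cells that meet the boundary of the cell, of which there are finitely
  many.
\<close>

lemma continuous_retraction_cell:
  "(n, \<Phi>) \<in> C \<Longrightarrow> continuous_map (prod_topology unit_interval (disk_top n)) (prod_topology X euclideanreal)
    (\<lambda>(s, v). retraction (\<Phi> v) s)"
proof (induction n arbitrary: \<Phi> rule: less_induct)
  case (less n)
  let ?P = "prod_topology unit_interval (disk_top n)"
  let ?Z = "prod_topology X euclideanreal"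
  have s: "continuous_map ?P euclideanreal fst"
    using continuous_map_fst continuous_map_into_fulltopology by blast
  have \<Phi>: "continuous_map (disk_top n) X \<Phi>"
    using less.prems by (rule cell_continuous)
  show ?case
  proof (cases "n = 0")
    case True
    let ?x = "\<Phi> (\<lambda>_. 0)"
    have "dim_of ?x = 0"
      using cell_point(2)[OF less.prems, of "\<lambda>_. 0"] True by (simp add: closed_disk_0)
    then have r: "retraction ?x s = (?x, if ?x = pt then s else 0)" for s
      by (rule retraction_dim_0)
    have eq: "(?x, if ?x = pt then fst z else 0) = (\<lambda>(s, v). retraction (\<Phi> v) s) z" if "z \<in> topspace ?P" for z
      using that True by (cases z) (simp add: closed_disk_0 r)
    have "?x \<in> closed_cell (n, \<Phi>)"
      by (simp add: closed_cell_def True closed_disk_0)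
    then have "?x \<in> topspace X"
      by (rule subsetD[OF closed_cell_sub[OF less.prems]])
    then have "continuous_map ?P ?Z (\<lambda>z. (?x, if ?x = pt then fst z else 0))"
      unfolding continuous_map_pairwise comp_def by (auto simp: s)
    then show ?thesis
      by (rule continuous_map_eq) (rule eq)
  next
    case False
    have rad: "continuous_map ?P euclideanreal (\<lambda>z. radius n (snd z))"
      using continuous_map_compose[OF continuous_map_snd continuous_radius] by (simp add: comp_def)
    obtain F where F: "F \<subseteq> C" "finite F" "\<forall>e'\<in>F. fst e' < n" "cell_frontier (n, \<Phi>) \<subseteq> (\<Union>e'\<in>F. open_cell e')"
      using frontier_lower[OF less.prems] by auto
    have side: "continuous_map (prod_topology unit_interval (subtopology X (\<Union>e\<in>F. closed_cell e))) ?Z retraction_map"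
      unfolding retraction_map_def
    proof (rule continuous_on_closed_cells[OF F(2,1)])
      fix n' \<Phi>'
      assume e': "(n', \<Phi>') \<in> F"
      have "n' < n"
        using bspec[OF F(3) e'] by simp
      from less.IH[OF this subsetD[OF F(1) e']]
      show "continuous_map (prod_topology unit_interval (disk_top n')) ?Z (\<lambda>(s, v). (\<lambda>(s, x). retraction x s) (s, \<Phi>' v))"
        by simp
    qed
    let ?in = "subtopology ?P {z \<in> topspace ?P. 2 * radius n (snd z) \<le> 2 - fst z}"
    let ?out = "subtopology ?P {z \<in> topspace ?P. 2 - fst z \<le> 2 * radius n (snd z)}"
    have "continuous_map ?P ?Z (\<lambda>z. if 2 * radius n (snd z) \<le> 2 - fst z
        then (\<Phi> (dilate (2 / (2 - fst z)) (snd z)), 0)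
        else retraction_map (2 - (2 - fst z) / radius n (snd z), \<Phi> (dilate (1 / radius n (snd z)) (snd z))))"
    proof (rule continuous_map_cases_le)
      show "continuous_map ?P euclideanreal (\<lambda>z. 2 * radius n (snd z))"
        by (intro continuous_map_real_mult_left rad)
      show "continuous_map ?P euclideanreal (\<lambda>z. 2 - fst z)"
        by (intro continuous_map_diff s continuous_map_const[THEN iffD2]) auto
      have s_in: "continuous_map ?in euclideanreal fst" and s_out: "continuous_map ?out euclideanreal fst"
        using s by (auto intro: continuous_map_from_subtopology)
      have v_in: "continuous_map ?in (disk_top n) snd" and v_out: "continuous_map ?out (disk_top n) snd"
        using continuous_map_snd by (auto intro: continuous_map_from_subtopology)
      have r_out: "continuous_map ?out euclideanreal (\<lambda>z. radius n (snd z))"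
        using rad by (rule continuous_map_from_subtopology)
      have "continuous_map ?in (disk_top n) (\<lambda>z. dilate (2 / (2 - fst z)) (snd z))"
      proof (rule continuous_dilate[OF _ v_in])
        show "continuous_map ?in euclideanreal (\<lambda>z. 2 / (2 - fst z))"
          by (intro continuous_map_real_divide continuous_map_diff s_in continuous_map_const[THEN iffD2]) auto
        show "dilate (2 / (2 - fst z)) (snd z) \<in> closed_disk n" if "z \<in> topspace ?in" for z
          using that by (intro inner_parameters) auto
      qed
      from continuous_map_compose[OF this \<Phi>]
      show "continuous_map ?in ?Z (\<lambda>z. (\<Phi> (dilate (2 / (2 - fst z)) (snd z)), 0))"
        unfolding continuous_map_pairwise comp_def by simp
      have r_pos: "radius n (snd z) \<noteq> 0" if "z \<in> topspace ?out" for z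
        using that by auto
      have u: "dilate (1 / radius n (snd z)) (snd z) \<in> closed_disk n - open_disk n"
          "2 - (2 - fst z) / radius n (snd z) \<in> {0..1}" if z: "z \<in> topspace ?out" for z
      proof -
        have z': "fst z \<in> {0..1}" "snd z \<in> closed_disk n" "2 - fst z \<le> 2 * radius n (snd z)"
          using z by auto
        let ?a = "radius n (snd z)"
        have a: "?a \<le> 1" "1 / 2 \<le> ?a" "0 < ?a"
          using z' by (auto simp: closed_disk_iff)
        then have "radius n (dilate (1 / ?a) (snd z)) = 1"
          by (simp add: radius_dilate)
        then show "dilate (1 / ?a) (snd z) \<in> closed_disk n - open_disk n"
          using z'(2) dilate_in_Euclidean by (auto simp: closed_disk_iff open_disk_iff)
        have "(2 - fst z) / ?a \<ge> 2 - fst z"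
          using a z'(1) by (simp add: le_divide_eq mult_left_le)
        moreover have "(2 - fst z) / ?a \<le> 2"
          using a z'(3) by (simp add: divide_le_eq)
        ultimately show "2 - (2 - fst z) / ?a \<in> {0..1}"
          using z'(1) by auto
      qed
      have "continuous_map ?out (disk_top n) (\<lambda>z. dilate (1 / radius n (snd z)) (snd z))"
      proof (rule continuous_dilate[OF _ v_out])
        show "continuous_map ?out euclideanreal (\<lambda>z. 1 / radius n (snd z))"
          using r_pos by (intro continuous_map_real_divide r_out continuous_map_const[THEN iffD2]) auto
      qed (use u(1) in blast)
      from continuous_map_compose[OF this \<Phi>]
      have "continuous_map ?out X (\<lambda>z. \<Phi> (dilate (1 / radius n (snd z)) (snd z)))"
        by (simp add: comp_def)
      moreover have "\<Phi> (dilate (1 / radius n (snd z)) (snd z)) \<in> (\<Union>e\<in>F. closed_cell e)" if "z \<in> topspace ?out" for z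
      proof -
        have "\<Phi> (dilate (1 / radius n (snd z)) (snd z)) \<in> cell_frontier (n, \<Phi>)"
          using u(1)[OF that] by (simp add: cell_frontier_def)
        then have "\<Phi> (dilate (1 / radius n (snd z)) (snd z)) \<in> (\<Union>e'\<in>F. open_cell e')"
          by (rule subsetD[OF F(4)])
        then obtain e' where e': "e' \<in> F" "\<Phi> (dilate (1 / radius n (snd z)) (snd z)) \<in> open_cell e'"
          by (rule UN_E)
        show ?thesis
          unfolding UN_iff by (intro bexI[OF _ e'(1)]) (rule subsetD[OF open_cell_sub e'(2)])
      qed
      ultimately have X_part: "continuous_map ?out (subtopology X (\<Union>e\<in>F. closed_cell e)) (\<lambda>z. \<Phi> (dilate (1 / radius n (snd z)) (snd z)))"
        by (auto simp: continuous_map_in_subtopology)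
      have "continuous_map ?out euclideanreal (\<lambda>z. 2 - (2 - fst z) / radius n (snd z))"
        using r_pos by (intro continuous_map_diff continuous_map_real_divide r_out s_out continuous_map_const[THEN iffD2]) auto
      then have I_part: "continuous_map ?out unit_interval (\<lambda>z. 2 - (2 - fst z) / radius n (snd z))"
        using u(2) by (auto simp: continuous_map_in_subtopology)
      have "continuous_map ?out (prod_topology unit_interval (subtopology X (\<Union>e\<in>F. closed_cell e)))
          (\<lambda>z. (2 - (2 - fst z) / radius n (snd z), \<Phi> (dilate (1 / radius n (snd z)) (snd z))))"
        using X_part I_part unfolding continuous_map_pairwise comp_def by simp
      from continuous_map_compose[OF this side]
      show "continuous_map ?out ?Z (\<lambda>z. retraction_map (2 - (2 - fst z) / radius n (snd z), \<Phi> (dilate (1 / radius n (snd z)) (snd z))))"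
        by (simp add: comp_def)
      fix z
      assume z: "z \<in> topspace ?P" "2 * radius n (snd z) = 2 - fst z"
      then have "z \<in> topspace ?out"
        by auto
      from u(1)[OF this] have "\<Phi> (dilate (1 / radius n (snd z)) (snd z)) \<in> topspace X"
        using dim_of_frontier(2)[OF less.prems] by blast
      moreover have "(2 - fst z) / radius n (snd z) = 2" "2 / (2 - fst z) = 1 / radius n (snd z)"
        using z by (auto simp: divide_simps)
      ultimately show "(\<Phi> (dilate (2 / (2 - fst z)) (snd z)), 0)
          = retraction_map (2 - (2 - fst z) / radius n (snd z), \<Phi> (dilate (1 / radius n (snd z)) (snd z)))"
        by (simp add: retraction_map_def retraction_0)
    qed
    then show ?thesis
      by (rule continuous_map_eq) (use retraction_cell[OF less.prems False] in \<open>auto simp: retraction_map_def\<close>)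
  qed
qed

text \<open>The cylinder on a CW-complex carries the weak topology given by the cylinders on its closed cells,
  because the interval is locally compact.\<close>

lemma continuous_cellwise:
  assumes cont: "\<And>n \<Phi>. (n, \<Phi>) \<in> C \<Longrightarrow>
      continuous_map (prod_topology unit_interval (disk_top n)) Z (\<lambda>(s, v). f (s, \<Phi> v))"
  shows "continuous_map (prod_topology unit_interval X) Z f"
  unfolding continuous_map_def
proof (intro conjI allI impI)
  let ?P = "prod_topology unit_interval X"
  have in_Z: "f (s, \<Phi> v) \<in> topspace Z" if "(n, \<Phi>) \<in> C" "s \<in> {0..1}" "v \<in> closed_disk n" for n \<Phi> v s
    using continuous_map_image_subset_topspace[OF cont[OF that(1)]] that(2,3)
    by (auto simp: image_subset_iff closed_disk_iff)
  show "f \<in> topspace ?P \<rightarrow> topspace Z"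
  proof (rule funcsetI, clarsimp)
    fix s :: real and x
    assume s: "0 \<le> s" "s \<le> 1" and x: "x \<in> topspace X"
    from x obtain n \<Phi> v where "(n, \<Phi>) \<in> C" "v \<in> open_disk n" "x = \<Phi> v"
      by (rule point_cases)
    then show "f (s, x) \<in> topspace Z"
      using in_Z[of n \<Phi> s v] s open_disk_sub by auto
  qed
  fix O'
  assume O': "openin Z O'"
  show "openin ?P {z \<in> topspace ?P. f z \<in> O'}"
    unfolding openin_prod_topology_alt
  proof (intro allI impI)
    fix s x
    assume "(s, x) \<in> {z \<in> topspace ?P. f z \<in> O'}"
    then have s: "s \<in> {0..1}" and x: "x \<in> topspace X" and fO: "f (s, x) \<in> O'"
      by auto
    obtain n \<Phi> v where e: "(n, \<Phi>) \<in> C" "v \<in> open_disk n" "x = \<Phi> v"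
      using x by (rule point_cases)
    have "v \<in> topspace (disk_top n)"
      unfolding topspace_disk_top by (rule subsetD[OF open_disk_sub e(2)])
    then have "continuous_map unit_interval (prod_topology unit_interval (disk_top n)) (\<lambda>t. (t, v))"
      by (simp add: continuous_map_pairwise comp_def)
    from continuous_map_compose[OF this cont[OF e(1)]]
    have "continuous_map unit_interval Z (\<lambda>t. f (t, x))"
      by (simp add: comp_def e(3))
    then have "openin unit_interval {t \<in> {0..1}. f (t, x) \<in> O'}"
      using openin_continuous_map_preimage[OF _ O'] by fastforce
    then obtain d where d: "0 < d" "\<And>t. \<lbrakk>t \<in> {0..1}; dist t s < d\<rbrakk> \<Longrightarrow> f (t, x) \<in> O'"
      using s fO unfolding openin_euclidean_subtopology_iff by blast
    (* A compact interval around s on which the values at x stay in O'. The points y for which this fails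
       form a closed set S: on each cell it is the image of a compact set. *)
    define N where "N = {0..1} \<inter> cball s (d / 2)"
    have N: "compact N" "N \<subseteq> {0..1}"
      by (auto simp: N_def)
    define S where "S = {y \<in> topspace X. \<exists>t\<in>N. f (t, y) \<notin> O'}"
    have "closedin X S"
    proof (rule weak_topology)
      fix e'
      assume e': "e' \<in> C"
      obtain n' \<Phi>' where e'_eq: "e' = (n', \<Phi>')"
        by (cases e')
      let ?D = "prod_topology unit_interval (disk_top n')"
      let ?K = "{z \<in> topspace ?D. (\<lambda>(s, v). f (s, \<Phi>' v)) z \<in> topspace Z - O'} \<inter> (N \<times> closed_disk n')"
      have "closedin ?D {z \<in> topspace ?D. (\<lambda>(s, v). f (s, \<Phi>' v)) z \<in> topspace Z - O'}"
        using cont[of n' \<Phi>'] e' e'_eq O' by (intro closedin_continuous_map_preimage) auto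
      moreover have "closedin ?D (N \<times> closed_disk n')"
      proof -
        have "closedin unit_interval N"
          using N by (metis closed_subset compact_imp_closed)
        moreover have "closedin (disk_top n') (closed_disk n')"
          using closedin_topspace[of "disk_top n'"] unfolding topspace_disk_top .
        ultimately show ?thesis
          unfolding closedin_prod_Times_iff by (intro disjI2 conjI)
      qed
      moreover have "compact_space ?D"
        by (auto simp: compact_space_prod_topology compact_space_disk compact_space_subtopology)
      ultimately have "compactin ?D ?K"
        by (intro closedin_compact_space closedin_Int)
      then have "compactin (disk_top n') (snd ` ?K)"
        using continuous_map_snd by (rule image_compactin)
      then have "compactin X (\<Phi>' ` (snd ` ?K))"
        by (rule image_compactin[OF _ cell_continuous[OF e'[unfolded e'_eq]]])
      moreover have "\<Phi>' ` (snd ` ?K) = S \<inter> closed_cell e'"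
      proof
        show "\<Phi>' ` (snd ` ?K) \<subseteq> S \<inter> closed_cell e'"
          using closed_cell_sub[OF e'] by (fastforce simp: S_def closed_cell_def e'_eq)
        show "S \<inter> closed_cell e' \<subseteq> \<Phi>' ` (snd ` ?K)"
        proof
          fix y
          assume "y \<in> S \<inter> closed_cell e'"
          then obtain t u where tu: "t \<in> N" "f (t, y) \<notin> O'" "u \<in> closed_disk n'" "y = \<Phi>' u"
            by (auto simp: S_def closed_cell_def e'_eq)
          then have "(t, u) \<in> ?K"
            using in_Z[of n' \<Phi>' t u] e' e'_eq N(2) by (auto simp: closed_disk_iff)
          then show "y \<in> \<Phi>' ` (snd ` ?K)"
            using tu(4) by force
        qed
      qed
      ultimately show "closedin X (S \<inter> closed_cell e')"
        using compactin_imp_closedin[OF Hausdorff] by simp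
    qed (auto simp: S_def)
    then have "openin X (topspace X - S)"
      by blast
    moreover have "openin unit_interval ({0..1} \<inter> ball s (d / 2))"
      by (simp add: openin_open_Int)
    moreover have "s \<in> {0..1} \<inter> ball s (d / 2)"
      using s d(1) by simp
    moreover have "x \<in> topspace X - S"
      using x d by (auto simp: S_def N_def dist_commute)
    moreover have "({0..1} \<inter> ball s (d / 2)) \<times> (topspace X - S) \<subseteq> {z \<in> topspace ?P. f z \<in> O'}"
      by (auto simp: S_def N_def less_imp_le)
    ultimately show "\<exists>U V. openin unit_interval U \<and> openin X V \<and> s \<in> U \<and> x \<in> V
        \<and> U \<times> V \<subseteq> {z \<in> topspace ?P. f z \<in> O'}"
      by blast
  qed
qed

lemma continuous_retraction_map:
  "continuous_map (prod_topology unit_interval X) (prod_topology X euclideanreal) retraction_map"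
  by (rule continuous_cellwise) (use continuous_retraction_cell in \<open>simp add: retraction_map_def case_prod_unfold\<close>)

end

text \<open>
  The homotopy is the first component of the retraction. A point that ends at positive height over the base
  point ends, in the first component, at the base point; those points form the neighbourhood.
\<close>

lemma based_cw_pair_contraction:
  assumes "based_cw_pair X A pt"
  obtains H U where "continuous_map (prod_topology (top_of_set {0..1::real}) X) X H"
    and "openin X U" and "pt \<in> U"
    and "\<And>x. x \<in> topspace X \<Longrightarrow> H (0, x) = x" and "\<And>t. H (t, pt) = pt"
    and "\<And>x. x \<in> U \<Longrightarrow> H (1, x) = pt" and "\<And>t x. \<lbrakk>t \<in> {0..1}; x \<in> A\<rbrakk> \<Longrightarrow> H (t, x) \<in> A"
proof -
  obtain C e0 where C: "cw_structure X C" "cw_subcomplex C A" "e0 \<in> C" "fst e0 = 0" "open_cell e0 = {pt}"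
    using assms unfolding based_cw_pair_def by blast
  interpret based_cw X C pt e0
    using C by unfold_locales
  have pt: "pt \<in> topspace X"
    using cells_cover e0 by auto
  let ?U = "{x \<in> topspace X. snd (retraction x 1) \<in> {0<..}}"
  have H: "continuous_map (prod_topology unit_interval X) X (fst \<circ> retraction_map)"
    and w: "continuous_map (prod_topology unit_interval X) euclideanreal (snd \<circ> retraction_map)"
    using continuous_map_compose[OF continuous_retraction_map] continuous_map_fst continuous_map_snd by blast+
  have "continuous_map X (prod_topology unit_interval X) (\<lambda>x. (1, x))"
    by (simp add: continuous_map_pairwise comp_def)
  from continuous_map_compose[OF this w]
  have "continuous_map X euclideanreal (\<lambda>x. snd (retraction x 1))"
    by (simp add: comp_def retraction_map_def)
  then have "openin X ?U"
    by (rule openin_continuous_map_preimage) auto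
  moreover have "pt \<in> ?U"
    using pt by (simp add: retraction_base)
  moreover have "(fst \<circ> retraction_map) (1, x) = pt" if "x \<in> ?U" for x
    using that retraction_height[of x 1] by (simp add: retraction_map_def)
  moreover have "(fst \<circ> retraction_map) (t, x) \<in> A" if "t \<in> {0..1}" "x \<in> A" for t x
    using retraction_subcomplex[OF C(2) that(2,1)] by (simp add: retraction_map_def)
  ultimately show thesis
    using H by (intro that[of "fst \<circ> retraction_map" ?U]) (auto simp: retraction_map_def retraction_0 retraction_base)
qed

lemma based_cw_pair_closed:
  assumes "based_cw_pair X A pt"
  shows "Hausdorff_space X" "closedin X A" "pt \<in> A"
proof -
  obtain C e0 where C: "cw_structure X C" "cw_subcomplex C A" "e0 \<in> C" "fst e0 = 0" "open_cell e0 = {pt}" "pt \<in> A"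
    using assms unfolding based_cw_pair_def by blast
  interpret based_cw X C pt e0
    using C by unfold_locales
  show "Hausdorff_space X" "closedin X A" "pt \<in> A"
    using Hausdorff closedin_subcomplex[OF C(2)] C(6) by auto
qed


section \<open>Modules over a group ring\<close>

text \<open>The axioms are equations, so they pass to homomorphic images.\<close>

lemma module_image:
  assumes M: "module R M" and surj: "f ` carrier M = carrier N"
    and add: "\<And>x y. \<lbrakk>x \<in> carrier M; y \<in> carrier M\<rbrakk> \<Longrightarrow> f (x \<oplus>\<^bsub>M\<^esub> y) = f x \<oplus>\<^bsub>N\<^esub> f y"
    and smult: "\<And>r x. \<lbrakk>r \<in> carrier R; x \<in> carrier M\<rbrakk> \<Longrightarrow> f (r \<odot>\<^bsub>M\<^esub> x) = r \<odot>\<^bsub>N\<^esub> f x"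
    and zero: "f \<zero>\<^bsub>M\<^esub> = \<zero>\<^bsub>N\<^esub>"
  shows "module R N"
proof -
  interpret M: module R M
    by (rule M)
  have in_N: "f x \<in> carrier N" if "x \<in> carrier M" for x
    using surj that by blast
  have lift: "\<exists>x\<in>carrier M. y = f x" if "y \<in> carrier N" for y
    using surj that by blast
  have "abelian_group N"
  proof (rule abelian_groupI)
    fix a b c
    assume "a \<in> carrier N" "b \<in> carrier N" "c \<in> carrier N"
    then obtain x y z where "x \<in> carrier M" "y \<in> carrier M" "z \<in> carrier M" "a = f x" "b = f y" "c = f z"
      using lift by metis
    then show "(a \<oplus>\<^bsub>N\<^esub> b) \<oplus>\<^bsub>N\<^esub> c = a \<oplus>\<^bsub>N\<^esub> (b \<oplus>\<^bsub>N\<^esub> c)"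
      by (simp add: add[symmetric] M.M.a_assoc)
  next
    fix a b
    assume "a \<in> carrier N" "b \<in> carrier N"
    then obtain x y where xy: "x \<in> carrier M" "y \<in> carrier M" "a = f x" "b = f y"
      using lift by metis
    then show "a \<oplus>\<^bsub>N\<^esub> b \<in> carrier N"
      by (simp add: add[symmetric] in_N)
    show "a \<oplus>\<^bsub>N\<^esub> b = b \<oplus>\<^bsub>N\<^esub> a"
      using xy by (simp add: add[symmetric] M.M.a_comm)
  next
    fix a
    assume "a \<in> carrier N"
    then obtain x where x: "x \<in> carrier M" "a = f x"
      using lift by metis
    show "\<zero>\<^bsub>N\<^esub> \<oplus>\<^bsub>N\<^esub> a = a"
      using x by (simp add: add[symmetric] zero[symmetric])
    have "f (\<ominus>\<^bsub>M\<^esub> x) \<oplus>\<^bsub>N\<^esub> a = \<zero>\<^bsub>N\<^esub>"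
      using x by (simp add: add[symmetric] zero[symmetric] M.M.l_neg)
    then show "\<exists>b\<in>carrier N. b \<oplus>\<^bsub>N\<^esub> a = \<zero>\<^bsub>N\<^esub>"
      using x in_N by blast
  next
    show "\<zero>\<^bsub>N\<^esub> \<in> carrier N"
      using in_N[of "\<zero>\<^bsub>M\<^esub>"] zero by simp
  qed
  with M.is_cring show ?thesis
  proof (rule moduleI)
    fix r a
    assume r: "r \<in> carrier R" and "a \<in> carrier N"
    then obtain x where x: "x \<in> carrier M" "a = f x"
      using lift by metis
    show "r \<odot>\<^bsub>N\<^esub> a \<in> carrier N"
      using x r by (simp add: smult[symmetric] in_N)
    fix s
    assume s: "s \<in> carrier R"
    show "(r \<oplus>\<^bsub>R\<^esub> s) \<odot>\<^bsub>N\<^esub> a = r \<odot>\<^bsub>N\<^esub> a \<oplus>\<^bsub>N\<^esub> s \<odot>\<^bsub>N\<^esub> a"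
      using x r s by (simp add: smult[symmetric] add[symmetric] M.smult_l_distr)
    show "(r \<otimes>\<^bsub>R\<^esub> s) \<odot>\<^bsub>N\<^esub> a = r \<odot>\<^bsub>N\<^esub> (s \<odot>\<^bsub>N\<^esub> a)"
      using x r s by (simp add: smult[symmetric] M.smult_assoc1)
  next
    fix r a b
    assume r: "r \<in> carrier R" and "a \<in> carrier N" "b \<in> carrier N"
    then obtain x y where xy: "x \<in> carrier M" "y \<in> carrier M" "a = f x" "b = f y"
      using lift by metis
    then show "r \<odot>\<^bsub>N\<^esub> (a \<oplus>\<^bsub>N\<^esub> b) = r \<odot>\<^bsub>N\<^esub> a \<oplus>\<^bsub>N\<^esub> r \<odot>\<^bsub>N\<^esub> b"
      using r by (simp add: smult[symmetric] add[symmetric] M.smult_r_distr)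
  next
    fix a
    assume "a \<in> carrier N"
    then obtain x where x: "x \<in> carrier M" "a = f x"
      using lift by metis
    then show "\<one>\<^bsub>R\<^esub> \<odot>\<^bsub>N\<^esub> a = a"
      by (simp add: smult[symmetric])
  qed
qed

lemma group_ring_module_image:
  assumes M: "group_ring_module R G M \<rho>" and surj: "f ` carrier M = carrier N"
    and add: "\<And>x y. \<lbrakk>x \<in> carrier M; y \<in> carrier M\<rbrakk> \<Longrightarrow> f (x \<oplus>\<^bsub>M\<^esub> y) = f x \<oplus>\<^bsub>N\<^esub> f y"
    and smult: "\<And>r x. \<lbrakk>r \<in> carrier R; x \<in> carrier M\<rbrakk> \<Longrightarrow> f (r \<odot>\<^bsub>M\<^esub> x) = r \<odot>\<^bsub>N\<^esub> f x"
    and zero: "f \<zero>\<^bsub>M\<^esub> = \<zero>\<^bsub>N\<^esub>"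
    and act: "\<And>g x. \<lbrakk>g \<in> carrier G; x \<in> carrier M\<rbrakk> \<Longrightarrow> f (\<rho> g x) = \<tau> g (f x)"
  shows "group_ring_module R G N \<tau>"
proof -
  interpret M: group_ring_module R G M \<rho>
    by (rule M)
  have in_N: "f x \<in> carrier N" if "x \<in> carrier M" for x
    using surj that by blast
  have lift: "\<exists>x\<in>carrier M. y = f x" if "y \<in> carrier N" for y
    using surj that by blast
  have "module R N"
    by (rule module_image[OF M.module_axioms surj add smult zero])
  moreover have "group_ring_module_axioms R G N \<tau>"
  proof
    fix g a
    assume g: "g \<in> carrier G" and "a \<in> carrier N"
    then obtain x where x: "x \<in> carrier M" "a = f x"
      using lift by metis
    show "\<tau> g a \<in> carrier N"
      using x g by (simp add: act[symmetric] in_N M.act_closed)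
    show "\<tau> g (r \<odot>\<^bsub>N\<^esub> a) = r \<odot>\<^bsub>N\<^esub> \<tau> g a" if "r \<in> carrier R" for r
      using x g that by (simp add: smult[symmetric] act[symmetric] M.act_smult M.act_closed)
    show "\<tau> (g \<otimes>\<^bsub>G\<^esub> h) a = \<tau> g (\<tau> h a)" if "h \<in> carrier G" for h
      using x g that by (simp add: act[symmetric] M.act_mult M.act_closed)
  next
    fix g a b
    assume g: "g \<in> carrier G" and "a \<in> carrier N" "b \<in> carrier N"
    then obtain x y where xy: "x \<in> carrier M" "y \<in> carrier M" "a = f x" "b = f y"
      using lift by metis
    then show "\<tau> g (a \<oplus>\<^bsub>N\<^esub> b) = \<tau> g a \<oplus>\<^bsub>N\<^esub> \<tau> g b"
      using g by (simp add: add[symmetric] act[symmetric] M.act_add M.act_closed)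
  next
    fix a
    assume "a \<in> carrier N"
    then obtain x where x: "x \<in> carrier M" "a = f x"
      using lift by metis
    then show "\<tau> \<one>\<^bsub>G\<^esub> a = a"
      by (simp add: act[symmetric] M.act_one)
  qed
  ultimately show ?thesis
    by (intro group_ring_module.intro M.G.is_group)
qed

text \<open>
  The module axioms of the target follow from the bijection, because they are equations.
\<close>

lemma group_ring_isomorphic_via:
  assumes M: "group_ring_module R G M \<rho>" and bij: "bij_betw f (carrier M) (carrier N)"
    and add: "\<And>x y. \<lbrakk>x \<in> carrier M; y \<in> carrier M\<rbrakk> \<Longrightarrow> f (x \<oplus>\<^bsub>M\<^esub> y) = f x \<oplus>\<^bsub>N\<^esub> f y"
    and smult: "\<And>r x. \<lbrakk>r \<in> carrier R; x \<in> carrier M\<rbrakk> \<Longrightarrow> f (r \<odot>\<^bsub>M\<^esub> x) = r \<odot>\<^bsub>N\<^esub> f x"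
    and zero: "f \<zero>\<^bsub>M\<^esub> = \<zero>\<^bsub>N\<^esub>"
    and act: "\<And>g x. \<lbrakk>g \<in> carrier G; x \<in> carrier M\<rbrakk> \<Longrightarrow> f (\<rho> g x) = \<tau> g (f x)"
  shows "group_ring_isomorphic R G M \<rho> N \<tau>"
proof -
  have "group_ring_module R G N \<tau>"
    by (rule group_ring_module_image[where M = M and N = N and f = f and \<rho> = \<rho> and \<tau> = \<tau>,
          OF M bij_betw_imp_surj_on[OF bij] add smult zero act])
  moreover have "\<forall>x\<in>carrier M. \<forall>y\<in>carrier M. f (x \<oplus>\<^bsub>M\<^esub> y) = f x \<oplus>\<^bsub>N\<^esub> f y"
    using add by simp
  moreover have "\<forall>r\<in>carrier R. \<forall>x\<in>carrier M. f (r \<odot>\<^bsub>M\<^esub> x) = r \<odot>\<^bsub>N\<^esub> f x"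
    using smult by simp
  moreover have "\<forall>g\<in>carrier G. \<forall>x\<in>carrier M. f (\<rho> g x) = \<tau> g (f x)"
    using act by simp
  ultimately show ?thesis
    unfolding group_ring_isomorphic_def using M bij by (intro conjI exI[of _ f])
qed


section \<open>Quotients of submodules of a free module\<close>

definition lin_subspace :: "('x \<Rightarrow>\<^sub>0 'k::comm_ring_1) set \<Rightarrow> bool"
  where "lin_subspace Z \<longleftrightarrow> 0 \<in> Z \<and> (\<forall>a\<in>Z. \<forall>b\<in>Z. a + b \<in> Z) \<and> (\<forall>r. \<forall>a\<in>Z. lin_scale r a \<in> Z)"

definition coset :: "('x \<Rightarrow>\<^sub>0 'k::comm_ring_1) set \<Rightarrow> ('x \<Rightarrow>\<^sub>0 'k) \<Rightarrow> ('x \<Rightarrow>\<^sub>0 'k) set"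
  where "coset B c = {c + b | b. b \<in> B}"

lemma lin_subspace_zero: "lin_subspace Z \<Longrightarrow> 0 \<in> Z"
  by (simp add: lin_subspace_def)

lemma lin_subspace_add: "\<lbrakk>lin_subspace Z; a \<in> Z; b \<in> Z\<rbrakk> \<Longrightarrow> a + b \<in> Z"
  by (simp add: lin_subspace_def)

lemma lin_subspace_scale: "\<lbrakk>lin_subspace Z; a \<in> Z\<rbrakk> \<Longrightarrow> lin_scale r a \<in> Z"
  by (simp add: lin_subspace_def)

lemma lin_subspace_minus: "\<lbrakk>lin_subspace Z; a \<in> Z\<rbrakk> \<Longrightarrow> - a \<in> Z"
  using lin_subspace_scale[of Z a "-1"] by (simp add: lin_scale_minus_one)

lemma lin_subspace_diff: "\<lbrakk>lin_subspace Z; a \<in> Z; b \<in> Z\<rbrakk> \<Longrightarrow> a - b \<in> Z"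
  using lin_subspace_add[of Z a "- b"] lin_subspace_minus[of Z b] by simp

lemma lin_subspace_sum: "\<lbrakk>lin_subspace Z; \<And>i. i \<in> S \<Longrightarrow> f i \<in> Z\<rbrakk> \<Longrightarrow> sum f S \<in> Z"
  by (induction S rule: infinite_finite_induct) (auto intro: lin_subspace_zero lin_subspace_add)

lemma lin_subspace_lin_span: "lin_subspace (lin_span S)"
  by (simp add: lin_subspace_def lin_span.zero lin_span.add lin_span.scale)

lemma lin_subspace_keys: "lin_subspace {c. Poly_Mapping.keys c \<subseteq> S}"
  unfolding lin_subspace_def
proof (intro conjI ballI allI CollectI)
  fix a b :: "'a \<Rightarrow>\<^sub>0 'b" and r
  assume a: "a \<in> {c. Poly_Mapping.keys c \<subseteq> S}"
  show "Poly_Mapping.keys (lin_scale r a) \<subseteq> S"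
    by (rule order_trans[OF keys_lin_scale]) (use a in simp)
  assume b: "b \<in> {c. Poly_Mapping.keys c \<subseteq> S}"
  show "Poly_Mapping.keys (a + b) \<subseteq> S"
    by (rule order_trans[OF keys_add]) (use a b in simp)
qed simp

lemma coset_eq_iff:
  assumes "lin_subspace B"
  shows "coset B a = coset B b \<longleftrightarrow> a - b \<in> B"
proof
  assume "coset B a = coset B b"
  moreover have "a \<in> coset B a"
    using lin_subspace_zero[OF assms] by (force simp: coset_def)
  ultimately show "a - b \<in> B"
    by (auto simp: coset_def)
next
  assume ab: "a - b \<in> B"
  show "coset B a = coset B b"
  proof (intro equalityI subsetI)
    fix x
    assume "x \<in> coset B a"
    then obtain c where c: "x = a + c" "c \<in> B"
      by (auto simp: coset_def)
    then have "x = b + ((a - b) + c)" "(a - b) + c \<in> B"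
      using lin_subspace_add[OF assms ab] by auto
    then show "x \<in> coset B b"
      unfolding coset_def by blast
  next
    fix x
    assume "x \<in> coset B b"
    then obtain c where c: "x = b + c" "c \<in> B"
      by (auto simp: coset_def)
    then have "x = a + (c - (a - b))" "c - (a - b) \<in> B"
      using lin_subspace_diff[OF assms _ ab] by auto
    then show "x \<in> coset B a"
      unfolding coset_def by blast
  qed
qed

lemma carrier_quotient_module: "carrier (quotient_module Z B) = coset B ` Z"
  by (auto simp: quotient_module_def coset_def)

lemma zero_quotient_module: "\<zero>\<^bsub>quotient_module Z B\<^esub> = coset B 0"
  by (auto simp: quotient_module_def coset_def)

lemma add_quotient_module:
  assumes "lin_subspace B"
  shows "coset B a \<oplus>\<^bsub>quotient_module Z B\<^esub> coset B b = coset B (a + b)"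
proof -
  have "\<exists>x y. a + b + c = x + y \<and> (\<exists>d. x = a + d \<and> d \<in> B) \<and> (\<exists>d. y = b + d \<and> d \<in> B)" if "c \<in> B" for c
    using that lin_subspace_zero[OF assms]
    by (intro exI[of _ a] exI[of _ "b + c"] conjI exI[of _ 0] exI[of _ c]) (auto simp: add_ac)
  moreover have "\<exists>c. a + d + (b + d') = a + b + c \<and> c \<in> B" if "d \<in> B" "d' \<in> B" for d d'
    using lin_subspace_add[OF assms that] by (intro exI[of _ "d + d'"]) (auto simp: add_ac)
  ultimately show ?thesis
    by (auto simp: quotient_module_def coset_def)
qed

lemma smult_quotient_module:
  assumes "lin_subspace B"
  shows "r \<odot>\<^bsub>quotient_module Z B\<^esub> coset B a = coset B (lin_scale r a)"
proof -
  have "\<exists>x c'. lin_scale r a + c = lin_scale r x + c' \<and> (\<exists>d. x = a + d \<and> d \<in> B) \<and> c' \<in> B" if "c \<in> B" for c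
    using that lin_subspace_zero[OF assms]
    by (intro exI[of _ a] exI[of _ c] conjI exI[of _ 0]) auto
  moreover have "\<exists>c. lin_scale r (a + d) + d' = lin_scale r a + c \<and> c \<in> B" if "d \<in> B" "d' \<in> B" for d d'
    using lin_subspace_add[OF assms lin_subspace_scale[OF assms that(1)] that(2)]
    by (intro exI[of _ "lin_scale r d + d'"]) (auto simp: lin_scale_add_right add_ac)
  ultimately show ?thesis
    by (auto simp: quotient_module_def coset_def)
qed

lemma quotient_map_induced_coset:
  assumes B: "lin_subspace B" and B': "lin_subspace B'" and F: "lin_map F" "\<And>b. b \<in> B \<Longrightarrow> F b \<in> B'"
  shows "quotient_map_induced B' F (coset B c) = coset B' (F c)"
proof -
  have "\<exists>x b'. F c + d = F x + b' \<and> (\<exists>b. x = c + b \<and> b \<in> B) \<and> b' \<in> B'" if "d \<in> B'" for d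
    using that lin_subspace_zero[OF B]
    by (intro exI[of _ c] exI[of _ d] conjI exI[of _ 0]) auto
  moreover have "\<exists>d. F (c + b) + b' = F c + d \<and> d \<in> B'" if "b \<in> B" "b' \<in> B'" for b b'
    using lin_subspace_add[OF B' F(2)[OF that(1)] that(2)]
    by (intro exI[of _ "F b + b'"]) (auto simp: lin_map_add[OF F(1)] add_ac)
  ultimately show ?thesis
    by (auto simp: quotient_map_induced_def coset_def)
qed

definition subspace_module :: "('x \<Rightarrow>\<^sub>0 'k) set \<Rightarrow> ('k::comm_ring_1, 'x \<Rightarrow>\<^sub>0 'k) module"
  where "subspace_module Z = \<lparr>carrier = Z, monoid.mult = undefined, monoid.one = undefined,
    ring.zero = 0, ring.add = (+), module.smult = lin_scale\<rparr>"

lemma module_subspace_module: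
  assumes "lin_subspace Z"
  shows "module (ring_of_type_algebra :: 'k::comm_ring_1 ring) (subspace_module (Z :: ('x \<Rightarrow>\<^sub>0 'k) set))"
proof (rule moduleI)
  show "cring (ring_of_type_algebra :: 'k ring)"
    by (rule cring_from_type_algebra)
  show "abelian_group (subspace_module Z)"
  proof (rule abelian_groupI)
    show "\<exists>y\<in>carrier (subspace_module Z). y \<oplus>\<^bsub>subspace_module Z\<^esub> x = \<zero>\<^bsub>subspace_module Z\<^esub>"
      if "x \<in> carrier (subspace_module Z)" for x
      using that lin_subspace_minus[OF assms] by (intro bexI[of _ "- x"]) (auto simp: subspace_module_def)
  qed (use assms in \<open>auto simp: subspace_module_def lin_subspace_def add_ac\<close>)
qed (use assms in \<open>auto simp: subspace_module_def ring_of_type_algebra_def lin_subspace_def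
      lin_scale_add_left lin_scale_add_right\<close>)

lemma module_quotient_module:
  assumes Z: "lin_subspace Z" and B: "lin_subspace B"
  shows "module (ring_of_type_algebra :: 'k::comm_ring_1 ring) (quotient_module Z (B :: ('x \<Rightarrow>\<^sub>0 'k) set))"
  by (rule module_image[OF module_subspace_module[OF Z], of "coset B"])
     (simp_all add: carrier_quotient_module zero_quotient_module add_quotient_module[OF B]
        smult_quotient_module[OF B] subspace_module_def)

section \<open>Permuted direct sums as induced modules\<close>

text \<open>
  The linear extension of a map from a basis to a module. It is the universal property of the free module
  that is used to define maps out of induced modules.
\<close>

definition module_eval :: "('k::comm_ring_1, 'm, 'z) module_scheme \<Rightarrow> ('x \<Rightarrow> 'm) \<Rightarrow> ('x \<Rightarrow>\<^sub>0 'k) \<Rightarrow> 'm"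
  where "module_eval M F c = (\<Oplus>\<^bsub>M\<^esub>x\<in>Poly_Mapping.keys c. Poly_Mapping.lookup c x \<odot>\<^bsub>M\<^esub> F x)"

lemma ring_of_type_algebra_simps [simp]:
  "carrier (ring_of_type_algebra :: 'k::comm_ring_1 ring) = UNIV"
  "r \<oplus>\<^bsub>ring_of_type_algebra\<^esub> s = r + s" "r \<otimes>\<^bsub>ring_of_type_algebra\<^esub> s = r * s"
  "\<zero>\<^bsub>ring_of_type_algebra\<^esub> = 0" "\<one>\<^bsub>ring_of_type_algebra\<^esub> = 1"
  by (simp_all add: ring_of_type_algebra_def)

context
  fixes M :: "('k::comm_ring_1, 'm) module" and F :: "'x \<Rightarrow> 'm"
  assumes M: "module ring_of_type_algebra M" and F: "\<And>x. F x \<in> carrier M"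
begin

interpretation M: module ring_of_type_algebra M
  by (rule M)

lemma smult_F [simp]: "r \<odot>\<^bsub>M\<^esub> F x \<in> carrier M"
  using F by (intro M.smult_closed) simp_all

lemma smult_zero_F: "0 \<odot>\<^bsub>M\<^esub> F x = \<zero>\<^bsub>M\<^esub>"
  using M.smult_l_null[OF F[of x]] by simp

lemma module_eval_superset:
  assumes "finite S" "Poly_Mapping.keys c \<subseteq> S"
  shows "module_eval M F c = (\<Oplus>\<^bsub>M\<^esub>x\<in>S. Poly_Mapping.lookup c x \<odot>\<^bsub>M\<^esub> F x)"
  unfolding module_eval_def
  by (rule M.M.add.finprod_mono_neutral_cong_left[OF assms])
     (auto simp: in_keys_iff smult_zero_F)

lemma module_eval_closed: "module_eval M F c \<in> carrier M"
  unfolding module_eval_def by (intro M.M.finsum_closed) auto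

lemma module_eval_add: "module_eval M F (a + b) = module_eval M F a \<oplus>\<^bsub>M\<^esub> module_eval M F b"
proof -
  let ?S = "Poly_Mapping.keys a \<union> Poly_Mapping.keys b"
  have "module_eval M F (a + b) = (\<Oplus>\<^bsub>M\<^esub>x\<in>?S. Poly_Mapping.lookup (a + b) x \<odot>\<^bsub>M\<^esub> F x)"
    by (rule module_eval_superset) (simp_all add: keys_add)
  also have "\<dots> = (\<Oplus>\<^bsub>M\<^esub>x\<in>?S. Poly_Mapping.lookup a x \<odot>\<^bsub>M\<^esub> F x \<oplus>\<^bsub>M\<^esub> Poly_Mapping.lookup b x \<odot>\<^bsub>M\<^esub> F x)"
    by (rule M.M.finsum_cong') (use M.smult_l_distr[OF _ _ F] in \<open>auto simp: lookup_add\<close>)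
  also have "\<dots> = (\<Oplus>\<^bsub>M\<^esub>x\<in>?S. Poly_Mapping.lookup a x \<odot>\<^bsub>M\<^esub> F x) \<oplus>\<^bsub>M\<^esub> (\<Oplus>\<^bsub>M\<^esub>x\<in>?S. Poly_Mapping.lookup b x \<odot>\<^bsub>M\<^esub> F x)"
    by (rule M.M.finsum_addf) auto
  also have "\<dots> = module_eval M F a \<oplus>\<^bsub>M\<^esub> module_eval M F b"
    using module_eval_superset[of ?S a] module_eval_superset[of ?S b] by simp
  finally show ?thesis .
qed

lemma module_eval_scale: "module_eval M F (lin_scale r a) = r \<odot>\<^bsub>M\<^esub> module_eval M F a"
proof -
  have "module_eval M F (lin_scale r a) = (\<Oplus>\<^bsub>M\<^esub>x\<in>Poly_Mapping.keys a. Poly_Mapping.lookup (lin_scale r a) x \<odot>\<^bsub>M\<^esub> F x)"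
    by (rule module_eval_superset) (simp_all add: keys_lin_scale)
  also have "\<dots> = (\<Oplus>\<^bsub>M\<^esub>x\<in>Poly_Mapping.keys a. r \<odot>\<^bsub>M\<^esub> (Poly_Mapping.lookup a x \<odot>\<^bsub>M\<^esub> F x))"
    by (rule M.M.finsum_cong') (use M.smult_assoc1[OF _ _ F] in auto)
  also have "\<dots> = r \<odot>\<^bsub>M\<^esub> module_eval M F a"
    unfolding module_eval_def by (rule M.finsum_smult_ldistr[symmetric]) auto
  finally show ?thesis .
qed

lemma module_eval_single: "module_eval M F (Poly_Mapping.single x r) = r \<odot>\<^bsub>M\<^esub> F x"
  using module_eval_superset[of "{x}" "Poly_Mapping.single x r"] by simp

lemma module_eval_zero: "module_eval M F 0 = \<zero>\<^bsub>M\<^esub>"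
  by (simp add: module_eval_def)

lemma module_eval_diff: "module_eval M F (a - b) \<oplus>\<^bsub>M\<^esub> module_eval M F b = module_eval M F a"
  using module_eval_add[of "a - b" b] by simp

lemma module_eval_diff_eq_zero:
  assumes "module_eval M F a = module_eval M F b"
  shows "module_eval M F (a - b) = \<zero>\<^bsub>M\<^esub>"
  using module_eval_diff[of a b] assms module_eval_closed M.M.add.r_cancel_one by metis

lemma module_eval_span:
  assumes "\<And>s. s \<in> S \<Longrightarrow> module_eval M F s = \<zero>\<^bsub>M\<^esub>" "c \<in> lin_span S"
  shows "module_eval M F c = \<zero>\<^bsub>M\<^esub>"
  using assms(2)
  by induction (simp_all add: assms(1) module_eval_zero module_eval_add module_eval_scale M.smult_r_null)

end

text \<open>
  A family of modules over a finite set on which a group acts, with maps \<open>\<rho> J g\<close> from the module at \<open>J\<close> to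
  the one at \<open>g J\<close> that are compatible with the multiplication; \<open>T\<close> represents the orbits.
\<close>

locale permuted_modules =
  fixes G :: "('g, 'z) monoid_scheme" and I :: "'i set" and a :: "'g \<Rightarrow> 'i \<Rightarrow> 'i"
    and M :: "'i \<Rightarrow> ('k::comm_ring_1, 'm) module" and \<rho> :: "'i \<Rightarrow> 'g \<Rightarrow> 'm \<Rightarrow> 'm" and T :: "'i set"
  assumes group: "group G" and finite_I: "finite I"
    and a_in: "\<lbrakk>g \<in> carrier G; J \<in> I\<rbrakk> \<Longrightarrow> a g J \<in> I"
    and a_one: "J \<in> I \<Longrightarrow> a \<one>\<^bsub>G\<^esub> J = J"
    and a_mult: "\<lbrakk>g \<in> carrier G; h \<in> carrier G; J \<in> I\<rbrakk> \<Longrightarrow> a (g \<otimes>\<^bsub>G\<^esub> h) J = a g (a h J)"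
    and M: "J \<in> I \<Longrightarrow> module ring_of_type_algebra (M J)"
    and \<rho>_in: "\<lbrakk>g \<in> carrier G; J \<in> I; x \<in> carrier (M J)\<rbrakk> \<Longrightarrow> \<rho> J g x \<in> carrier (M (a g J))"
    and \<rho>_add: "\<lbrakk>g \<in> carrier G; J \<in> I; x \<in> carrier (M J); y \<in> carrier (M J)\<rbrakk>
      \<Longrightarrow> \<rho> J g (x \<oplus>\<^bsub>M J\<^esub> y) = \<rho> J g x \<oplus>\<^bsub>M (a g J)\<^esub> \<rho> J g y"
    and \<rho>_smult: "\<lbrakk>g \<in> carrier G; J \<in> I; x \<in> carrier (M J)\<rbrakk>
      \<Longrightarrow> \<rho> J g (r \<odot>\<^bsub>M J\<^esub> x) = r \<odot>\<^bsub>M (a g J)\<^esub> \<rho> J g x"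
    and \<rho>_one: "\<lbrakk>J \<in> I; x \<in> carrier (M J)\<rbrakk> \<Longrightarrow> \<rho> J \<one>\<^bsub>G\<^esub> x = x"
    and \<rho>_mult: "\<lbrakk>g \<in> carrier G; h \<in> carrier G; J \<in> I; x \<in> carrier (M J)\<rbrakk>
      \<Longrightarrow> \<rho> J (g \<otimes>\<^bsub>G\<^esub> h) x = \<rho> (a h J) g (\<rho> J h x)"
    and T_sub: "T \<subseteq> I" and T_ex1: "J \<in> I \<Longrightarrow> \<exists>!J'. J' \<in> T \<and> (\<exists>g\<in>carrier G. a g J' = J)"
begin

interpretation G: group G
  by (rule group)

definition stab :: "'i \<Rightarrow> 'g set"
  where "stab J = {g \<in> carrier G. a g J = J}"

definition orb :: "'i \<Rightarrow> 'i set"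
  where "orb J = (\<lambda>g. a g J) ` carrier G"

text \<open>
  One element of the group for every point \<open>J'\<close> of the orbit of \<open>J\<close>, in other words a
  representative for every coset of the stabiliser.
\<close>

definition transp :: "'i \<Rightarrow> 'i \<Rightarrow> 'g"
  where "transp J J' = (SOME g. g \<in> carrier G \<and> a g J = J')"

abbreviation rel :: "'i \<Rightarrow> ('g \<times> 'm \<Rightarrow>\<^sub>0 'k) set"
  where "rel J \<equiv> induced_relations G (stab J) (M J) (\<rho> J)"

abbreviation tensor :: "'g \<Rightarrow> 'm \<Rightarrow> 'g \<times> 'm \<Rightarrow>\<^sub>0 'k"
  where "tensor g x \<equiv> Poly_Mapping.single (g, x) 1"

text \<open>
  In terms of the representatives of the cosets, the induced module is the sum of copies of the module at
  \<open>J\<close>, one for every point of the orbit; \<open>y\<close> collects the entries in these copies.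
\<close>

definition formal :: "'i \<Rightarrow> ('i \<Rightarrow> 'm) \<Rightarrow> 'g \<times> 'm \<Rightarrow>\<^sub>0 'k"
  where "formal J y = (\<Sum>J'\<in>orb J. tensor (transp J J') (y J'))"

definition pullback :: "'i \<Rightarrow> ('i \<Rightarrow> 'm) \<Rightarrow> 'i \<Rightarrow> 'm"
  where "pullback J f J' = \<rho> J' (inv\<^bsub>G\<^esub> (transp J J')) (f J')"

definition to_induced :: "('i \<Rightarrow> 'm) \<Rightarrow> 'i \<Rightarrow> ('g \<times> 'm \<Rightarrow>\<^sub>0 'k) set"
  where "to_induced f = (\<lambda>J\<in>T. coset (rel J) (formal J (pullback J f)))"

lemma rel_subspace: "lin_subspace (rel J)"
  unfolding induced_relations_def by (rule lin_subspace_lin_span)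

lemma orb_sub: "J \<in> I \<Longrightarrow> orb J \<subseteq> I"
  using a_in by (auto simp: orb_def)

lemma finite_orb: "J \<in> I \<Longrightarrow> finite (orb J)"
  using orb_sub finite_I finite_subset by metis

lemma transp:
  assumes "J' \<in> orb J"
  shows "transp J J' \<in> carrier G" "a (transp J J') J = J'"
proof -
  have "\<exists>g. g \<in> carrier G \<and> a g J = J'"
    using assms by (auto simp: orb_def)
  from someI_ex[OF this] show "transp J J' \<in> carrier G" "a (transp J J') J = J'"
    by (simp_all add: transp_def)
qed

lemma a_inv: "\<lbrakk>g \<in> carrier G; J \<in> I; a g J = J'\<rbrakk> \<Longrightarrow> a (inv\<^bsub>G\<^esub> g) J' = J"
  using a_mult[of "inv\<^bsub>G\<^esub> g" g J] a_one by simp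

lemma orb_mem:
  assumes "J \<in> I" "J' \<in> orb J" "g \<in> carrier G"
  shows "a g J' \<in> orb J"
proof -
  obtain h where h: "h \<in> carrier G" "J' = a h J"
    using assms(2) by (auto simp: orb_def)
  then have "a g J' = a (g \<otimes>\<^bsub>G\<^esub> h) J"
    using a_mult assms by simp
  moreover have "g \<otimes>\<^bsub>G\<^esub> h \<in> carrier G"
    using assms h by simp
  ultimately show ?thesis
    unfolding orb_def by (rule image_eqI)
qed

lemma pullback_in:
  assumes "J \<in> I" "J' \<in> orb J" "f J' \<in> carrier (M J')"
  shows "pullback J f J' \<in> carrier (M J)"
proof -
  have "J' \<in> I"
    using assms orb_sub by blast
  then show ?thesis
    using \<rho>_in[of "inv\<^bsub>G\<^esub> (transp J J')" J' "f J'"] transp[OF assms(2)] assms a_inv[of "transp J J'" J J']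
    by (simp add: pullback_def)
qed

lemma rel_add:
  assumes "g \<in> carrier G" "x \<in> carrier (M J)" "y \<in> carrier (M J)"
  shows "tensor g (x \<oplus>\<^bsub>M J\<^esub> y) - tensor g x - tensor g y \<in> rel J"
  unfolding induced_relations_def by (rule lin_span.base) (use assms in blast)

lemma rel_smult:
  assumes "g \<in> carrier G" "x \<in> carrier (M J)"
  shows "tensor g (r \<odot>\<^bsub>M J\<^esub> x) - Poly_Mapping.single (g, x) r \<in> rel J"
  unfolding induced_relations_def by (rule lin_span.base) (use assms in blast)

lemma rel_stab:
  assumes "g \<in> carrier G" "h \<in> stab J" "x \<in> carrier (M J)"
  shows "tensor (g \<otimes>\<^bsub>G\<^esub> h) x - tensor g (\<rho> J h x) \<in> rel J"
  unfolding induced_relations_def by (rule lin_span.base) (use assms in blast)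

lemma rel_zero:
  assumes "J \<in> I" "g \<in> carrier G"
  shows "tensor g \<zero>\<^bsub>M J\<^esub> \<in> rel J"
proof -
  interpret M: module ring_of_type_algebra "M J"
    by (rule M[OF assms(1)])
  have "tensor g (\<zero>\<^bsub>M J\<^esub> \<oplus>\<^bsub>M J\<^esub> \<zero>\<^bsub>M J\<^esub>) - tensor g \<zero>\<^bsub>M J\<^esub> - tensor g \<zero>\<^bsub>M J\<^esub> \<in> rel J"
    by (rule rel_add[OF assms(2)]) auto
  then have "- tensor g \<zero>\<^bsub>M J\<^esub> \<in> rel J"
    by simp
  from lin_subspace_minus[OF rel_subspace this] show ?thesis
    by simp
qed

text \<open>Every tensor can be moved to the chosen representative of its coset of the stabiliser.\<close>

lemma tensor_normal:
  assumes J: "J \<in> I" and u: "u \<in> carrier G" "a u J = J'" and x: "x \<in> carrier (M J)"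
  shows "tensor u x - tensor (transp J J') (\<rho> J (inv\<^bsub>G\<^esub> (transp J J') \<otimes>\<^bsub>G\<^esub> u) x) \<in> rel J"
proof -
  have J': "J' \<in> orb J"
    using u by (auto simp: orb_def)
  note t = transp[OF J']
  let ?h = "inv\<^bsub>G\<^esub> (transp J J') \<otimes>\<^bsub>G\<^esub> u"
  have "a ?h J = J"
    using a_mult[of "inv\<^bsub>G\<^esub> (transp J J')" u J] a_inv[OF t(1) J t(2)] t u J by simp
  then have h: "?h \<in> stab J"
    using t u by (simp add: stab_def)
  have "transp J J' \<otimes>\<^bsub>G\<^esub> ?h = u"
    using t u by (simp add: G.m_assoc[symmetric])
  then show ?thesis
    using rel_stab[OF t(1) h x] by simp
qed

lemma formal_keys:
  assumes "J \<in> I" "\<And>J'. J' \<in> orb J \<Longrightarrow> y J' \<in> carrier (M J)"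
  shows "formal J y \<in> {c. Poly_Mapping.keys c \<subseteq> carrier G \<times> carrier (M J)}"
  unfolding formal_def
  by (rule lin_subspace_sum[OF lin_subspace_keys]) (use assms transp in auto)

lemma formal_add:
  assumes "J \<in> I" "\<And>J'. J' \<in> orb J \<Longrightarrow> y J' \<in> carrier (M J)" "\<And>J'. J' \<in> orb J \<Longrightarrow> z J' \<in> carrier (M J)"
    and "\<And>J'. J' \<in> orb J \<Longrightarrow> w J' = y J' \<oplus>\<^bsub>M J\<^esub> z J'"
  shows "formal J w - (formal J y + formal J z) \<in> rel J"
proof -
  have "formal J w - (formal J y + formal J z)
      = (\<Sum>J'\<in>orb J. tensor (transp J J') (y J' \<oplus>\<^bsub>M J\<^esub> z J') - tensor (transp J J') (y J') - tensor (transp J J') (z J'))"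
    using assms(4) by (simp add: formal_def sum_subtractf sum.distrib algebra_simps)
  also have "\<dots> \<in> rel J"
    by (rule lin_subspace_sum[OF rel_subspace]) (use assms transp in \<open>intro rel_add, auto\<close>)
  finally show ?thesis .
qed

lemma formal_smult:
  assumes "J \<in> I" "\<And>J'. J' \<in> orb J \<Longrightarrow> y J' \<in> carrier (M J)"
    and "\<And>J'. J' \<in> orb J \<Longrightarrow> w J' = r \<odot>\<^bsub>M J\<^esub> y J'"
  shows "formal J w - lin_scale r (formal J y) \<in> rel J"
proof -
  have "formal J w - lin_scale r (formal J y)
      = (\<Sum>J'\<in>orb J. tensor (transp J J') (r \<odot>\<^bsub>M J\<^esub> y J') - Poly_Mapping.single (transp J J', y J') r)"
    using assms(3) by (simp add: formal_def sum_subtractf lin_scale_sum)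
  also have "\<dots> \<in> rel J"
    by (rule lin_subspace_sum[OF rel_subspace]) (use assms transp in \<open>intro rel_smult, auto\<close>)
  finally show ?thesis .
qed

text \<open>
  Tensors can be moved to the representatives of their cosets, and the combinations that arise in this way
  are closed under the operations of the module.
\<close>

lemma formal_surjective:
  assumes J: "J \<in> I" and c: "Poly_Mapping.keys c \<subseteq> carrier G \<times> carrier (M J)"
  shows "\<exists>y. (\<forall>J'\<in>orb J. y J' \<in> carrier (M J)) \<and> c - formal J y \<in> rel J"
proof -
  interpret M: module ring_of_type_algebra "M J"
    by (rule M[OF J])
  (* The combinations that can be written with the representatives. *)
  define E where "E = {c. \<exists>y. (\<forall>J'\<in>orb J. y J' \<in> carrier (M J)) \<and> c - formal J y \<in> rel J}"
  have E_add: "c + d \<in> E" if cd: "c \<in> E" "d \<in> E" for c d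
  proof -
    obtain y z where y: "\<forall>J'\<in>orb J. y J' \<in> carrier (M J)" "c - formal J y \<in> rel J"
      and z: "\<forall>J'\<in>orb J. z J' \<in> carrier (M J)" "d - formal J z \<in> rel J"
      using cd by (auto simp: E_def)
    let ?w = "\<lambda>J'. y J' \<oplus>\<^bsub>M J\<^esub> z J'"
    have "c + d - formal J ?w = (c - formal J y) + (d - formal J z) - (formal J ?w - (formal J y + formal J z))"
      by simp
    also have "\<dots> \<in> rel J"
    proof (rule lin_subspace_diff[OF rel_subspace lin_subspace_add[OF rel_subspace y(2) z(2)]])
      show "formal J ?w - (formal J y + formal J z) \<in> rel J"
        by (rule formal_add[OF J]) (use y z in simp_all)
    qed
    finally show ?thesis
      unfolding E_def using y z by (intro CollectI exI[of _ ?w]) auto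
  qed
  have E_scale: "lin_scale r c \<in> E" if cE: "c \<in> E" for r c
  proof -
    obtain y where y: "\<forall>J'\<in>orb J. y J' \<in> carrier (M J)" "c - formal J y \<in> rel J"
      using cE by (auto simp: E_def)
    let ?w = "\<lambda>J'. r \<odot>\<^bsub>M J\<^esub> y J'"
    have "lin_scale r c - formal J ?w = lin_scale r (c - formal J y) - (formal J ?w - lin_scale r (formal J y))"
      by (simp add: lin_scale_diff_right)
    also have "\<dots> \<in> rel J"
    proof (rule lin_subspace_diff[OF rel_subspace lin_subspace_scale[OF rel_subspace y(2)]])
      show "formal J ?w - lin_scale r (formal J y) \<in> rel J"
        by (rule formal_smult[OF J]) (use y in simp_all)
    qed
    finally show ?thesis
      unfolding E_def using y by (intro CollectI exI[of _ ?w]) auto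
  qed
  have E_rel: "c \<in> E" if "c \<in> rel J" for c
  proof -
    have "formal J (\<lambda>_. \<zero>\<^bsub>M J\<^esub>) \<in> rel J"
      unfolding formal_def by (rule lin_subspace_sum[OF rel_subspace]) (use transp J in \<open>intro rel_zero, auto\<close>)
    then show ?thesis
      unfolding E_def using that
      by (intro CollectI exI[of _ "\<lambda>_. \<zero>\<^bsub>M J\<^esub>"]) (auto intro: lin_subspace_diff[OF rel_subspace])
  qed
  have E_tensor: "tensor u x \<in> E" if u: "u \<in> carrier G" and x: "x \<in> carrier (M J)" for u x
  proof -
    let ?J' = "a u J"
    have J': "?J' \<in> orb J"
      using u by (simp add: orb_def)
    note t = transp[OF J']
    let ?x = "\<rho> J (inv\<^bsub>G\<^esub> (transp J ?J') \<otimes>\<^bsub>G\<^esub> u) x"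
    let ?y = "\<lambda>J''. if J'' = ?J' then ?x else \<zero>\<^bsub>M J\<^esub>"
    have "a (inv\<^bsub>G\<^esub> (transp J ?J') \<otimes>\<^bsub>G\<^esub> u) J = J"
      using a_mult[of "inv\<^bsub>G\<^esub> (transp J ?J')" u J] a_inv[OF t(1) J t(2)] t u J by simp
    then have x': "?x \<in> carrier (M J)"
      using \<rho>_in[of "inv\<^bsub>G\<^esub> (transp J ?J') \<otimes>\<^bsub>G\<^esub> u" J x] t u x J by simp
    have "formal J ?y = tensor (transp J ?J') ?x + (\<Sum>J''\<in>orb J - {?J'}. tensor (transp J J'') \<zero>\<^bsub>M J\<^esub>)"
      unfolding formal_def using finite_orb[OF J] J' by (simp add: sum.remove)
    then have "tensor u x - formal J ?y
        = (tensor u x - tensor (transp J ?J') ?x) - (\<Sum>J''\<in>orb J - {?J'}. tensor (transp J J'') \<zero>\<^bsub>M J\<^esub>)"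
      by simp
    also have "\<dots> \<in> rel J"
    proof (rule lin_subspace_diff[OF rel_subspace tensor_normal[OF J u refl x]], rule lin_subspace_sum[OF rel_subspace])
      show "tensor (transp J J'') \<zero>\<^bsub>M J\<^esub> \<in> rel J" if "J'' \<in> orb J - {?J'}" for J''
        using that transp(1)[of J'' J] by (intro rel_zero[OF J]) auto
    qed
    finally show ?thesis
      unfolding E_def using x' by (intro CollectI exI[of _ ?y]) auto
  qed
  have "0 \<in> E"
    by (rule E_rel) (rule lin_subspace_zero[OF rel_subspace])
  then have "lin_subspace E"
    using E_add E_scale by (simp add: lin_subspace_def)
  then have "(\<Sum>k\<in>Poly_Mapping.keys c. lin_scale (Poly_Mapping.lookup c k) (Poly_Mapping.single k 1)) \<in> E"
  proof (rule lin_subspace_sum)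
    fix k
    assume "k \<in> Poly_Mapping.keys c"
    then have "fst k \<in> carrier G" "snd k \<in> carrier (M J)"
      using c by auto
    from E_scale[OF E_tensor[OF this]]
    show "lin_scale (Poly_Mapping.lookup c k) (Poly_Mapping.single k 1) \<in> E"
      by (simp del: lin_scale_single)
  qed
  then show ?thesis
    unfolding lin_expand[symmetric] by (simp add: E_def)
qed

text \<open>
  The map from the induced module back to the direct sum, in the component at \<open>J'\<close>: it sends \<open>u \<otimes> x\<close> to
  \<open>u x\<close>, if this lies over \<open>J'\<close>. It shows that \<open>to_induced\<close> is injective.
\<close>

definition component :: "'i \<Rightarrow> 'i \<Rightarrow> ('g \<times> 'm \<Rightarrow>\<^sub>0 'k) \<Rightarrow> 'm"
  where "component J J' = module_eval (M J') (\<lambda>(u, x).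
    if u \<in> carrier G \<and> x \<in> carrier (M J) \<and> a u J = J' then \<rho> J u x else \<zero>\<^bsub>M J'\<^esub>)"

lemma component_rel:
  assumes J: "J \<in> I" and J': "J' \<in> orb J" and c: "c \<in> rel J"
  shows "component J J' c = \<zero>\<^bsub>M J'\<^esub>"
proof -
  let ?F = "\<lambda>(u, x). if u \<in> carrier G \<and> x \<in> carrier (M J) \<and> a u J = J' then \<rho> J u x else \<zero>\<^bsub>M J'\<^esub>"
  interpret M: module ring_of_type_algebra "M J"
    by (rule M[OF J])
  have J'I: "J' \<in> I"
    using J J' orb_sub by blast
  interpret M': module ring_of_type_algebra "M J'"
    by (rule M[OF J'I])
  have F: "?F k \<in> carrier (M J')" for k
    using \<rho>_in[OF _ J] by (auto split: prod.splits)
  note ev = module_eval_diff_eq_zero[OF M'.module_axioms F]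
  note ev_simps = module_eval_single[OF M'.module_axioms F] module_eval_add[OF M'.module_axioms F]
  have smult_one: "1 \<odot>\<^bsub>M J'\<^esub> x = x" if "x \<in> carrier (M J')" for x
    using M'.smult_one[OF that] by simp
  show ?thesis
    unfolding component_def
  proof (rule module_eval_span[OF M'.module_axioms F _ c[unfolded induced_relations_def]], elim UnE)
    fix c
    assume "c \<in> {tensor g (x \<oplus>\<^bsub>M J\<^esub> y) - tensor g x - tensor g y |g x y.
        g \<in> carrier G \<and> x \<in> carrier (M J) \<and> y \<in> carrier (M J)}"
    then obtain g x y where c: "c = tensor g (x \<oplus>\<^bsub>M J\<^esub> y) - (tensor g x + tensor g y)"
      and g: "g \<in> carrier G" "x \<in> carrier (M J)" "y \<in> carrier (M J)"
      by (auto simp: diff_diff_eq)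
    show "module_eval (M J') ?F c = \<zero>\<^bsub>M J'\<^esub>"
      unfolding c
    proof (rule ev, cases "a g J = J'")
      case True
      then show "module_eval (M J') ?F (tensor g (x \<oplus>\<^bsub>M J\<^esub> y)) = module_eval (M J') ?F (tensor g x + tensor g y)"
        using g J \<rho>_in[of g J] \<rho>_add[of g J x y] by (simp add: ev_simps smult_one)
    next
      case False
      then show "module_eval (M J') ?F (tensor g (x \<oplus>\<^bsub>M J\<^esub> y)) = module_eval (M J') ?F (tensor g x + tensor g y)"
        by (simp add: ev_simps smult_one)
    qed
  next
    fix c
    assume "c \<in> {tensor g (r \<odot>\<^bsub>M J\<^esub> x) - Poly_Mapping.single (g, x) r |g r x. g \<in> carrier G \<and> x \<in> carrier (M J)}"
    then obtain g r x where c: "c = tensor g (r \<odot>\<^bsub>M J\<^esub> x) - Poly_Mapping.single (g, x) r"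
      and g: "g \<in> carrier G" "x \<in> carrier (M J)"
      by blast
    have rx: "r \<odot>\<^bsub>M J\<^esub> x \<in> carrier (M J)"
      using M.smult_closed[OF _ g(2)] by simp
    show "module_eval (M J') ?F c = \<zero>\<^bsub>M J'\<^esub>"
      unfolding c
    proof (rule ev, cases "a g J = J'")
      case True
      then show "module_eval (M J') ?F (tensor g (r \<odot>\<^bsub>M J\<^esub> x)) = module_eval (M J') ?F (Poly_Mapping.single (g, x) r)"
        using g rx J \<rho>_in[of g J] \<rho>_smult[of g J x r] by (simp add: ev_simps smult_one)
    next
      case False
      then show "module_eval (M J') ?F (tensor g (r \<odot>\<^bsub>M J\<^esub> x)) = module_eval (M J') ?F (Poly_Mapping.single (g, x) r)"
        using M'.smult_r_null[of r] by (simp add: ev_simps smult_one)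
    qed
  next
    fix c
    assume "c \<in> {tensor (g \<otimes>\<^bsub>G\<^esub> h) x - tensor g (\<rho> J h x) |g h x. g \<in> carrier G \<and> h \<in> stab J \<and> x \<in> carrier (M J)}"
    then obtain g h x where c: "c = tensor (g \<otimes>\<^bsub>G\<^esub> h) x - tensor g (\<rho> J h x)"
      and g: "g \<in> carrier G" "h \<in> carrier G" "a h J = J" "x \<in> carrier (M J)"
      by (auto simp: stab_def)
    have hx: "\<rho> J h x \<in> carrier (M J)"
      using \<rho>_in[of h J x] g J by simp
    have gh: "g \<otimes>\<^bsub>G\<^esub> h \<in> carrier G" "a (g \<otimes>\<^bsub>G\<^esub> h) J = a g J"
      using g J a_mult by auto
    show "module_eval (M J') ?F c = \<zero>\<^bsub>M J'\<^esub>"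
      unfolding c
      by (rule ev) (use g hx gh J \<rho>_mult[of g h J x] in \<open>simp add: ev_simps\<close>)
  qed
qed

lemma component_formal:
  assumes J: "J \<in> I" and J': "J' \<in> orb J" and y: "\<And>J'. J' \<in> orb J \<Longrightarrow> y J' \<in> carrier (M J)"
  shows "component J J' (formal J y) = \<rho> J (transp J J') (y J')"
proof -
  let ?F = "\<lambda>(u, x). if u \<in> carrier G \<and> x \<in> carrier (M J) \<and> a u J = J' then \<rho> J u x else \<zero>\<^bsub>M J'\<^esub>"
  have J'I: "J' \<in> I"
    using J J' orb_sub by blast
  interpret M': module ring_of_type_algebra "M J'"
    by (rule M[OF J'I])
  have F: "?F k \<in> carrier (M J')" for k
    using \<rho>_in[OF _ J] by (auto split: prod.splits)
  note ev_simps = module_eval_single[OF M'.module_axioms F] module_eval_add[OF M'.module_axioms F]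
    module_eval_zero[OF M'.module_axioms F]
  have smult_one: "1 \<odot>\<^bsub>M J'\<^esub> x = x" if "x \<in> carrier (M J')" for x
    using M'.smult_one[OF that] by simp
  have other: "module_eval (M J') ?F (\<Sum>J''\<in>S. tensor (transp J J'') (y J'')) = \<zero>\<^bsub>M J'\<^esub>"
    if "finite S" "S \<subseteq> orb J - {J'}" for S
    using that
  proof (induction S rule: finite_induct)
    case (insert J'' S)
    have "a (transp J J'') J \<noteq> J'"
      using insert.prems transp(2)[of J'' J] by auto
    then show ?case
      using insert by (simp add: ev_simps smult_one)
  qed (simp add: ev_simps)
  have "formal J y = tensor (transp J J') (y J') + (\<Sum>J''\<in>orb J - {J'}. tensor (transp J J'') (y J''))"
    unfolding formal_def using finite_orb[OF J] J' by (simp add: sum.remove)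
  then show ?thesis
    unfolding component_def
    using other[of "orb J - {J'}"] finite_orb[OF J] transp[OF J'] y[OF J'] \<rho>_in[of "transp J J'" J "y J'"] J
    by (simp add: ev_simps smult_one)
qed

lemma \<rho>_pullback:
  assumes "J \<in> I" "J' \<in> orb J" "f J' \<in> carrier (M J')"
  shows "\<rho> J (transp J J') (pullback J f J') = f J'"
proof -
  note t = transp[OF assms(2)]
  have J': "J' \<in> I"
    using assms orb_sub by blast
  have "\<rho> J' (transp J J' \<otimes>\<^bsub>G\<^esub> inv\<^bsub>G\<^esub> (transp J J')) (f J') = \<rho> J (transp J J') (pullback J f J')"
    using \<rho>_mult[of "transp J J'" "inv\<^bsub>G\<^esub> (transp J J')" J' "f J'"] t J' assms(3) a_inv[OF t(1) assms(1) t(2)]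
    by (simp add: pullback_def)
  then show ?thesis
    using t J' assms(3) by (simp add: \<rho>_one)
qed

lemma component_to_induced:
  assumes "J \<in> I" "J' \<in> orb J" "\<And>J'. J' \<in> I \<Longrightarrow> f J' \<in> carrier (M J')"
  shows "component J J' (formal J (pullback J f)) = f J'"
proof -
  have "pullback J f J'' \<in> carrier (M J)" if "J'' \<in> orb J" for J''
    using assms orb_sub that by (intro pullback_in) auto
  from component_formal[OF assms(1,2) this] show ?thesis
    using \<rho>_pullback[of J J' f] assms orb_sub by auto
qed

abbreviation sum_mod :: "('k, 'i \<Rightarrow> 'm) module"
  where "sum_mod \<equiv> direct_sum_module I M"

abbreviation ind :: "'i \<Rightarrow> ('k, ('g \<times> 'm \<Rightarrow>\<^sub>0 'k) set) module"
  where "ind J \<equiv> induced_module G (stab J) (M J) (\<rho> J)"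

abbreviation sum_ind :: "('k, 'i \<Rightarrow> ('g \<times> 'm \<Rightarrow>\<^sub>0 'k) set) module"
  where "sum_ind \<equiv> direct_sum_module T ind"

lemma carrier_sum_mod: "carrier sum_mod = (\<Pi>\<^sub>E J\<in>I. carrier (M J))"
  using finite_I by (auto simp: direct_sum_module_def)

lemma carrier_sum_ind: "carrier sum_ind = (\<Pi>\<^sub>E J\<in>T. carrier (ind J))"
  using finite_subset[OF T_sub finite_I] by (auto simp: direct_sum_module_def)

lemma carrier_ind: "carrier (ind J) = coset (rel J) ` {c. Poly_Mapping.keys c \<subseteq> carrier G \<times> carrier (M J)}"
  unfolding induced_module_def by (rule carrier_quotient_module)

lemma rep_exists:
  assumes "J' \<in> I"
  shows "\<exists>J\<in>T. J' \<in> orb J"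
proof -
  obtain J where J: "J \<in> T" "\<exists>g\<in>carrier G. a g J = J'"
    using ex1_implies_ex[OF T_ex1[OF assms]] by (elim exE conjE)
  from J(2) have "J' \<in> orb J"
    unfolding orb_def by (elim bexE) (rule image_eqI, erule sym)
  with J(1) show ?thesis
    by (rule bexI[rotated])
qed

lemma rep_unique:
  assumes "J \<in> T" "L \<in> T" "J' \<in> orb J" "J' \<in> orb L" "J' \<in> I"
  shows "J = L"
proof -
  define P where "P L \<longleftrightarrow> L \<in> T \<and> (\<exists>g\<in>carrier G. a g L = J')" for L
  have "\<exists>!L. P L"
    unfolding P_def by (rule T_ex1[OF assms(5)])
  moreover have "P J"
    using assms(1,3) by (auto simp: P_def orb_def)
  moreover have "P L"
    using assms(2,4) by (auto simp: P_def orb_def)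
  ultimately show ?thesis
    by blast
qed

lemma to_induced_bij: "bij_betw to_induced (carrier sum_mod) (carrier sum_ind)"
proof (rule bij_betw_imageI)
  show "inj_on to_induced (carrier sum_mod)"
  proof (rule inj_onI)
    fix f f'
    assume f: "f \<in> carrier sum_mod" and f': "f' \<in> carrier sum_mod" and eq: "to_induced f = to_induced f'"
    have in_M: "f J \<in> carrier (M J)" "f' J \<in> carrier (M J)" if "J \<in> I" for J
      using f f' that by (auto simp: carrier_sum_mod)
    have "f J' = f' J'" if J': "J' \<in> I" for J'
    proof -
      obtain J where J: "J \<in> T" "J' \<in> orb J"
        using rep_exists[OF J'] by blast
      have JI: "J \<in> I"
        using J T_sub by blast
      let ?c = "formal J (pullback J f)" and ?c' = "formal J (pullback J f')"
      have c_eq: "component J J' ?c = f J'"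
        by (rule component_to_induced[OF JI J(2)]) (rule in_M(1))
      have c'_eq: "component J J' ?c' = f' J'"
        by (rule component_to_induced[OF JI J(2)]) (rule in_M(2))
      have "coset (rel J) ?c = coset (rel J) ?c'"
        using fun_cong[OF eq, of J] J by (simp add: to_induced_def)
      then have rel: "?c - ?c' \<in> rel J"
        by (simp add: coset_eq_iff[OF rel_subspace])
      have "component J J' ?c = component J J' (?c - ?c') \<oplus>\<^bsub>M J'\<^esub> component J J' ?c'"
        unfolding component_def using M[OF J'] \<rho>_in[OF _ JI]
        by (intro module_eval_diff[symmetric]) (auto split: prod.splits intro!: abelian_group.axioms(1)
            abelian_monoid.zero_closed module.axioms(2)[THEN abelian_group.axioms(1)])
      also have "\<dots> = component J J' ?c'"
        unfolding component_rel[OF JI J(2) rel] c'_eq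
        using in_M(2)[OF J'] module.axioms(2)[OF M[OF J']] by (simp add: abelian_monoid.l_zero abelian_group.axioms(1))
      finally show ?thesis
        unfolding c_eq c'_eq .
    qed
    then show "f = f'"
      using f f' unfolding carrier_sum_mod by (intro PiE_ext)
  qed
  show "to_induced ` carrier sum_mod = carrier sum_ind"
  proof (intro equalityI subsetI)
    fix \<alpha>
    assume "\<alpha> \<in> to_induced ` carrier sum_mod"
    then obtain f where f: "f \<in> carrier sum_mod" "\<alpha> = to_induced f"
      by blast
    have "formal J (pullback J f) \<in> {c. Poly_Mapping.keys c \<subseteq> carrier G \<times> carrier (M J)}" if "J \<in> T" for J
      using f(1) that T_sub orb_sub by (intro formal_keys pullback_in) (auto simp: carrier_sum_mod)
    then show "\<alpha> \<in> carrier sum_ind"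
      unfolding f(2) carrier_sum_ind to_induced_def carrier_ind by auto
  next
    fix \<alpha>
    assume \<alpha>: "\<alpha> \<in> carrier sum_ind"
    have "\<exists>y. (\<forall>J'\<in>orb J. y J' \<in> carrier (M J)) \<and> \<alpha> J = coset (rel J) (formal J y)" if J: "J \<in> T" for J
    proof -
      obtain c where c: "Poly_Mapping.keys c \<subseteq> carrier G \<times> carrier (M J)" "\<alpha> J = coset (rel J) c"
        using \<alpha> J unfolding carrier_sum_ind carrier_ind by fastforce
      have "J \<in> I"
        using J T_sub by blast
      from formal_surjective[OF this c(1)] show ?thesis
        unfolding c(2) coset_eq_iff[OF rel_subspace] .
    qed
    then obtain y where y: "\<And>J J'. \<lbrakk>J \<in> T; J' \<in> orb J\<rbrakk> \<Longrightarrow> y J J' \<in> carrier (M J)"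
      "\<And>J. J \<in> T \<Longrightarrow> \<alpha> J = coset (rel J) (formal J (y J))"
      by metis
    define rep where "rep J' = (SOME J. J \<in> T \<and> J' \<in> orb J)" for J'
    have rep: "rep J' = J" if "J \<in> T" "J' \<in> orb J" for J J'
    proof -
      have "rep J' \<in> T \<and> J' \<in> orb (rep J')"
        unfolding rep_def by (rule someI[of _ J]) (use that in blast)
      then show ?thesis
        using rep_unique[of "rep J'" J J'] that orb_sub T_sub by blast
    qed
    define f where "f = (\<lambda>J'\<in>I. \<rho> (rep J') (transp (rep J') J') (y (rep J') J'))"
    have f_eq: "f J' = \<rho> J (transp J J') (y J J')" if "J \<in> T" "J' \<in> orb J" for J J'
      using rep[OF that] that orb_sub T_sub by (auto simp: f_def)
    have "f \<in> carrier sum_mod"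
      unfolding carrier_sum_mod
    proof (rule PiE_I)
      fix J'
      assume "J' \<in> I"
      then obtain J where J: "J \<in> T" "J' \<in> orb J"
        using rep_exists by blast
      then show "f J' \<in> carrier (M J')"
        unfolding f_eq[OF J] using \<rho>_in[of "transp J J'" J "y J J'"] transp[OF J(2)] y(1)[OF J] T_sub by auto
    qed (simp add: f_def)
    moreover have "to_induced f = \<alpha>"
    proof
      fix J
      show "to_induced f J = \<alpha> J"
      proof (cases "J \<in> T")
        case True
        have JI: "J \<in> I"
          using True T_sub by blast
        have "pullback J f J' = y J J'" if J': "J' \<in> orb J" for J'
        proof -
          note t = transp[OF J']
          have "\<rho> J (inv\<^bsub>G\<^esub> (transp J J') \<otimes>\<^bsub>G\<^esub> transp J J') (y J J') = pullback J f J'"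
            unfolding pullback_def f_eq[OF True J']
            using \<rho>_mult[of "inv\<^bsub>G\<^esub> (transp J J')" "transp J J'" J "y J J'"] t JI y(1)[OF True J'] by simp
          then show ?thesis
            using t JI y(1)[OF True J'] by (simp add: \<rho>_one)
        qed
        then have "formal J (pullback J f) = formal J (y J)"
          by (simp add: formal_def)
        then show ?thesis
          using True y(2) by (simp add: to_induced_def)
      next
        case False
        then show ?thesis
          using \<alpha> by (auto simp: to_induced_def carrier_sum_ind PiE_def extensional_def)
      qed
    qed
    ultimately show "\<alpha> \<in> to_induced ` carrier sum_mod"
      by blast
  qed
qed

definition sum_act :: "'g \<Rightarrow> ('i \<Rightarrow> 'm) \<Rightarrow> 'i \<Rightarrow> 'm"
  where "sum_act g f = (\<lambda>J\<in>I. \<rho> (a (inv\<^bsub>G\<^esub> g) J) g (f (a (inv\<^bsub>G\<^esub> g) J)))"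

abbreviation left_mult :: "'g \<Rightarrow> ('g \<times> 'm \<Rightarrow>\<^sub>0 'k) \<Rightarrow> 'g \<times> 'm \<Rightarrow>\<^sub>0 'k"
  where "left_mult g \<equiv> lin_extend (\<lambda>(g', x). Poly_Mapping.single (g \<otimes>\<^bsub>G\<^esub> g', x) 1)"

lemma left_mult_rel:
  assumes J: "J \<in> I" and g: "g \<in> carrier G" and c: "c \<in> rel J"
  shows "left_mult g c \<in> rel J"
  using c unfolding induced_relations_def
proof induction
  case zero
  show ?case
    unfolding lin_map_zero[OF lin_map_lin_extend] by (rule lin_span.zero)
next
  case (add a b)
  show ?case
    unfolding lin_map_add[OF lin_map_lin_extend] by (rule lin_span.add[OF add.IH])
next
  case (scale a r)
  show ?case
    unfolding lin_map_scale[OF lin_map_lin_extend] by (rule lin_span.scale[OF scale.IH])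
next
  case (base s)
  note sub = lin_map_diff[OF lin_map_lin_extend]
  have lm: "left_mult g (Poly_Mapping.single (g', x) r) = Poly_Mapping.single (g \<otimes>\<^bsub>G\<^esub> g', x) r" for g' x and r :: 'k
    by simp
  show ?case
    unfolding induced_relations_def[symmetric] using base
  proof (elim UnE)
    assume "s \<in> {tensor g (x \<oplus>\<^bsub>M J\<^esub> y) - tensor g x - tensor g y |g x y.
        g \<in> carrier G \<and> x \<in> carrier (M J) \<and> y \<in> carrier (M J)}"
    then obtain g' x y where s: "s = tensor g' (x \<oplus>\<^bsub>M J\<^esub> y) - tensor g' x - tensor g' y"
      "g' \<in> carrier G" "x \<in> carrier (M J)" "y \<in> carrier (M J)"
      by blast
    show "left_mult g s \<in> rel J"
      unfolding s(1) sub lm using s g by (intro rel_add) auto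
  next
    assume "s \<in> {tensor g (r \<odot>\<^bsub>M J\<^esub> x) - Poly_Mapping.single (g, x) r |g r x. g \<in> carrier G \<and> x \<in> carrier (M J)}"
    then obtain g' r x where s: "s = tensor g' (r \<odot>\<^bsub>M J\<^esub> x) - Poly_Mapping.single (g', x) r"
      "g' \<in> carrier G" "x \<in> carrier (M J)"
      by blast
    show "left_mult g s \<in> rel J"
      unfolding s(1) sub lm using s g by (intro rel_smult) auto
  next
    assume "s \<in> {tensor (g \<otimes>\<^bsub>G\<^esub> h) x - tensor g (\<rho> J h x) |g h x. g \<in> carrier G \<and> h \<in> stab J \<and> x \<in> carrier (M J)}"
    then obtain g' h x where s: "s = tensor (g' \<otimes>\<^bsub>G\<^esub> h) x - tensor g' (\<rho> J h x)"
      "g' \<in> carrier G" "h \<in> stab J" "x \<in> carrier (M J)"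
      by blast
    have assoc: "g \<otimes>\<^bsub>G\<^esub> (g' \<otimes>\<^bsub>G\<^esub> h) = (g \<otimes>\<^bsub>G\<^esub> g') \<otimes>\<^bsub>G\<^esub> h"
      using s g by (simp add: stab_def G.m_assoc)
    show "left_mult g s \<in> rel J"
      unfolding s(1) sub lm assoc using s g by (intro rel_stab) auto
  qed
qed

lemma induced_action_coset:
  assumes "J \<in> I" "g \<in> carrier G"
  shows "induced_action G (stab J) (M J) (\<rho> J) g (coset (rel J) c) = coset (rel J) (left_mult g c)"
  unfolding induced_action_def
  by (rule quotient_map_induced_coset[OF rel_subspace rel_subspace lin_map_lin_extend left_mult_rel[OF assms]])

text \<open>
  The element \<open>g\<close> moves the representative for \<open>J'\<close> to another element of the coset for \<open>g J'\<close>, and the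
  correction by the stabiliser is absorbed by the tensor product.
\<close>

lemma formal_sum_act:
  assumes J: "J \<in> I" and g: "g \<in> carrier G" and f: "\<And>J'. J' \<in> I \<Longrightarrow> f J' \<in> carrier (M J')"
  shows "left_mult g (formal J (pullback J f)) - formal J (pullback J (sum_act g f)) \<in> rel J"
proof -
  have bij: "bij_betw (a g) (orb J) (orb J)"
  proof (rule bij_betw_byWitness[where f' = "a (inv\<^bsub>G\<^esub> g)"])
    show "\<forall>J'\<in>orb J. a (inv\<^bsub>G\<^esub> g) (a g J') = J'"
      using g orb_sub[OF J] a_inv by blast
    show "\<forall>J'\<in>orb J. a g (a (inv\<^bsub>G\<^esub> g) J') = J'"
      using g orb_sub[OF J] a_inv[of "inv\<^bsub>G\<^esub> g"] by auto
  qed (use g orb_mem[OF J] in auto)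
  have "left_mult g (formal J (pullback J f)) = (\<Sum>J'\<in>orb J. tensor (g \<otimes>\<^bsub>G\<^esub> transp J J') (pullback J f J'))"
    unfolding formal_def by (simp add: lin_map_sum[OF lin_map_lin_extend])
  moreover have "formal J (pullback J (sum_act g f))
      = (\<Sum>J'\<in>orb J. tensor (transp J (a g J')) (pullback J (sum_act g f) (a g J')))"
    unfolding formal_def by (rule sum.reindex_bij_betw[OF bij, symmetric])
  moreover have "tensor (g \<otimes>\<^bsub>G\<^esub> transp J J') (pullback J f J')
      - tensor (transp J (a g J')) (pullback J (sum_act g f) (a g J')) \<in> rel J" if J': "J' \<in> orb J" for J'
  proof -
    note t = transp[OF J']
    have J'I: "J' \<in> I" and gJ': "a g J' \<in> orb J" and gJ'I: "a g J' \<in> I"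
      using J' J orb_sub orb_mem[OF J J' g] by auto
    note t' = transp[OF gJ']
    let ?t = "transp J J'" and ?t' = "transp J (a g J')"
    have u: "g \<otimes>\<^bsub>G\<^esub> ?t \<in> carrier G" "a (g \<otimes>\<^bsub>G\<^esub> ?t) J = a g J'"
      using g t J a_mult by auto
    have invg: "a (inv\<^bsub>G\<^esub> g) (a g J') = J'"
      using a_inv[OF g J'I refl] .
    have fJ': "f J' \<in> carrier (M J')"
      using f J'I by blast
    have "\<rho> J (inv\<^bsub>G\<^esub> ?t' \<otimes>\<^bsub>G\<^esub> (g \<otimes>\<^bsub>G\<^esub> ?t)) (pullback J f J')
        = \<rho> J' (inv\<^bsub>G\<^esub> ?t' \<otimes>\<^bsub>G\<^esub> g) (\<rho> J ?t (pullback J f J'))"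
      using \<rho>_mult[of "inv\<^bsub>G\<^esub> ?t' \<otimes>\<^bsub>G\<^esub> g" ?t J "pullback J f J'"] t t' g J pullback_in[of J J' f, OF J J' fJ']
      by (simp add: G.m_assoc)
    also have "\<dots> = \<rho> J' (inv\<^bsub>G\<^esub> ?t' \<otimes>\<^bsub>G\<^esub> g) (f J')"
      by (simp add: \<rho>_pullback[of J J' f, OF J J' fJ'])
    also have "\<dots> = \<rho> (a g J') (inv\<^bsub>G\<^esub> ?t') (\<rho> J' g (f J'))"
      using \<rho>_mult[of "inv\<^bsub>G\<^esub> ?t'" g J' "f J'"] t' g J'I fJ' by simp
    also have "\<dots> = pullback J (sum_act g f) (a g J')"
      using gJ'I invg by (simp add: pullback_def sum_act_def)
    finally show ?thesis
      using tensor_normal[OF J u pullback_in[of J J' f, OF J J' fJ']] by simp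
  qed
  ultimately show ?thesis
    by (simp add: sum_subtractf[symmetric] lin_subspace_sum[OF rel_subspace])
qed

theorem sum_isomorphic_induced:
  assumes "group_ring_module ring_of_type_algebra G sum_mod sum_act"
  shows "group_ring_isomorphic ring_of_type_algebra G sum_mod sum_act
    sum_ind (direct_sum_action T (\<lambda>J. induced_action G (stab J) (M J) (\<rho> J)))"
proof (rule group_ring_isomorphic_via[OF assms to_induced_bij])
  have in_M: "f J \<in> carrier (M J)" if "f \<in> carrier sum_mod" "J \<in> I" for f J
    using that by (auto simp: carrier_sum_mod)
  have pull: "pullback J f J' \<in> carrier (M J)" if "f \<in> carrier sum_mod" "J \<in> I" "J' \<in> orb J" for f J J'
    using that in_M orb_sub by (intro pullback_in) auto
  show "to_induced (f \<oplus>\<^bsub>sum_mod\<^esub> f') = to_induced f \<oplus>\<^bsub>sum_ind\<^esub> to_induced f'"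
    if f: "f \<in> carrier sum_mod" "f' \<in> carrier sum_mod" for f f'
  proof -
    have "coset (rel J) (formal J (pullback J (f \<oplus>\<^bsub>sum_mod\<^esub> f')))
        = coset (rel J) (formal J (pullback J f)) \<oplus>\<^bsub>ind J\<^esub> coset (rel J) (formal J (pullback J f'))" if J: "J \<in> T" for J
    proof -
      have JI: "J \<in> I"
        using J T_sub by blast
      have "pullback J (f \<oplus>\<^bsub>sum_mod\<^esub> f') J' = pullback J f J' \<oplus>\<^bsub>M J\<^esub> pullback J f' J'" if J': "J' \<in> orb J" for J'
      proof -
        note t = transp[OF J']
        have "J' \<in> I"
          using J' JI orb_sub by blast
        then show ?thesis
          using \<rho>_add[of "inv\<^bsub>G\<^esub> (transp J J')" J' "f J'" "f' J'"] t in_M f a_inv[OF t(1) JI t(2)]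
          by (simp add: pullback_def direct_sum_module_def)
      qed
      then have "formal J (pullback J (f \<oplus>\<^bsub>sum_mod\<^esub> f')) - (formal J (pullback J f) + formal J (pullback J f')) \<in> rel J"
        using pull f JI by (intro formal_add) auto
      then show ?thesis
        unfolding induced_module_def add_quotient_module[OF rel_subspace] coset_eq_iff[OF rel_subspace] .
    qed
    then show ?thesis
      by (auto simp: to_induced_def direct_sum_module_def fun_eq_iff restrict_def)
  qed
  show "to_induced (r \<odot>\<^bsub>sum_mod\<^esub> f) = r \<odot>\<^bsub>sum_ind\<^esub> to_induced f"
    if f: "f \<in> carrier sum_mod" for r f
  proof -
    have "coset (rel J) (formal J (pullback J (r \<odot>\<^bsub>sum_mod\<^esub> f)))
        = r \<odot>\<^bsub>ind J\<^esub> coset (rel J) (formal J (pullback J f))" if J: "J \<in> T" for J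
    proof -
      have JI: "J \<in> I"
        using J T_sub by blast
      have "pullback J (r \<odot>\<^bsub>sum_mod\<^esub> f) J' = r \<odot>\<^bsub>M J\<^esub> pullback J f J'" if J': "J' \<in> orb J" for J'
      proof -
        note t = transp[OF J']
        have "J' \<in> I"
          using J' JI orb_sub by blast
        then show ?thesis
          using \<rho>_smult[of "inv\<^bsub>G\<^esub> (transp J J')" J' "f J'" r] t in_M f a_inv[OF t(1) JI t(2)]
          by (simp add: pullback_def direct_sum_module_def)
      qed
      then have "formal J (pullback J (r \<odot>\<^bsub>sum_mod\<^esub> f)) - lin_scale r (formal J (pullback J f)) \<in> rel J"
        using pull f JI by (intro formal_smult) auto
      then show ?thesis
        unfolding induced_module_def smult_quotient_module[OF rel_subspace] coset_eq_iff[OF rel_subspace] .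
    qed
    then show ?thesis
      by (auto simp: to_induced_def direct_sum_module_def fun_eq_iff restrict_def)
  qed
  show "to_induced \<zero>\<^bsub>sum_mod\<^esub> = \<zero>\<^bsub>sum_ind\<^esub>"
  proof -
    have "coset (rel J) (formal J (pullback J \<zero>\<^bsub>sum_mod\<^esub>)) = \<zero>\<^bsub>ind J\<^esub>" if J: "J \<in> T" for J
    proof -
      have JI: "J \<in> I"
        using J T_sub by blast
      interpret MJ: module ring_of_type_algebra "M J"
        by (rule M[OF JI])
      have "tensor (transp J J') (pullback J \<zero>\<^bsub>sum_mod\<^esub> J') \<in> rel J" if J': "J' \<in> orb J" for J'
      proof -
        note t = transp[OF J']
        have J'I: "J' \<in> I"
          using J' JI orb_sub by blast
        interpret MJ': module ring_of_type_algebra "M J'"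
          by (rule M[OF J'I])
        have zero: "0 \<odot>\<^bsub>M J'\<^esub> \<zero>\<^bsub>M J'\<^esub> = \<zero>\<^bsub>M J'\<^esub>"
          using MJ'.smult_l_null[of "\<zero>\<^bsub>M J'\<^esub>"] by simp
        have in_J: "\<rho> J' (inv\<^bsub>G\<^esub> (transp J J')) \<zero>\<^bsub>M J'\<^esub> \<in> carrier (M J)"
          using \<rho>_in[of "inv\<^bsub>G\<^esub> (transp J J')" J' "\<zero>\<^bsub>M J'\<^esub>"] t J'I a_inv[OF t(1) JI t(2)] by simp
        have "\<rho> J' (inv\<^bsub>G\<^esub> (transp J J')) (0 \<odot>\<^bsub>M J'\<^esub> \<zero>\<^bsub>M J'\<^esub>) = 0 \<odot>\<^bsub>M J\<^esub> \<rho> J' (inv\<^bsub>G\<^esub> (transp J J')) \<zero>\<^bsub>M J'\<^esub>"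
          using \<rho>_smult[of "inv\<^bsub>G\<^esub> (transp J J')" J' "\<zero>\<^bsub>M J'\<^esub>" 0] t J'I a_inv[OF t(1) JI t(2)] by simp
        also have "\<dots> = \<zero>\<^bsub>M J\<^esub>"
          using MJ.smult_l_null[OF in_J] by simp
        finally have "pullback J \<zero>\<^bsub>sum_mod\<^esub> J' = \<zero>\<^bsub>M J\<^esub>"
          using J'I by (simp add: pullback_def direct_sum_module_def zero)
        then show ?thesis
          using rel_zero[OF JI t(1)] by simp
      qed
      then have "formal J (pullback J \<zero>\<^bsub>sum_mod\<^esub>) \<in> rel J"
        unfolding formal_def by (rule lin_subspace_sum[OF rel_subspace])
      then show ?thesis
        unfolding induced_module_def zero_quotient_module coset_eq_iff[OF rel_subspace] by simp
    qed
    then show ?thesis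
      by (auto simp: to_induced_def direct_sum_module_def fun_eq_iff restrict_def)
  qed
  show "to_induced (sum_act g f) = direct_sum_action T (\<lambda>J. induced_action G (stab J) (M J) (\<rho> J)) g (to_induced f)"
    if g: "g \<in> carrier G" and f: "f \<in> carrier sum_mod" for g f
  proof -
    have "coset (rel J) (formal J (pullback J (sum_act g f)))
        = induced_action G (stab J) (M J) (\<rho> J) g (coset (rel J) (formal J (pullback J f)))" if J: "J \<in> T" for J
    proof -
      have JI: "J \<in> I"
        using J T_sub by blast
      show ?thesis
        unfolding induced_action_coset[OF JI g]
        by (rule coset_eq_iff[OF rel_subspace, THEN iffD2, OF formal_sum_act[OF JI g in_M[OF f]], symmetric])
    qed
    then show ?thesis
      by (auto simp: to_induced_def direct_sum_action_def fun_eq_iff restrict_def)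
  qed
qed

end


section \<open>Polyhedral products and polyhedral smash products\<close>

text \<open>
  The homotopy \<open>h\<close> contracts the neighbourhood \<open>U\<close> of the base point, relative to it and within \<open>A\<close>.
\<close>

locale polyhedral =
  fixes X :: "'a topology" and A :: "'a set" and pt :: 'a and V :: "'v set" and K :: "'v set set"
    and h :: "real \<times> 'a \<Rightarrow> 'a" and U :: "'a set"
  assumes finite_V: "finite V" and K: "simplicial_complex_on V K"
    and Hausdorff: "Hausdorff_space X" and A: "closedin X A" and pt_A: "pt \<in> A"
    and h: "continuous_map (prod_topology (top_of_set {0..1::real}) X) X h"
    and U: "openin X U" and pt_U: "pt \<in> U"
    and h_0: "x \<in> topspace X \<Longrightarrow> h (0, x) = x" and h_pt: "h (t, pt) = pt"
    and h_U: "x \<in> U \<Longrightarrow> h (1, x) = pt" and h_A: "\<lbrakk>t \<in> {0..1}; x \<in> A\<rbrakk> \<Longrightarrow> h (t, x) \<in> A"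
begin

abbreviation Y :: "('v \<Rightarrow> 'a) topology"
  where "Y \<equiv> polyhedral_product X A V K"

abbreviation power :: "'v set \<Rightarrow> ('v \<Rightarrow> 'a) topology"
  where "power J \<equiv> product_topology (\<lambda>_. X) J"

definition smash :: "'v set \<Rightarrow> ('v \<Rightarrow> 'a) topology"
  where "smash J = polyhedral_smash X A pt J (full_subcomplex K J)"

definition retract :: "'v set \<Rightarrow> ('v \<Rightarrow> 'a) \<Rightarrow> 'v \<Rightarrow> 'a"
  where "retract L x = (\<lambda>v. if v \<in> L then x v else if v \<in> V then pt else undefined)"

definition proj :: "'v set \<Rightarrow> ('v \<Rightarrow> 'a) \<Rightarrow> 'v \<Rightarrow> 'a"
  where "proj J x = collapse_fat_wedge pt J (restrict x J)"

definition base :: "'v \<Rightarrow> 'a"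
  where "base = (\<lambda>v\<in>V. pt)"

definition homotopy :: "real \<times> ('v \<Rightarrow> 'a) \<Rightarrow> 'v \<Rightarrow> 'a"
  where "homotopy = (\<lambda>(t, x). \<lambda>v\<in>V. h (t, x v))"

lemma pt_X: "pt \<in> topspace X"
  using A pt_A closedin_subset by blast

lemma K_empty: "{} \<in> K" and K_sub: "\<sigma> \<in> K \<Longrightarrow> \<sigma> \<subseteq> V"
  using K by (auto simp: simplicial_complex_on_def)

lemma finite_K: "finite K"
  using K_sub finite_V by (meson Pow_iff finite_Pow_iff finite_subset subsetI)

lemma topspace_Y: "x \<in> topspace Y \<longleftrightarrow> x \<in> extensional V \<and> (\<forall>v\<in>V. x v \<in> topspace X) \<and> (\<exists>\<sigma>\<in>K. \<forall>j\<in>V - \<sigma>. x j \<in> A)"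
  by (auto simp: polyhedral_product_def PiE_iff)

lemma topspace_smash:
  "y \<in> topspace (smash J) \<longleftrightarrow> y \<in> collapse_fat_wedge pt J ` topspace (power J) \<and> (\<exists>\<sigma>\<in>K. \<forall>j\<in>J - \<sigma>. y j \<in> A)"
proof -
  have "full_subcomplex K J = (\<lambda>\<sigma>. \<sigma> \<inter> J) ` K" and "J - \<sigma> \<inter> J = J - \<sigma>" for \<sigma>
    by (auto simp: full_subcomplex_def)
  then show ?thesis
    by (simp add: smash_def polyhedral_smash_def smash_power_def)
qed

lemma closedin_INT_in:
  assumes "closedin Z C" "\<And>i. i \<in> I \<Longrightarrow> closedin Z (D i)"
  shows "closedin Z (C \<inter> (\<Inter>i\<in>I. D i))"
proof (cases "I = {}")
  case False
  then have "closedin Z (\<Inter>i\<in>I. D i)"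
    using assms(2) by (intro closedin_Inter) auto
  then show ?thesis
    using assms(1) by (rule closedin_Int[rotated])
qed (simp add: assms(1))

lemma closedin_Y: "closedin (power V) (topspace Y)"
proof -
  have coord: "closedin (power V) {x \<in> topspace (power V). x j \<in> A}" if "j \<in> V" for j
    using that A by (intro closedin_continuous_map_preimage[OF continuous_map_product_projection]) auto
  have "closedin (power V) (topspace (power V) \<inter> (\<Inter>j\<in>V - \<sigma>. {x \<in> topspace (power V). x j \<in> A}))" for \<sigma>
    by (rule closedin_INT_in[OF closedin_topspace]) (use coord in auto)
  then have "closedin (power V) (\<Union>\<sigma>\<in>K. topspace (power V) \<inter> (\<Inter>j\<in>V - \<sigma>. {x \<in> topspace (power V). x j \<in> A}))"
    using finite_K by (intro closedin_Union) auto
  moreover have "(\<Union>\<sigma>\<in>K. topspace (power V) \<inter> (\<Inter>j\<in>V - \<sigma>. {x \<in> topspace (power V). x j \<in> A})) = topspace Y"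
    by (auto simp: polyhedral_product_def)
  ultimately show ?thesis
    by simp
qed

lemma continuous_coord: "v \<in> V \<Longrightarrow> continuous_map Y X (\<lambda>x. x v)"
  unfolding polyhedral_product_def
  by (intro continuous_map_from_subtopology continuous_map_product_projection)

lemma continuous_into_Y:
  assumes "\<And>v. v \<in> V \<Longrightarrow> continuous_map Z X (\<lambda>z. f z v)"
    and "\<And>z. z \<in> topspace Z \<Longrightarrow> f z \<in> extensional V \<and> (\<exists>\<sigma>\<in>K. \<forall>j\<in>V - \<sigma>. f z j \<in> A)"
  shows "continuous_map Z Y f"
  unfolding polyhedral_product_def continuous_map_in_subtopology continuous_map_componentwise
  using assms by auto

lemma retract_comp: "\<lbrakk>J \<subseteq> V; L \<subseteq> V\<rbrakk> \<Longrightarrow> retract J (retract L x) = retract (J \<inter> L) x"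
  by (auto simp: retract_def fun_eq_iff)

lemma retract_cont:
  assumes "J \<subseteq> V"
  shows "continuous_map Y Y (retract J)"
proof (rule continuous_into_Y)
  show "continuous_map Y X (\<lambda>x. retract J x v)" if "v \<in> V" for v
    using that continuous_coord[of v] pt_X by (cases "v \<in> J") (simp_all add: retract_def)
  fix x
  assume "x \<in> topspace Y"
  then obtain \<sigma> where \<sigma>: "\<sigma> \<in> K" "\<forall>j\<in>V - \<sigma>. x j \<in> A"
    by (auto simp: topspace_Y)
  have "\<forall>j\<in>V - \<sigma>. retract J x j \<in> A"
    using \<sigma>(2) pt_A by (simp add: retract_def)
  moreover have "retract J x \<in> extensional V"
    using assms by (auto simp: retract_def extensional_def)
  ultimately show "retract J x \<in> extensional V \<and> (\<exists>\<sigma>\<in>K. \<forall>j\<in>V - \<sigma>. retract J x j \<in> A)"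
    using \<sigma>(1) by blast
qed

lemma retract_fixed_iff: "x \<in> topspace Y \<Longrightarrow> J \<subseteq> V \<Longrightarrow> retract J x = x \<longleftrightarrow> (\<forall>v\<in>V - J. x v = pt)"
  by (auto simp: retract_def fun_eq_iff topspace_Y extensional_def)

lemma base_Y: "base \<in> topspace Y"
  using pt_X pt_A K_empty by (auto simp: topspace_Y base_def)

lemma proj_base: "J \<noteq> {} \<Longrightarrow> proj J base = (\<lambda>j\<in>J. pt)" if "J \<subseteq> V"
  using that by (auto simp: proj_def collapse_fat_wedge_def base_def)

lemma proj_wedge: "\<lbrakk>j \<in> J; x j = pt\<rbrakk> \<Longrightarrow> proj J x = (\<lambda>j\<in>J. pt)"
  by (auto simp: proj_def collapse_fat_wedge_def)

lemma proj_off_wedge: "(\<And>j. j \<in> J \<Longrightarrow> x j \<noteq> pt) \<Longrightarrow> proj J x = restrict x J"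
  by (auto simp: proj_def collapse_fat_wedge_def)

lemma proj_eq_base_iff:
  assumes "J \<noteq> {}"
  shows "proj J x = (\<lambda>j\<in>J. pt) \<longleftrightarrow> (\<exists>j\<in>J. x j = pt)"
proof (cases "\<exists>j\<in>J. x j = pt")
  case True
  then obtain j where "j \<in> J" "x j = pt"
    by blast
  then have "proj J x = (\<lambda>j\<in>J. pt)"
    by (rule proj_wedge)
  with True show ?thesis
    by simp
next
  case False
  obtain j where "j \<in> J"
    using assms by blast
  then show ?thesis
    using False proj_off_wedge[of J x] by (auto simp: fun_eq_iff restrict_def)
qed

lemma continuous_proj:
  assumes J: "J \<subseteq> V"
  shows "continuous_map Y (smash J) (proj J)"
proof -
  have "continuous_map Y (power J) (\<lambda>x. restrict x J)"
    unfolding continuous_map_componentwise using continuous_coord J by auto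
  moreover have "continuous_map (power J) (smash_power X pt J) (collapse_fat_wedge pt J)"
    unfolding smash_power_def by (rule quotient_imp_continuous_map[OF quotient_map_quotient_topology])
  ultimately have "continuous_map Y (smash_power X pt J) (collapse_fat_wedge pt J \<circ> (\<lambda>x. restrict x J))"
    by (rule continuous_map_compose)
  moreover have "collapse_fat_wedge pt J \<circ> (\<lambda>x. restrict x J) = proj J"
    by (auto simp: proj_def)
  moreover have "\<exists>\<sigma>\<in>full_subcomplex K J. \<forall>j\<in>J - \<sigma>. proj J x j \<in> A" if x: "x \<in> topspace Y" for x
  proof -
    obtain \<sigma> where \<sigma>: "\<sigma> \<in> K" "\<forall>j\<in>V - \<sigma>. x j \<in> A"
      using x by (auto simp: topspace_Y)
    have "proj J x j \<in> A" if "j \<in> J - \<sigma> \<inter> J" for j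
      using that \<sigma>(2) J pt_A by (auto simp: proj_def collapse_fat_wedge_def)
    then show ?thesis
      using \<sigma>(1) by (intro bexI[of _ "\<sigma> \<inter> J"]) (auto simp: full_subcomplex_def)
  qed
  ultimately show ?thesis
    unfolding smash_def polyhedral_smash_def by (auto simp: continuous_map_in_subtopology)
qed

lemma proj_retract: "J \<subseteq> V \<Longrightarrow> proj J (retract J x) = proj J x"
proof -
  have "restrict (retract J x) J = restrict x J"
    by (auto simp: retract_def)
  then show ?thesis
    by (simp add: proj_def)
qed

lemma closed_fat_wedge:
  assumes J: "finite J"
  shows "closedin (power J) {x \<in> topspace (power J). \<exists>j\<in>J. x j = pt}"
proof -
  have "closedin X {pt}"
    using Hausdorff pt_X by (simp add: closedin_Hausdorff_singleton)
  then have "closedin (power J) {x \<in> topspace (power J). x j \<in> {pt}}" if "j \<in> J" for j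
    using that by (intro closedin_continuous_map_preimage[OF continuous_map_product_projection])
  then have "closedin (power J) (\<Union>j\<in>J. {x \<in> topspace (power J). x j \<in> {pt}})"
    using J by (intro closedin_Union) auto
  moreover have "(\<Union>j\<in>J. {x \<in> topspace (power J). x j \<in> {pt}}) = {x \<in> topspace (power J). \<exists>j\<in>J. x j = pt}"
    by auto
  ultimately show ?thesis
    by simp
qed

text \<open>Collapsing a closed subset to a point is a closed map.\<close>

lemma closed_map_collapse:
  assumes J: "finite J"
  shows "closed_map (power J) (smash_power X pt J) (collapse_fat_wedge pt J)"
  unfolding closed_map_def
proof (intro allI impI)
  fix D
  assume D: "closedin (power J) D"
  let ?W = "{x \<in> topspace (power J). \<exists>j\<in>J. x j = pt}"
  let ?c = "collapse_fat_wedge pt J"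
  have D_sub: "D \<subseteq> topspace (power J)"
    using D by (rule closedin_subset)
  have wedge: "?c x \<noteq> ?c y" if xy: "x \<in> ?W" "y \<in> topspace (power J) - ?W" for x y
  proof -
    obtain j where j: "j \<in> J" "x j = pt"
      using xy(1) by auto
    then have "?c x j = pt"
      by (auto simp: collapse_fat_wedge_def)
    moreover have "?c y j \<noteq> pt"
      using xy j by (auto simp: collapse_fat_wedge_def)
    ultimately show ?thesis
      by metis
  qed
  have off: "x = y" if "x \<in> topspace (power J) - ?W" "y \<in> topspace (power J) - ?W" "?c x = ?c y" for x y
    using that by (auto simp: collapse_fat_wedge_def split: if_splits)
  have on: "?c x = ?c y" if "x \<in> ?W" "y \<in> ?W" for x y
    using that by (auto simp: collapse_fat_wedge_def)
  have "{x \<in> topspace (power J). ?c x \<in> ?c ` D} = (if D \<inter> ?W = {} then D else D \<union> ?W)" (is "?L = ?R")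
  proof (intro equalityI subsetI)
    fix x
    assume "x \<in> ?L"
    then obtain y where x: "x \<in> topspace (power J)" and y: "y \<in> D" "?c x = ?c y"
      by blast
    have y_in: "y \<in> topspace (power J)"
      using y(1) D_sub by blast
    show "x \<in> ?R"
    proof (cases "x \<in> ?W")
      case True
      then have "y \<in> ?W"
        using wedge[OF True, of y] y_in y(2) by blast
      then have "D \<inter> ?W \<noteq> {}"
        using y(1) by blast
      then show ?thesis
        using True by simp
    next
      case False
      then have "y \<notin> ?W"
        using wedge[of y x] x y(2) by auto
      then have "x = y"
        using off[of x y] x y_in False y(2) by blast
      then show ?thesis
        using y(1) by simp
    qed
  next
    fix x
    assume x: "x \<in> ?R"
    show "x \<in> ?L"
    proof (cases "x \<in> D")
      case True
      then show ?thesis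
        using D_sub by blast
    next
      case False
      then obtain y where "y \<in> D" "y \<in> ?W" and xW: "x \<in> ?W"
        using x by (auto split: if_splits)
      then have "?c x = ?c y"
        using on by blast
      then show ?thesis
        using \<open>y \<in> D\<close> xW by blast
    qed
  qed
  then have "closedin (power J) {x \<in> topspace (power J). ?c x \<in> ?c ` D}"
    using D closed_fat_wedge[OF J] by (simp add: closedin_Un)
  moreover have "?c ` D \<subseteq> topspace (smash_power X pt J)"
    using D_sub by (auto simp: smash_power_def)
  ultimately show "closedin (smash_power X pt J) (?c ` D)"
    using quotient_map_quotient_topology[of "power J" ?c] unfolding quotient_map_closedin smash_power_def[symmetric]
    by simp
qed

abbreviation part_top :: "'v set \<Rightarrow> ('v \<Rightarrow> 'a) topology"
  where "part_top J \<equiv> subtopology Y {x. retract J x = x}"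

lemma part_iff: "J \<subseteq> V \<Longrightarrow> x \<in> topspace (part_top J) \<longleftrightarrow> x \<in> topspace Y \<and> (\<forall>v\<in>V - J. x v = pt)"
  using retract_fixed_iff[of x J] by auto

lemma proj_image:
  assumes J: "J \<subseteq> V" "J \<noteq> {}"
  shows "proj J ` topspace (part_top J) = topspace (smash J)"
proof (intro equalityI subsetI)
  fix y
  assume "y \<in> proj J ` topspace (part_top J)"
  then show "y \<in> topspace (smash J)"
    using continuous_map_image_subset_topspace[OF continuous_proj[OF J(1)]] by auto
next
  fix y
  assume "y \<in> topspace (smash J)"
  then obtain x \<sigma> where x: "x \<in> topspace (power J)" "y = collapse_fat_wedge pt J x"
    and \<sigma>: "\<sigma> \<in> K" "\<forall>j\<in>J - \<sigma>. y j \<in> A"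
    by (auto simp: topspace_smash)
  show "y \<in> proj J ` topspace (part_top J)"
  proof (cases "\<exists>j\<in>J. x j = pt")
    case True
    then have "y = proj J base"
      using x(2) J by (simp add: proj_base collapse_fat_wedge_def)
    moreover have "base \<in> topspace (part_top J)"
      using base_Y unfolding part_iff[OF J(1)] by (simp add: base_def)
    ultimately show ?thesis
      by (rule image_eqI)
  next
    case False
    then have y: "y = x"
      using x(2) by (auto simp: collapse_fat_wedge_def)
    have x_J: "x v \<in> topspace X" if "v \<in> J" for v
      using x(1) that by auto
    have x_ext: "restrict x J = x"
      using x(1) by (simp add: PiE_def extensional_restrict)
    let ?x = "retract J x"
    have "?x \<in> extensional V"
      using J by (auto simp: retract_def extensional_def)
    moreover have "\<forall>v\<in>V. ?x v \<in> topspace X"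
      using x_J pt_X by (simp add: retract_def)
    moreover have "\<forall>j\<in>V - \<sigma>. ?x j \<in> A"
      using \<sigma>(2) y pt_A by (simp add: retract_def)
    ultimately have "?x \<in> topspace Y"
      using \<sigma>(1) unfolding topspace_Y by blast
    then have in_part: "?x \<in> topspace (part_top J)"
      unfolding part_iff[OF J(1)] by (simp add: retract_def)
    have "y = proj J ?x"
      unfolding proj_retract[OF J(1)] using y x x_ext by (simp add: proj_def)
    then show ?thesis
      using in_part by (rule image_eqI)
  qed
qed

lemma closed_fixed:
  assumes J: "J \<subseteq> V"
  shows "closedin (power V) (topspace (part_top J))"
proof -
  have "closedin X {pt}"
    using Hausdorff pt_X by (simp add: closedin_Hausdorff_singleton)
  then have "closedin (power V) {x \<in> topspace (power V). x v \<in> {pt}}" if "v \<in> V" for v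
    using that by (intro closedin_continuous_map_preimage[OF continuous_map_product_projection])
  then have "closedin (power V) (topspace Y \<inter> (\<Inter>v\<in>V - J. {x \<in> topspace (power V). x v \<in> {pt}}))"
    by (intro closedin_INT_in[OF closedin_Y]) auto
  moreover have "topspace Y \<inter> (\<Inter>v\<in>V - J. {x \<in> topspace (power V). x v \<in> {pt}}) = topspace (part_top J)"
  proof -
    have "x \<in> topspace (power V)" if "x \<in> topspace Y" for x
      using that closedin_subset[OF closedin_Y] by blast
    then show ?thesis
      using part_iff[OF J] by auto
  qed
  ultimately show ?thesis
    by simp
qed

text \<open>
  The image of a closed set of tuples on \<open>V\<close> is the collapse of a closed set of tuples on \<open>J\<close>, namely of
  those whose extension by the base point lies in the set.
\<close>

lemma proj_closed_map:
  assumes J: "J \<subseteq> V" "J \<noteq> {}"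
  shows "closed_map (part_top J) (smash J) (proj J)"
  unfolding closed_map_def
proof (intro allI impI)
  fix D
  assume D: "closedin (part_top J) D"
  have D_sub: "D \<subseteq> topspace (part_top J)"
    using D by (rule closedin_subset)
  have part_eq: "part_top J = subtopology (power V) (topspace (part_top J))"
    using closedin_subset[OF closed_fixed[OF J(1)]]
    unfolding polyhedral_product_def subtopology_subtopology topspace_subtopology
    by (subst subtopology_restrict) (simp add: Int_ac)
  have D': "closedin (power V) D"
    using arg_cong[where f = "\<lambda>T. closedin T D", OF part_eq, THEN iffD1, OF D]
    by (rule closedin_closed_subtopology[OF closed_fixed[OF J(1)], THEN iffD1, THEN conjunct1])
  have "continuous_map (power J) (power V) (retract J)"
    unfolding continuous_map_componentwise
  proof (intro conjI ballI)
    show "retract J ` topspace (power J) \<subseteq> extensional V"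
      using J by (auto simp: retract_def extensional_def)
    show "continuous_map (power J) X (\<lambda>x. retract J x v)" if "v \<in> V" for v
      using that pt_X continuous_map_product_projection[of v J "\<lambda>_. X"]
      by (cases "v \<in> J") (simp_all add: retract_def)
  qed
  from closedin_continuous_map_preimage[OF this D']
  have "closedin (smash_power X pt J) (collapse_fat_wedge pt J ` {x \<in> topspace (power J). retract J x \<in> D})"
    using closed_map_collapse[OF finite_subset[OF J(1) finite_V]] by (simp add: closed_map_def)
  moreover have "collapse_fat_wedge pt J ` {x \<in> topspace (power J). retract J x \<in> D} = proj J ` D"
  proof (intro equalityI subsetI)
    fix y
    assume "y \<in> collapse_fat_wedge pt J ` {x \<in> topspace (power J). retract J x \<in> D}"
    then obtain x where x: "x \<in> topspace (power J)" "retract J x \<in> D" "y = collapse_fat_wedge pt J x"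
      by blast
    have "restrict x J = x"
      using x(1) by (simp add: PiE_def extensional_restrict)
    then have "y = proj J (retract J x)"
      using x(3) unfolding proj_retract[OF J(1)] by (simp add: proj_def)
    then show "y \<in> proj J ` D"
      using x(2) by (rule image_eqI)
  next
    fix y
    assume "y \<in> proj J ` D"
    then obtain x where x: "x \<in> D" "y = proj J x"
      by blast
    then have xY: "x \<in> topspace Y" "retract J x = x"
      using D_sub by auto
    have "retract J (restrict x J) = retract J x"
      by (auto simp: retract_def)
    then have "retract J (restrict x J) \<in> D"
      using xY x by simp
    moreover have "restrict x J \<in> topspace (power J)"
      using xY(1) J by (auto simp: topspace_Y)
    ultimately show "y \<in> collapse_fat_wedge pt J ` {x \<in> topspace (power J). retract J x \<in> D}"
      unfolding x(2) proj_def by blast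
  qed
  moreover have "proj J ` D \<subseteq> topspace (smash J)"
    using D_sub proj_image[OF J] by blast
  ultimately show "closedin (smash J) (proj J ` D)"
    unfolding smash_def polyhedral_smash_def
    by (intro closedin_subset_topspace) auto
qed

lemma proj_quotient_map:
  assumes J: "J \<subseteq> V" "J \<noteq> {}"
  shows "quotient_map (part_top J) (smash J) (proj J)"
  using continuous_map_from_subtopology[OF continuous_proj[OF J(1)]] proj_closed_map[OF J] proj_image[OF J]
  by (rule continuous_closed_imp_quotient_map)

lemma homotopy_cont_Y: "continuous_map (prod_topology (top_of_set {0..1}) Y) Y homotopy"
proof (rule continuous_into_Y)
  let ?P = "prod_topology (top_of_set {0..1::real}) Y"
  show "continuous_map ?P X (\<lambda>z. homotopy z v)" if v: "v \<in> V" for v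
  proof -
    have "continuous_map ?P X (\<lambda>z. snd z v)"
      using continuous_map_compose[OF continuous_map_snd continuous_coord[OF v]] by (simp add: comp_def)
    then have "continuous_map ?P (prod_topology (top_of_set {0..1}) X) (\<lambda>z. (fst z, snd z v))"
      unfolding continuous_map_pairwise comp_def using continuous_map_fst by simp
    from continuous_map_compose[OF this h] show ?thesis
      using v by (simp add: comp_def homotopy_def case_prod_unfold)
  qed
  fix z
  assume z: "z \<in> topspace ?P"
  then obtain \<sigma> where \<sigma>: "\<sigma> \<in> K" "\<forall>j\<in>V - \<sigma>. snd z j \<in> A" and t: "fst z \<in> {0..1}"
    by (auto simp: topspace_Y)
  have "\<forall>j\<in>V - \<sigma>. homotopy z j \<in> A"
    using \<sigma>(2) h_A[OF t] by (simp add: homotopy_def case_prod_unfold)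
  then show "homotopy z \<in> extensional V \<and> (\<exists>\<sigma>\<in>K. \<forall>j\<in>V - \<sigma>. homotopy z j \<in> A)"
    using \<sigma>(1) by (auto simp: homotopy_def case_prod_unfold)
qed

lemma homotopy_Y: "\<lbrakk>t \<in> {0..1}; x \<in> topspace Y\<rbrakk> \<Longrightarrow> homotopy (t, x) \<in> topspace Y"
  using continuous_map_image_subset_topspace[OF homotopy_cont_Y] by (auto simp: image_subset_iff)

lemma homotopy_fixed:
  assumes "J \<subseteq> V" "x \<in> topspace Y" "retract J x = x" "t \<in> {0..1}"
  shows "retract J (homotopy (t, x)) = homotopy (t, x)"
  using retract_fixed_iff[OF homotopy_Y[OF assms(4,2)] assms(1)] retract_fixed_iff[OF assms(2,1)] assms(3) h_pt
  by (simp add: homotopy_def)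

lemma homotopy_cont_part:
  assumes J: "J \<subseteq> V"
  shows "continuous_map (prod_topology (top_of_set {0..1}) (part_top J)) (part_top J) homotopy"
proof -
  have "prod_topology (top_of_set {0..1::real}) (part_top J)
      = subtopology (prod_topology (top_of_set {0..1}) Y) (UNIV \<times> {x. retract J x = x})"
    by (metis subtopology_Times subtopology_UNIV)
  moreover have "homotopy z \<in> {x. retract J x = x}"
    if "z \<in> topspace (prod_topology (top_of_set {0..1::real}) (part_top J))" for z
    using that homotopy_fixed[OF J, of "snd z" "fst z"] by auto
  ultimately show ?thesis
    using continuous_map_from_subtopology[OF homotopy_cont_Y]
    by (auto simp: continuous_map_in_subtopology Pi_iff)
qed

text \<open>
  The face without \<open>j\<close> consists of the tuples whose coordinate at \<open>j\<close> is the base point; it has a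
  neighbourhood of tuples whose coordinate at \<open>j\<close> lies in \<open>U\<close>. The homotopy contracts all coordinates at the
  same time, so it respects all faces.
\<close>

lemma collapse_part:
  assumes J: "J \<subseteq> V" "J \<noteq> {}"
  shows "collapse (part_top J) (smash J) (proj J) J (\<lambda>j. {x. retract (J - {j}) x = x})
    (\<lambda>j. {x \<in> topspace Y. retract J x = x} \<inter> {x. x j \<in> U}) homotopy (proj J base)"
proof
  have sub: "J - {j} \<subseteq> V" for j
    using J by blast
  have face: "retract (J - {j}) x = x \<longleftrightarrow> x j = pt"
    if "j \<in> J" "x \<in> topspace (part_top J)" for j x
    using that J part_iff[OF J(1), of x] retract_fixed_iff[of x "J - {j}"] sub by auto
  have base_eq: "proj J base = (\<lambda>j\<in>J. pt)"
    using J by (rule proj_base)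
  have z_iff: "proj J x = proj J base \<longleftrightarrow> (\<exists>j\<in>J. x j = pt)" for x
    unfolding base_eq by (rule proj_eq_base_iff[OF J(2)])
  show "quotient_map (part_top J) (smash J) (proj J)"
    by (rule proj_quotient_map[OF J])
  show "x = y \<or> proj J x = proj J base"
    if x: "x \<in> topspace (part_top J)" and y: "y \<in> topspace (part_top J)" and eq: "proj J x = proj J y" for x y
  proof (rule disjCI)
    assume ne: "proj J x \<noteq> proj J base"
    have "restrict x J = restrict y J"
      using ne eq z_iff[of x] z_iff[of y] proj_off_wedge[of J x] proj_off_wedge[of J y] by metis
    then have "retract J x = retract J y"
      by (auto simp: retract_def fun_eq_iff restrict_def) metis+
    then show "x = y"
      using x y by auto
  qed
  show "proj J x = proj J base \<longleftrightarrow> (\<exists>j\<in>J. x \<in> {x. retract (J - {j}) x = x})" if "x \<in> topspace (part_top J)" for x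
    unfolding z_iff using face that by auto
  show "proj J base \<in> topspace (smash J)"
    using continuous_map_image_subset_topspace[OF continuous_proj[OF J(1)]] base_Y by blast
  have coord: "continuous_map (part_top J) X (\<lambda>x. x j)" if "j \<in> J" for j
    using that J continuous_coord by (intro continuous_map_from_subtopology) auto
  have "closedin X {pt}"
    using Hausdorff pt_X by (simp add: closedin_Hausdorff_singleton)
  then have "closedin (part_top J) {x \<in> topspace (part_top J). x j \<in> {pt}}" if "j \<in> J" for j
    by (rule closedin_continuous_map_preimage[OF coord[OF that]])
  then have "closedin (part_top J) (\<Union>j\<in>J. {x \<in> topspace (part_top J). x j \<in> {pt}})"
    using finite_subset[OF J(1) finite_V] by (intro closedin_Union) auto
  moreover have "(\<Union>j\<in>J. {x \<in> topspace (part_top J). x j \<in> {pt}}) = {x \<in> topspace (part_top J). proj J x = proj J base}"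
    unfolding z_iff by auto
  ultimately show "closedin (part_top J) {x \<in> topspace (part_top J). proj J x = proj J base}"
    by simp
  show "openin (part_top J) ({x \<in> topspace Y. retract J x = x} \<inter> {x. x j \<in> U})" if "j \<in> J" for j
  proof -
    have "{x \<in> topspace Y. retract J x = x} \<inter> {x. x j \<in> U} = {x \<in> topspace (part_top J). x j \<in> U}"
      by auto
    then show ?thesis
      using openin_continuous_map_preimage[OF coord[OF that] U] by simp
  qed
  show "{x. retract (J - {j}) x = x} \<inter> topspace (part_top J) \<subseteq> {x \<in> topspace Y. retract J x = x} \<inter> {x. x j \<in> U}"
    if "j \<in> J" for j
    using face[OF that] pt_U by auto
  show "continuous_map (prod_topology (top_of_set {0..1}) (part_top J)) (part_top J) homotopy"
    by (rule homotopy_cont_part[OF J(1)])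
  show "homotopy (0, x) = x" if "x \<in> topspace (part_top J)" for x
    using that h_0 by (auto simp: homotopy_def topspace_Y fun_eq_iff extensional_def)
  show "homotopy (t, x) \<in> {x. retract (J - {j}) x = x}"
    if "j \<in> J" "x \<in> {x. retract (J - {j}) x = x} \<inter> topspace (part_top J)" "t \<in> {0..1}" for j x t
    using that homotopy_fixed[OF sub, of x j t] by auto
  show "homotopy (1, x) \<in> {x. retract (J - {j}) x = x}"
    if j: "j \<in> J" and x: "x \<in> {x \<in> topspace Y. retract J x = x} \<inter> {x. x j \<in> U}" for j x
  proof -
    have "homotopy (1, x) \<in> topspace (part_top J)"
      using x homotopy_Y[of 1 x] homotopy_fixed[OF J(1), of x 1] by auto
    moreover have "homotopy (1, x) j = pt"
      using x j J h_U by (auto simp: homotopy_def)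
    ultimately show ?thesis
      using face[OF j] by simp
  qed
qed

lemma splitting_Y: "splitting Y V retract smash proj (\<lambda>j. {x. x j \<in> U}) homotopy base"
proof (rule splitting.intro)
  show "retract V x = x" if "x \<in> topspace Y" for x
    using retract_fixed_iff[OF that] by simp
  show "retract {} x = base" for x
    by (auto simp: retract_def base_def)
  show "collapse (part_top J) (smash J) (proj J) J (\<lambda>j. {x. retract (J - {j}) x = x})
      (\<lambda>j. {x \<in> topspace Y. retract J x = x} \<inter> {x. x j \<in> U}) homotopy (proj J base)"
    if "J \<subseteq> V" "J \<noteq> {}" for J
    by (rule collapse_part[OF that])
qed (simp_all add: finite_V retract_cont retract_comp base_Y continuous_proj proj_retract)

end


section \<open>Reduced homology as a functor\<close>

lemma lin_subspace_reduced_cycles: "lin_subspace (reduced_cycles p Z)"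
  unfolding lin_subspace_def using reduced_cycles_zero reduced_cycles_add reduced_cycles_scale by blast

lemma lin_subspace_boundaries: "lin_subspace (boundaries p Z)"
  unfolding lin_subspace_def using boundaries_zero boundaries_add boundaries_scale by blast

lemma module_reduced_homology:
  "module ring_of_type_algebra (reduced_homology p Z :: ('k::comm_ring_1, ('a, 'k) lin_chain set) module)"
  unfolding reduced_homology_def
  by (rule module_quotient_module[OF lin_subspace_reduced_cycles lin_subspace_boundaries])

lemma carrier_reduced_homology: "carrier (reduced_homology p Z) = coset (boundaries p Z) ` reduced_cycles p Z"
  by (simp add: reduced_homology_def carrier_quotient_module)

lemma reduced_homology_map_coset:
  fixes c :: "('a, 'k::comm_ring_1) lin_chain"
  assumes "continuous_map Z W f"
  shows "reduced_homology_map p W f (coset (boundaries p Z) c) = coset (boundaries p W) (lin_chain_map p f c)"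
  unfolding reduced_homology_map_def
  by (rule quotient_map_induced_coset[OF lin_subspace_boundaries lin_subspace_boundaries lin_map_lin_chain_map])
     (rule lin_chain_map_boundaries[OF _ assms])

lemma reduced_homology_cases:
  assumes "\<alpha> \<in> carrier (reduced_homology p Z)"
  obtains c where "c \<in> reduced_cycles p Z" "\<alpha> = coset (boundaries p Z) c"
  using assms unfolding carrier_reduced_homology by (rule imageE)

lemma reduced_homology_map_in:
  assumes "continuous_map Z W f" "\<alpha> \<in> carrier (reduced_homology p Z)"
  shows "reduced_homology_map p W f \<alpha> \<in> carrier (reduced_homology p W)"
  using assms(2)
proof (rule reduced_homology_cases)
  fix c
  assume c: "c \<in> reduced_cycles p Z" "\<alpha> = coset (boundaries p Z) c"
  show ?thesis
    unfolding c(2) reduced_homology_map_coset[OF assms(1)] carrier_reduced_homology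
    by (rule imageI) (rule lin_chain_map_reduced_cycles[OF c(1) assms(1)])
qed

lemma reduced_homology_map_add:
  assumes "continuous_map Z W f" "\<alpha> \<in> carrier (reduced_homology p Z)" "\<beta> \<in> carrier (reduced_homology p Z)"
  shows "reduced_homology_map p W f (\<alpha> \<oplus>\<^bsub>reduced_homology p Z\<^esub> \<beta>)
    = reduced_homology_map p W f \<alpha> \<oplus>\<^bsub>reduced_homology p W\<^esub> reduced_homology_map p W f \<beta>"
proof -
  obtain c where c: "\<alpha> = coset (boundaries p Z) c"
    using assms(2) by (rule reduced_homology_cases)
  obtain d where d: "\<beta> = coset (boundaries p Z) d"
    using assms(3) by (rule reduced_homology_cases)
  show ?thesis
    unfolding c d reduced_homology_def add_quotient_module[OF lin_subspace_boundaries]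
      reduced_homology_map_coset[OF assms(1)] lin_map_add[OF lin_map_lin_chain_map] ..
qed

lemma reduced_homology_map_smult:
  assumes "continuous_map Z W f" "\<alpha> \<in> carrier (reduced_homology p Z)"
  shows "reduced_homology_map p W f (t \<odot>\<^bsub>reduced_homology p Z\<^esub> \<alpha>)
    = t \<odot>\<^bsub>reduced_homology p W\<^esub> reduced_homology_map p W f \<alpha>"
proof -
  obtain c where c: "\<alpha> = coset (boundaries p Z) c"
    using assms(2) by (rule reduced_homology_cases)
  show ?thesis
    unfolding c reduced_homology_def smult_quotient_module[OF lin_subspace_boundaries]
      reduced_homology_map_coset[OF assms(1)] lin_map_scale[OF lin_map_lin_chain_map] ..
qed

lemma reduced_homology_map_zero:
  assumes "continuous_map Z W f"
  shows "reduced_homology_map p W f \<zero>\<^bsub>reduced_homology p Z\<^esub> = \<zero>\<^bsub>reduced_homology p W\<^esub>"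
  unfolding reduced_homology_def zero_quotient_module reduced_homology_map_coset[OF assms]
    lin_map_zero[OF lin_map_lin_chain_map] ..

lemma reduced_homology_map_comp:
  assumes "continuous_map Z W f" "continuous_map W W' f'" "\<alpha> \<in> carrier (reduced_homology p Z)"
  shows "reduced_homology_map p W' f' (reduced_homology_map p W f \<alpha>) = reduced_homology_map p W' (f' \<circ> f) \<alpha>"
proof -
  obtain c where c: "\<alpha> = coset (boundaries p Z) c"
    using assms(3) by (rule reduced_homology_cases)
  show ?thesis
    unfolding c reduced_homology_map_coset[OF assms(1)] reduced_homology_map_coset[OF assms(2)]
      reduced_homology_map_coset[OF continuous_map_compose[OF assms(1,2)]] lin_chain_map_comp ..
qed

lemma reduced_homology_map_ident:
  assumes "\<And>x. x \<in> topspace Z \<Longrightarrow> f x = x" "\<alpha> \<in> carrier (reduced_homology p Z)"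
  shows "reduced_homology_map p Z f \<alpha> = \<alpha>"
  using assms(2)
proof (rule reduced_homology_cases)
  fix c
  assume c: "c \<in> reduced_cycles p Z" "\<alpha> = coset (boundaries p Z) c"
  have f: "continuous_map Z Z f"
    by (rule continuous_map_eq[OF continuous_map_id]) (simp add: assms(1))
  show ?thesis
    unfolding c(2) reduced_homology_map_coset[OF f]
    by (rule arg_cong[OF lin_chain_map_id[OF reduced_cycles_chains[OF c(1)] assms(1)]])
qed


section \<open>The equivariant decomposition\<close>

locale equivariant_polyhedral = polyhedral X A pt V K h U
  for X :: "'a topology" and A :: "'a set" and pt :: 'a and V :: "'v set" and K :: "'v set set"
    and h :: "real \<times> 'a \<Rightarrow> 'a" and U :: "'a set" +
  fixes G :: "('g, 'z) monoid_scheme" and \<phi> :: "'g \<Rightarrow> 'v \<Rightarrow> 'v"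
  assumes group: "group G" and action: "group_action G V \<phi>"
    and invariant: "\<lbrakk>g \<in> carrier G; \<sigma> \<in> K\<rbrakk> \<Longrightarrow> \<phi> g ` \<sigma> \<in> K"
begin

interpretation G: group G
  by (rule group)

lemma \<phi>_in: "\<lbrakk>g \<in> carrier G; v \<in> V\<rbrakk> \<Longrightarrow> \<phi> g v \<in> V"
  using group_action.element_image[OF action] by blast

lemma \<phi>_one: "v \<in> V \<Longrightarrow> \<phi> \<one>\<^bsub>G\<^esub> v = v"
  using group_action.id_eq_one[OF action] by (metis restrict_apply')

lemma \<phi>_mult: "\<lbrakk>g \<in> carrier G; g' \<in> carrier G; v \<in> V\<rbrakk> \<Longrightarrow> \<phi> (g \<otimes>\<^bsub>G\<^esub> g') v = \<phi> g (\<phi> g' v)"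
  using group_action.composition_rule[OF action] by blast

lemma \<phi>_inv:
  assumes "g \<in> carrier G" "v \<in> V"
  shows "\<phi> (inv\<^bsub>G\<^esub> g) (\<phi> g v) = v" "\<phi> g (\<phi> (inv\<^bsub>G\<^esub> g) v) = v"
  using assms \<phi>_mult[of "inv\<^bsub>G\<^esub> g" g v] \<phi>_mult[of g "inv\<^bsub>G\<^esub> g" v] \<phi>_one by simp_all

lemma image_sub: "\<lbrakk>g \<in> carrier G; J \<subseteq> V\<rbrakk> \<Longrightarrow> \<phi> g ` J \<subseteq> V"
  using \<phi>_in by blast

lemma image_one: "J \<subseteq> V \<Longrightarrow> \<phi> \<one>\<^bsub>G\<^esub> ` J = J"
  using \<phi>_one by force

lemma image_mult:
  assumes "g \<in> carrier G" "g' \<in> carrier G" "J \<subseteq> V"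
  shows "\<phi> (g \<otimes>\<^bsub>G\<^esub> g') ` J = \<phi> g ` \<phi> g' ` J"
  unfolding image_image by (rule image_cong) (use assms \<phi>_mult in blast)+

lemma image_inv: "\<lbrakk>g \<in> carrier G; J \<subseteq> V\<rbrakk> \<Longrightarrow> \<phi> g ` \<phi> (inv\<^bsub>G\<^esub> g) ` J = J"
  using image_mult[of g "inv\<^bsub>G\<^esub> g" J] image_one by simp

lemma image_V: "g \<in> carrier G \<Longrightarrow> \<phi> g ` V = V"
  using group_action.surj_prop[OF action] .

abbreviation permute :: "'v set \<Rightarrow> 'g \<Rightarrow> ('v \<Rightarrow> 'a) \<Rightarrow> 'v \<Rightarrow> 'a"
  where "permute \<equiv> permute_coords G \<phi>"

lemma permute_apply: "\<lbrakk>g \<in> carrier G; J \<subseteq> V; v \<in> J\<rbrakk> \<Longrightarrow> permute J g x (\<phi> g v) = x v"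
  using \<phi>_inv(1)[of g v] by (auto simp: permute_coords_def)

lemma permute_eqI:
  assumes "g \<in> carrier G" "J \<subseteq> V" "z \<in> extensional (\<phi> g ` J)" "\<And>v. v \<in> J \<Longrightarrow> z (\<phi> g v) = x v"
  shows "permute J g x = z"
proof
  fix i
  show "permute J g x i = z i"
  proof (cases "i \<in> \<phi> g ` J")
    case True
    then obtain v where v: "v \<in> J" "i = \<phi> g v"
      by blast
    show ?thesis
      unfolding v(2) permute_apply[OF assms(1,2) v(1)] by (rule assms(4)[OF v(1), symmetric])
  next
    case False
    then show ?thesis
      using assms(3) by (simp add: permute_coords_def extensional_def)
  qed
qed

lemma permute_mult:
  assumes g: "g \<in> carrier G" "g' \<in> carrier G" and J: "J \<subseteq> V"
  shows "permute J (g \<otimes>\<^bsub>G\<^esub> g') x = permute (\<phi> g' ` J) g (permute J g' x)"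
proof (rule permute_eqI[OF _ J])
  show "g \<otimes>\<^bsub>G\<^esub> g' \<in> carrier G"
    using g by simp
  show "permute (\<phi> g' ` J) g (permute J g' x) \<in> extensional (\<phi> (g \<otimes>\<^bsub>G\<^esub> g') ` J)"
    unfolding image_mult[OF g J] by (simp add: permute_coords_def)
  show "permute (\<phi> g' ` J) g (permute J g' x) (\<phi> (g \<otimes>\<^bsub>G\<^esub> g') v) = x v" if v: "v \<in> J" for v
  proof -
    have "permute (\<phi> g' ` J) g (permute J g' x) (\<phi> g (\<phi> g' v)) = permute J g' x (\<phi> g' v)"
      by (rule permute_apply[OF g(1) image_sub[OF g(2) J] imageI[OF v]])
    then show ?thesis
      using \<phi>_mult[OF g, of v] v J permute_apply[OF g(2) J v, of x] by auto
  qed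
qed

lemma permute_one: "\<lbrakk>J \<subseteq> V; x \<in> extensional J\<rbrakk> \<Longrightarrow> permute J \<one>\<^bsub>G\<^esub> x = x"
  using image_one \<phi>_one by (intro permute_eqI) auto

lemma permute_Y:
  assumes g: "g \<in> carrier G"
  shows "continuous_map Y Y (permute V g)"
proof (rule continuous_into_Y)
  have ig: "inv\<^bsub>G\<^esub> g \<in> carrier G"
    using g by simp
  have apply_V: "permute V g x v = x (\<phi> (inv\<^bsub>G\<^esub> g) v)" if "v \<in> V" for x v
    using that image_V[OF g] by (simp add: permute_coords_def)
  show "continuous_map Y X (\<lambda>x. permute V g x v)" if v: "v \<in> V" for v
    unfolding apply_V[OF v] by (rule continuous_coord[OF \<phi>_in[OF ig v]])
  fix x
  assume "x \<in> topspace Y"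
  then obtain \<sigma> where \<sigma>: "\<sigma> \<in> K" "\<forall>j\<in>V - \<sigma>. x j \<in> A"
    by (auto simp: topspace_Y)
  have "permute V g x j \<in> A" if j: "j \<in> V - \<phi> g ` \<sigma>" for j
  proof -
    have "\<phi> (inv\<^bsub>G\<^esub> g) j \<notin> \<sigma>"
      using j \<phi>_inv(2)[OF g, of j] by force
    then show ?thesis
      using \<sigma>(2) j \<phi>_in[OF ig, of j] by (simp add: apply_V)
  qed
  then have "\<forall>j\<in>V - \<phi> g ` \<sigma>. permute V g x j \<in> A"
    by blast
  moreover have "permute V g x \<in> extensional V"
    using image_V[OF g] by (simp add: permute_coords_def)
  ultimately show "permute V g x \<in> extensional V \<and> (\<exists>\<sigma>\<in>K. \<forall>j\<in>V - \<sigma>. permute V g x j \<in> A)"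
    using invariant[OF g \<sigma>(1)] by blast
qed

lemma proj_permute:
  assumes g: "g \<in> carrier G" and J: "J \<subseteq> V"
  shows "permute J g (proj J x) = proj (\<phi> g ` J) (permute V g x)"
proof (rule permute_eqI[OF g J])
  show "proj (\<phi> g ` J) (permute V g x) \<in> extensional (\<phi> g ` J)"
    by (simp add: proj_def collapse_fat_wedge_def)
  have coord: "permute V g x (\<phi> g v) = x v" if "v \<in> J" for v
    using that J by (intro permute_apply[OF g]) auto
  show "proj (\<phi> g ` J) (permute V g x) (\<phi> g v) = proj J x v" if "v \<in> J" for v
    using that coord by (simp add: proj_def collapse_fat_wedge_def)
qed

text \<open>
  Continuity can be tested on the polyhedral product, of which the smash product is a quotient.
\<close>

lemma permute_smash:
  assumes g: "g \<in> carrier G" and J: "J \<subseteq> V" "J \<noteq> {}"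
  shows "continuous_map (smash J) (smash (\<phi> g ` J)) (permute J g)"
proof (rule continuous_compose_quotient_map[OF proj_quotient_map[OF J]])
  have "continuous_map Y (smash (\<phi> g ` J)) (proj (\<phi> g ` J) \<circ> permute V g)"
    by (rule continuous_map_compose[OF permute_Y[OF g] continuous_proj[OF image_sub[OF g J(1)]]])
  moreover have "proj (\<phi> g ` J) \<circ> permute V g = permute J g \<circ> proj J"
    using proj_permute[OF g J(1)] by (simp add: fun_eq_iff)
  ultimately show "continuous_map (part_top J) (smash (\<phi> g ` J)) (permute J g \<circ> proj J)"
    by (simp add: continuous_map_from_subtopology)
qed

abbreviation subsets :: "'v set set"
  where "subsets \<equiv> Pow V - {{}}"

lemma smash_homology_eq: "smash_homology X A pt K i J = reduced_homology i (smash J)"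
  by (simp add: smash_homology_def smash_def)

lemma smash_homology_map_eq:
  "smash_homology_map X A pt K G \<phi> i J g = reduced_homology_map i (smash (\<phi> g ` J)) (permute J g)"
  by (simp add: smash_homology_map_def smash_def)

lemma group_ring_module_product:
  "group_ring_module ring_of_type_algebra G
    (reduced_homology i Y :: ('k::comm_ring_1, ('v \<Rightarrow> 'a, 'k) lin_chain set) module)
    (product_homology_action X A V K G \<phi> i)"
proof (intro group_ring_module.intro module_reduced_homology group group_ring_module_axioms.intro)
  fix g and \<alpha> \<beta> :: "('v \<Rightarrow> 'a, 'k) lin_chain set" and t :: 'k
  assume g: "g \<in> carrier G" and \<alpha>: "\<alpha> \<in> carrier (reduced_homology i Y)"
  note act = product_homology_action_def
  show "product_homology_action X A V K G \<phi> i g \<alpha> \<in> carrier (reduced_homology i Y)"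
    unfolding act by (rule reduced_homology_map_in[OF permute_Y[OF g] \<alpha>])
  show "product_homology_action X A V K G \<phi> i g (t \<odot>\<^bsub>reduced_homology i Y\<^esub> \<alpha>)
      = t \<odot>\<^bsub>reduced_homology i Y\<^esub> product_homology_action X A V K G \<phi> i g \<alpha>"
    unfolding act by (rule reduced_homology_map_smult[OF permute_Y[OF g] \<alpha>])
  show "product_homology_action X A V K G \<phi> i g (\<alpha> \<oplus>\<^bsub>reduced_homology i Y\<^esub> \<beta>)
      = product_homology_action X A V K G \<phi> i g \<alpha>
        \<oplus>\<^bsub>reduced_homology i Y\<^esub> product_homology_action X A V K G \<phi> i g \<beta>"
    if "\<beta> \<in> carrier (reduced_homology i Y)"
    unfolding act by (rule reduced_homology_map_add[OF permute_Y[OF g] \<alpha> that])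
  show "product_homology_action X A V K G \<phi> i (g \<otimes>\<^bsub>G\<^esub> g') \<alpha>
      = product_homology_action X A V K G \<phi> i g (product_homology_action X A V K G \<phi> i g' \<alpha>)"
    if g': "g' \<in> carrier G" for g'
  proof -
    have "permute V (g \<otimes>\<^bsub>G\<^esub> g') = permute V g \<circ> permute V g'"
      using permute_mult[OF g g' order_refl] image_V[OF g'] by (simp add: fun_eq_iff)
    then show ?thesis
      unfolding act reduced_homology_map_comp[OF permute_Y[OF g'] permute_Y[OF g] \<alpha>] by simp
  qed
next
  fix \<alpha> :: "('v \<Rightarrow> 'a, 'k) lin_chain set"
  assume "\<alpha> \<in> carrier (reduced_homology i Y)"
  then show "product_homology_action X A V K G \<phi> i \<one>\<^bsub>G\<^esub> \<alpha> = \<alpha>"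
    unfolding product_homology_action_def
    by (intro reduced_homology_map_ident permute_one order_refl) (auto simp: topspace_Y)
qed

definition to_smashes :: "nat \<Rightarrow> ('v \<Rightarrow> 'a, 'k::comm_ring_1) lin_chain set \<Rightarrow> 'v set \<Rightarrow> ('v \<Rightarrow> 'a, 'k) lin_chain set"
  where "to_smashes i \<alpha> = (\<lambda>J\<in>subsets. reduced_homology_map i (smash J) (proj J) \<alpha>)"

lemma finite_subsets: "finite subsets"
  using finite_V by simp

lemma carrier_smash_sum:
  "carrier (direct_sum_module subsets (smash_homology X A pt K i)) = (\<Pi>\<^sub>E J\<in>subsets. carrier (reduced_homology i (smash J)))"
  using finite_subsets by (simp add: direct_sum_module_def smash_homology_eq)

text \<open>
  Injectivity and surjectivity in terms of cosets of cycles are the two halves of the homology splitting.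
\<close>

lemma to_smashes_bij:
  "bij_betw (to_smashes i) (carrier (reduced_homology i Y :: ('k::comm_ring_1, ('v \<Rightarrow> 'a, 'k) lin_chain set) module))
    (carrier (direct_sum_module subsets (smash_homology X A pt K i)))"
  unfolding carrier_smash_sum
proof (rule bij_betw_imageI)
  interpret S: splitting Y V retract smash proj "\<lambda>j. {x. x j \<in> U}" homotopy base
    by (rule splitting_Y)
  have proj: "continuous_map Y (smash J) (proj J)" if "J \<in> subsets" for J
    using that continuous_proj by simp
  show "inj_on (to_smashes i) (carrier (reduced_homology i Y :: ('k, _) module))"
  proof (rule inj_onI)
    fix \<alpha> \<beta> :: "('v \<Rightarrow> 'a, 'k) lin_chain set"
    assume \<alpha>: "\<alpha> \<in> carrier (reduced_homology i Y)" and \<beta>: "\<beta> \<in> carrier (reduced_homology i Y)"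
      and eq: "to_smashes i \<alpha> = to_smashes i \<beta>"
    obtain c where c: "c \<in> reduced_cycles i Y" "\<alpha> = coset (boundaries i Y) c"
      using \<alpha> by (rule reduced_homology_cases)
    obtain d where d: "d \<in> reduced_cycles i Y" "\<beta> = coset (boundaries i Y) d"
      using \<beta> by (rule reduced_homology_cases)
    have "lin_chain_map i (proj J) (c - d) \<in> boundaries i (smash J)" if J: "J \<subseteq> V" "J \<noteq> {}" for J
    proof -
      have J': "J \<in> subsets"
        using J by simp
      have "reduced_homology_map i (smash J) (proj J) \<alpha> = reduced_homology_map i (smash J) (proj J) \<beta>"
        using fun_cong[OF eq, of J] J' by (simp only: to_smashes_def restrict_apply')
      then show ?thesis
        unfolding c(2) d(2) reduced_homology_map_coset[OF proj[OF J']] coset_eq_iff[OF lin_subspace_boundaries]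
          lin_map_diff[OF lin_map_lin_chain_map] .
    qed
    then have "c - d \<in> boundaries i Y"
      by (rule S.homology_splitting_injective[OF reduced_cycles_diff[OF c(1) d(1)]])
    then show "\<alpha> = \<beta>"
      unfolding c(2) d(2) coset_eq_iff[OF lin_subspace_boundaries] .
  qed
  show "to_smashes i ` carrier (reduced_homology i Y :: ('k, _) module) = (\<Pi>\<^sub>E J\<in>subsets. carrier (reduced_homology i (smash J)))"
  proof (intro equalityI subsetI)
    fix f :: "'v set \<Rightarrow> ('v \<Rightarrow> 'a, 'k) lin_chain set"
    assume "f \<in> to_smashes i ` carrier (reduced_homology i Y)"
    then obtain \<alpha> where \<alpha>: "\<alpha> \<in> carrier (reduced_homology i Y)" "f = to_smashes i \<alpha>"
      by (rule imageE)
    show "f \<in> (\<Pi>\<^sub>E J\<in>subsets. carrier (reduced_homology i (smash J)))"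
      unfolding \<alpha>(2) to_smashes_def restrict_PiE_iff using reduced_homology_map_in[OF proj \<alpha>(1)] by (rule ballI)
  next
    fix f :: "'v set \<Rightarrow> ('v \<Rightarrow> 'a, 'k) lin_chain set"
    assume f: "f \<in> (\<Pi>\<^sub>E J\<in>subsets. carrier (reduced_homology i (smash J)))"
    have "\<forall>J\<in>subsets. \<exists>d. d \<in> reduced_cycles i (smash J) \<and> f J = coset (boundaries i (smash J)) d"
    proof
      fix J
      assume "J \<in> subsets"
      then have "f J \<in> carrier (reduced_homology i (smash J))"
        using f by (rule PiE_mem[rotated])
      then show "\<exists>d. d \<in> reduced_cycles i (smash J) \<and> f J = coset (boundaries i (smash J)) d"
        by (rule reduced_homology_cases) (intro exI conjI)
    qed
    then obtain D where D: "\<forall>J\<in>subsets. D J \<in> reduced_cycles i (smash J) \<and> f J = coset (boundaries i (smash J)) (D J)"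
      unfolding bchoice_iff by (rule exE)
    have D_cycle: "D J \<in> reduced_cycles i (smash J)" if "J \<subseteq> V" "J \<noteq> {}" for J
      using D that by simp
    obtain c where c: "c \<in> reduced_cycles i Y"
        "\<And>J. \<lbrakk>J \<subseteq> V; J \<noteq> {}\<rbrakk> \<Longrightarrow> lin_chain_map i (proj J) c - D J \<in> boundaries i (smash J)"
      using S.homology_splitting_surjective[of D i, OF D_cycle] by metis
    have "to_smashes i (coset (boundaries i Y) c) = f"
    proof (rule extensionalityI)
      show "to_smashes i (coset (boundaries i Y) c) \<in> extensional subsets"
        unfolding to_smashes_def by (rule restrict_extensional)
      show "f \<in> extensional subsets"
        using f by (simp only: PiE_def Int_iff)
      fix J
      assume J: "J \<in> subsets"
      have fJ: "f J = coset (boundaries i (smash J)) (D J)"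
        using D J by simp
      show "to_smashes i (coset (boundaries i Y) c) J = f J"
        unfolding to_smashes_def restrict_apply'[OF J] reduced_homology_map_coset[OF proj[OF J]] fJ
          coset_eq_iff[OF lin_subspace_boundaries]
        using J by (intro c(2)) auto
    qed
    moreover have "coset (boundaries i Y) c \<in> carrier (reduced_homology i Y)"
      unfolding carrier_reduced_homology using c(1) by (rule imageI)
    ultimately show "f \<in> to_smashes i ` carrier (reduced_homology i Y)"
      by (intro image_eqI[where x = "coset (boundaries i Y) c"]) (rule sym)
  qed
qed

text \<open>
  The map is equivariant because the projections commute with the permutations of coordinates and homology
  is a functor.
\<close>

theorem product_isomorphic_smash_sum:
  "group_ring_isomorphic (ring_of_type_algebra :: 'k::comm_ring_1 ring) G
    (reduced_homology i Y) (product_homology_action X A V K G \<phi> i)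
    (direct_sum_module subsets (smash_homology X A pt K i)) (smash_sum_action X A pt K G \<phi> i subsets)"
proof (rule group_ring_isomorphic_via[OF group_ring_module_product to_smashes_bij])
  have proj: "continuous_map Y (smash J) (proj J)" if "J \<in> subsets" for J
    using that continuous_proj by simp
  fix \<alpha> \<beta> :: "('v \<Rightarrow> 'a, 'k) lin_chain set" and t :: 'k
  assume \<alpha>: "\<alpha> \<in> carrier (reduced_homology i Y)"
  show "to_smashes i (\<alpha> \<oplus>\<^bsub>reduced_homology i Y\<^esub> \<beta>)
      = to_smashes i \<alpha> \<oplus>\<^bsub>direct_sum_module subsets (smash_homology X A pt K i)\<^esub> to_smashes i \<beta>"
    if \<beta>: "\<beta> \<in> carrier (reduced_homology i Y)"
    using reduced_homology_map_add[OF proj \<alpha> \<beta>]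
    by (simp add: to_smashes_def direct_sum_module_def smash_homology_eq cong: restrict_cong)
  show "to_smashes i (t \<odot>\<^bsub>reduced_homology i Y\<^esub> \<alpha>)
      = t \<odot>\<^bsub>direct_sum_module subsets (smash_homology X A pt K i)\<^esub> to_smashes i \<alpha>"
    using reduced_homology_map_smult[OF proj \<alpha>]
    by (simp add: to_smashes_def direct_sum_module_def smash_homology_eq cong: restrict_cong)
  fix g
  assume g: "g \<in> carrier G"
  show "to_smashes i (product_homology_action X A V K G \<phi> i g \<alpha>)
      = smash_sum_action X A pt K G \<phi> i subsets g (to_smashes i \<alpha>)"
    unfolding smash_sum_action_def Let_def to_smashes_def
  proof (rule restrict_ext)
    fix J
    assume J: "J \<in> subsets"
    let ?J = "\<phi> (inv\<^bsub>G\<^esub> g) ` J"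
    have J': "?J \<in> subsets" "?J \<subseteq> V" "?J \<noteq> {}"
      using J image_sub[of "inv\<^bsub>G\<^esub> g" J] g by auto
    have gJ: "\<phi> g ` ?J = J"
      using image_inv[OF g] J by simp
    have "reduced_homology_map i (smash J) (proj J) (product_homology_action X A V K G \<phi> i g \<alpha>)
        = reduced_homology_map i (smash J) (proj J \<circ> permute V g) \<alpha>"
      unfolding product_homology_action_def by (rule reduced_homology_map_comp[OF permute_Y[OF g] proj[OF J] \<alpha>])
    also have "proj J \<circ> permute V g = permute ?J g \<circ> proj ?J"
      using proj_permute[OF g J'(2)] unfolding gJ by (simp add: fun_eq_iff)
    also have "reduced_homology_map i (smash J) (permute ?J g \<circ> proj ?J) \<alpha>
        = reduced_homology_map i (smash J) (permute ?J g) (reduced_homology_map i (smash ?J) (proj ?J) \<alpha>)"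
      using permute_smash[OF g J'(2,3)] unfolding gJ
      by (rule reduced_homology_map_comp[OF proj[OF J'(1)] _ \<alpha>, symmetric])
    also have "\<dots> = smash_homology_map X A pt K G \<phi> i ?J g ((\<lambda>J\<in>subsets. reduced_homology_map i (smash J) (proj J) \<alpha>) ?J)"
      unfolding smash_homology_map_eq gJ restrict_apply'[OF J'(1)] ..
    finally show "reduced_homology_map i (smash J) (proj J) (product_homology_action X A V K G \<phi> i g \<alpha>)
        = smash_homology_map X A pt K G \<phi> i ?J g ((\<lambda>J\<in>subsets. reduced_homology_map i (smash J) (proj J) \<alpha>) ?J)" .
  qed
next
  have proj: "continuous_map Y (smash J) (proj J)" if "J \<in> subsets" for J
    using that continuous_proj by simp
  show "to_smashes i \<zero>\<^bsub>reduced_homology i Y\<^esub> = \<zero>\<^bsub>direct_sum_module subsets (smash_homology X A pt K i)\<^esub>"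
    by (simp add: to_smashes_def direct_sum_module_def smash_homology_eq fun_eq_iff restrict_def
        reduced_homology_map_zero[OF proj])
qed

theorem smash_sum_isomorphic_induced:
  assumes T: "orbit_representatives G \<phi> subsets T"
  shows "group_ring_isomorphic (ring_of_type_algebra :: 'k::comm_ring_1 ring) G
    (direct_sum_module subsets (smash_homology X A pt K i)) (smash_sum_action X A pt K G \<phi> i subsets)
    (direct_sum_module T (\<lambda>J. induced_module G (set_stabilizer G \<phi> J) (smash_homology X A pt K i J)
      (smash_homology_map X A pt K G \<phi> i J)))
    (direct_sum_action T (\<lambda>J. induced_action G (set_stabilizer G \<phi> J) (smash_homology X A pt K i J)
      (smash_homology_map X A pt K G \<phi> i J)))"
proof -
  let ?a = "\<lambda>g J. \<phi> g ` J"
  have smash: "continuous_map (smash J) (smash (\<phi> g ` J)) (permute J g)" if "g \<in> carrier G" "J \<in> subsets" for g J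
    using that by (intro permute_smash) auto
  have orbit_sym: "(\<exists>g\<in>carrier G. \<phi> g ` J' = J) \<longleftrightarrow> J' \<in> orbit G ?a J" if J: "J \<in> subsets" "J' \<in> subsets" for J J'
  proof
    assume "\<exists>g\<in>carrier G. \<phi> g ` J' = J"
    then obtain g where g: "g \<in> carrier G" "\<phi> g ` J' = J"
      by blast
    have "\<phi> (inv\<^bsub>G\<^esub> g) ` J = J'"
      using image_inv[of "inv\<^bsub>G\<^esub> g" J'] g J by simp
    then show "J' \<in> orbit G ?a J"
      using g(1) by (auto simp: orbit_def)
  next
    assume "J' \<in> orbit G ?a J"
    then obtain g where g: "g \<in> carrier G" "J' = \<phi> g ` J"
      by (auto simp: orbit_def)
    have "\<phi> (inv\<^bsub>G\<^esub> g) ` J' = J"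
      unfolding g(2) using image_inv[of "inv\<^bsub>G\<^esub> g" J] g(1) J by simp
    then show "\<exists>g\<in>carrier G. \<phi> g ` J' = J"
      using g(1) by (intro bexI[of _ "inv\<^bsub>G\<^esub> g"]) auto
  qed
  interpret P: permuted_modules G subsets ?a "smash_homology X A pt K i :: 'v set \<Rightarrow> ('k, ('v \<Rightarrow> 'a, 'k) lin_chain set) module"
      "smash_homology_map X A pt K G \<phi> i" T
  proof (rule permuted_modules.intro)
    show "group G"
      by (rule group)
    show "finite subsets"
      by (rule finite_subsets)
    show "\<phi> g ` J \<in> subsets" if "g \<in> carrier G" "J \<in> subsets" for g J
      using that image_sub by auto
    show "\<phi> \<one>\<^bsub>G\<^esub> ` J = J" if "J \<in> subsets" for J
      using that image_one by simp
    show "\<phi> (g \<otimes>\<^bsub>G\<^esub> g') ` J = \<phi> g ` \<phi> g' ` J" if "g \<in> carrier G" "g' \<in> carrier G" "J \<in> subsets" for g g' J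
      using that by (intro image_mult) auto
    show "T \<subseteq> subsets"
      using T by (simp add: orbit_representatives_def)
    show "\<exists>!J'. J' \<in> T \<and> (\<exists>g\<in>carrier G. \<phi> g ` J' = J)" if J: "J \<in> subsets" for J
    proof -
      have "orbit G ?a J \<in> orbits G subsets ?a"
        using J by (auto simp: orbits_def)
      then have "\<exists>!J'. J' \<in> T \<inter> orbit G ?a J" and "T \<subseteq> subsets"
        using T unfolding orbit_representatives_def by blast+
      moreover have "(J' \<in> T \<and> (\<exists>g\<in>carrier G. \<phi> g ` J' = J)) \<longleftrightarrow> J' \<in> T \<inter> orbit G ?a J" for J'
        using orbit_sym[OF J, of J'] \<open>T \<subseteq> subsets\<close> by blast
      ultimately show ?thesis
        by simp
    qed
  next
    fix J
    assume J: "J \<in> subsets"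
    show "module (ring_of_type_algebra :: 'k ring) (smash_homology X A pt K i J)"
      unfolding smash_homology_eq by (rule module_reduced_homology)
    fix \<alpha> :: "('v \<Rightarrow> 'a, 'k) lin_chain set"
    assume \<alpha>: "\<alpha> \<in> carrier (smash_homology X A pt K i J)"
    show "smash_homology_map X A pt K G \<phi> i J \<one>\<^bsub>G\<^esub> \<alpha> = \<alpha>"
    proof -
      have "permute J \<one>\<^bsub>G\<^esub> x = x" if "x \<in> topspace (smash J)" for x
      proof -
        have "x \<in> extensional J"
          using that by (auto simp: topspace_smash collapse_fat_wedge_def PiE_def)
        then show ?thesis
          using J by (intro permute_one) auto
      qed
      then show ?thesis
        using \<alpha> J unfolding smash_homology_map_eq smash_homology_eq
        by (simp add: image_one reduced_homology_map_ident)
    qed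
    fix g
    assume g: "g \<in> carrier G"
    show "smash_homology_map X A pt K G \<phi> i J g \<alpha> \<in> carrier (smash_homology X A pt K i (\<phi> g ` J))"
      using \<alpha> unfolding smash_homology_map_eq smash_homology_eq by (rule reduced_homology_map_in[OF smash[OF g J]])
    show "smash_homology_map X A pt K G \<phi> i J g (\<alpha> \<oplus>\<^bsub>smash_homology X A pt K i J\<^esub> \<beta>)
        = smash_homology_map X A pt K G \<phi> i J g \<alpha>
          \<oplus>\<^bsub>smash_homology X A pt K i (\<phi> g ` J)\<^esub> smash_homology_map X A pt K G \<phi> i J g \<beta>"
      if "\<beta> \<in> carrier (smash_homology X A pt K i J)" for \<beta>
      using \<alpha> that unfolding smash_homology_map_eq smash_homology_eq by (rule reduced_homology_map_add[OF smash[OF g J]])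
    show "smash_homology_map X A pt K G \<phi> i J g (t \<odot>\<^bsub>smash_homology X A pt K i J\<^esub> \<alpha>)
        = t \<odot>\<^bsub>smash_homology X A pt K i (\<phi> g ` J)\<^esub> smash_homology_map X A pt K G \<phi> i J g \<alpha>" for t
      using \<alpha> unfolding smash_homology_map_eq smash_homology_eq by (rule reduced_homology_map_smult[OF smash[OF g J]])
    show "smash_homology_map X A pt K G \<phi> i J (g' \<otimes>\<^bsub>G\<^esub> g) \<alpha>
        = smash_homology_map X A pt K G \<phi> i (\<phi> g ` J) g' (smash_homology_map X A pt K G \<phi> i J g \<alpha>)"
      if g': "g' \<in> carrier G" for g'
    proof -
      have J': "J \<subseteq> V" "\<phi> g ` J \<in> subsets"
        using J image_sub[OF g] by auto
      have "permute J (g' \<otimes>\<^bsub>G\<^esub> g) = permute (\<phi> g ` J) g' \<circ> permute J g"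
        using permute_mult[OF g' g J'(1)] by (simp add: fun_eq_iff)
      then show ?thesis
        unfolding smash_homology_map_eq image_mult[OF g' g J'(1)]
          reduced_homology_map_comp[OF smash[OF g J] smash[OF g' J'(2)] \<alpha>[unfolded smash_homology_eq]]
        by simp
    qed
  qed
  have stab: "P.stab = set_stabilizer G \<phi>"
    by (auto simp: fun_eq_iff P.stab_def set_stabilizer_def stabilizer_def)
  have act: "P.sum_act = smash_sum_action X A pt K G \<phi> i subsets"
    by (simp add: fun_eq_iff P.sum_act_def smash_sum_action_def Let_def)
  have "group_ring_module (ring_of_type_algebra :: 'k ring) G
      (direct_sum_module subsets (smash_homology X A pt K i)) (smash_sum_action X A pt K G \<phi> i subsets)"
    using product_isomorphic_smash_sum[where 'k = 'k and i = i] unfolding group_ring_isomorphic_def by (elim conjE)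
  from P.sum_isomorphic_induced[unfolded act stab, OF this] show ?thesis .
qed

end

theorem theorem3p5:
  fixes k :: "'k::comm_ring_1 ring"
    and G :: "('g, 'z) monoid_scheme"
    and \<phi> :: "'g \<Rightarrow> nat \<Rightarrow> nat"
    and m i :: nat
    and K T :: "nat set set"
    and X :: "'a topology" and A :: "'a set" and pt :: 'a
  assumes "k = ring_of_type_algebra" and "field k \<or> k \<simeq> \<Z>"
    and "group G" and "finite (carrier G)"
    and "simplicial_group_complex G \<phi> {1..m} K"
    and "based_cw_pair X A pt" and "connected_space X" and "connectedin X A"
    and "orbit_representatives G \<phi> (Pow {1..m} - {{}}) T"
  shows "group_ring_isomorphic k G
      (reduced_homology i (polyhedral_product X A {1..m} K))
      (product_homology_action X A {1..m} K G \<phi> i)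
      (direct_sum_module (Pow {1..m} - {{}}) (smash_homology X A pt K i))
      (smash_sum_action X A pt K G \<phi> i (Pow {1..m} - {{}}))
    \<and> group_ring_isomorphic k G
      (direct_sum_module (Pow {1..m} - {{}}) (smash_homology X A pt K i))
      (smash_sum_action X A pt K G \<phi> i (Pow {1..m} - {{}}))
      (direct_sum_module T
        (\<lambda>J. induced_module G (set_stabilizer G \<phi> J) (smash_homology X A pt K i J)
               (smash_homology_map X A pt K G \<phi> i J)))
      (direct_sum_action T
        (\<lambda>J. induced_action G (set_stabilizer G \<phi> J) (smash_homology X A pt K i J)
               (smash_homology_map X A pt K G \<phi> i J)))"
proof -
  obtain H U where H: "continuous_map (prod_topology (top_of_set {0..1::real}) X) X H" "openin X U" "pt \<in> U"
      "\<And>x. x \<in> topspace X \<Longrightarrow> H (0, x) = x" "\<And>t. H (t, pt) = pt"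
      "\<And>x. x \<in> U \<Longrightarrow> H (1, x) = pt" "\<And>t x. \<lbrakk>t \<in> {0..1}; x \<in> A\<rbrakk> \<Longrightarrow> H (t, x) \<in> A"
    using based_cw_pair_contraction[OF assms(6)] by metis
  have K: "simplicial_complex_on {1..m} K" "group_action G {1..m} \<phi>"
      "\<And>g \<sigma>. \<lbrakk>g \<in> carrier G; \<sigma> \<in> K\<rbrakk> \<Longrightarrow> \<phi> g ` \<sigma> \<in> K"
    using assms(5) unfolding simplicial_group_complex_def by blast+
  interpret equivariant_polyhedral X A pt "{1..m}" K H U G \<phi>
    by (intro equivariant_polyhedral.intro polyhedral.intro equivariant_polyhedral_axioms.intro
        finite_atLeastAtMost based_cw_pair_closed[OF assms(6)] H K assms(3))
  show ?thesis
    unfolding assms(1) using product_isomorphic_smash_sum smash_sum_isomorphic_induced[OF assms(9)] by (rule conjI)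
qed


end
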